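(* If $f\in\mathcal{D}(A^2)=\mathcal{D}(S)=B=D$ (these four sets of functions on $(-1,1)$ coincide), then (i) $f''\in L^2(-1,1)$, so $f,f'\in AC[-1,1]$; (ii) $\ell'[f]\in L^2(-1,1)$ and $\ell[f]\in AC[-1,1]$.
   Context: $AC_{\mathrm{loc}}(-1,1)$ denotes the complex-valued functions on $(-1,1)$ that are absolutely continuous on every compact subinterval; a function on $(-1,1)$ is said to belong to $AC[-1,1]$ if it extends to an absolutely continuous function on $[-1,1]$. The Legendre expression is $\ell[y](x)=-\left((1-x^2)y'(x)\right)'$, and $\ell'[f]:=(\ell[f])'$. The Legendre polynomials operator $A$ in $L^2(-1,1)$ is $Af=\ell[f]$ with domain $$\mathcal{D}(A)=\{f:(-1,1)\to\mathbb{C}\mid f,f'\in AC_{\mathrm{loc}}(-1,1);\ f,\ell[f]\in L^2(-1,1);\ \lim_{x\to\pm1}(1-x^2)f'(x)=0\},$$ and $\mathcal{D}(A^2)=\{f\in\mathcal{D}(A)\mid Af\in\mathcal{D}(A)\}$ ("$Af\in\mathcal{D}(A)$" is understood up to a.e. equality). The square of the Legendre expression is $\ell^2[y](x)=\left((1-x^2)^2y''(x)\right)''-2\left((1-x^2)y'(x)\right)'$. Put $$\Delta_{2,\max}=\{f:(-1,1)\to\mathbb{C}\mid f,f',f'',f'''\in AC_{\mathrm{loc}}(-1,1);\ f,\ell^2[f]\in L^2(-1,1)\},$$ and for $f\in\Delta_{2,\max}$ put $[f,1]_2(x)=\left((1-x^2)^2f''(x)\right)'-2(1-x^2)f'(x)$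 and $[f,x]_2(x)=x[f,1]_2(x)-(1-x^2)^2f''(x)+2(1-x^2)f(x)$. Then: $\mathcal{D}(S)=\{f\in\Delta_{2,\max}\mid \lim_{x\to\pm1}[f,1]_2(x)=0;\ \lim_{x\to\pm1}[f,x]_2(x)=0\}$; $B=\{f:(-1,1)\to\mathbb{C}\mid f,f',f'',f'''\in AC_{\mathrm{loc}}(-1,1);\ (1-x^2)^2f^{(4)}\in L^2(-1,1)\}$; $D=\{f\in\Delta_{2,\max}\mid \lim_{x\to\pm1}(1-x^2)f'(x)=0;\ \lim_{x\to\pm1}\left((1-x^2)^2f''(x)\right)'=0\}$. A limit "$x\to\pm1$" means both one-sided limits, $x\to1^-$ and $x\to-1^+$. *)

theory Defs
  imports "HOL-Analysis.Analysis"
begin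

(* Functions on (-1,1) are represented by total functions real => complex; every notion
   below except AC_on depends only on the values taken on {-1<..<1}. *)

definition AC_on :: "real \<Rightarrow> real \<Rightarrow> (real \<Rightarrow> complex) \<Rightarrow> bool" where
  "AC_on a b f \<longleftrightarrow>
     (\<forall>\<epsilon>>0. \<exists>\<delta>>0. \<forall>(n::nat) (u::nat \<Rightarrow> real) (v::nat \<Rightarrow> real).
        (\<forall>i<n. a \<le> u i \<and> u i \<le> v i \<and> v i \<le> b) \<and>
        (\<forall>i<n. \<forall>j<n. i \<noteq> j \<longrightarrow> {u i<..<v i} \<inter> {u j<..<v j} = {}) \<and>
        (\<Sum>i<n. v i - u i) < \<delta>
        \<longrightarrow> (\<Sum>i<n. cmod (f (v i) - f (u i))) < \<epsilon>)"

definition AC_loc :: "(real \<Rightarrow> complex) set" where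
  "AC_loc = {f. \<forall>a b. -1 < a \<and> a \<le> b \<and> b < 1 \<longrightarrow> AC_on a b f}"

definition AC_closed :: "(real \<Rightarrow> complex) set" where
  "AC_closed = {f. \<exists>g. AC_on (-1) 1 g \<and> (\<forall>x\<in>{-1<..<1}. g x = f x)}"

definition L2 :: "(real \<Rightarrow> complex) set" where
  "L2 = {f. f \<in> borel_measurable (lebesgue_on {-1<..<1}) \<and>
            integrable (lebesgue_on {-1<..<1}) (\<lambda>x. (cmod (f x))\<^sup>2)}"

(* At a point where f is not differentiable, vd f takes an unspecified fixed value.  The highest
   derivative occurring in an L2 condition below is that of a locally absolutely continuous
   function, so this affects only a null set. *)
definition vd :: "(real \<Rightarrow> complex) \<Rightarrow> real \<Rightarrow> complex" where
  "vd f = (\<lambda>x. vector_derivative f (at x))"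

(* f, f', ..., f^(n) all exist on (-1,1) and are locally absolutely continuous there. *)
definition AC_loc_upto :: "nat \<Rightarrow> (real \<Rightarrow> complex) set" where
  "AC_loc_upto n = {f. (\<forall>k<n. \<forall>x\<in>{-1<..<1}. (vd ^^ k) f differentiable (at x)) \<and>
                       (\<forall>k\<le>n. (vd ^^ k) f \<in> AC_loc)}"

definition lim_pm1 :: "(real \<Rightarrow> complex) \<Rightarrow> complex \<Rightarrow> bool" where
  "lim_pm1 f c \<longleftrightarrow> (f \<longlongrightarrow> c) (at_left 1) \<and> (f \<longlongrightarrow> c) (at_right (-1))"

definition leg :: "(real \<Rightarrow> complex) \<Rightarrow> real \<Rightarrow> complex" where
  "leg y = (\<lambda>x. - vd (\<lambda>t. (1 - t\<^sup>2) *\<^sub>R vd y t) x)"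

definition leg_sq :: "(real \<Rightarrow> complex) \<Rightarrow> real \<Rightarrow> complex" where
  "leg_sq y = (\<lambda>x. (vd ^^ 2) (\<lambda>t. ((1 - t\<^sup>2)\<^sup>2) *\<^sub>R (vd ^^ 2) y t) x
                   - 2 * vd (\<lambda>t. (1 - t\<^sup>2) *\<^sub>R vd y t) x)"

definition dom_A :: "(real \<Rightarrow> complex) set" where
  "dom_A = {f \<in> AC_loc_upto 1. f \<in> L2 \<and> leg f \<in> L2 \<and>
              lim_pm1 (\<lambda>x. (1 - x\<^sup>2) *\<^sub>R vd f x) 0}"

definition dom_A_sq :: "(real \<Rightarrow> complex) set" where
  "dom_A_sq = {f \<in> dom_A. \<exists>g\<in>dom_A. AE x in lebesgue_on {-1<..<1}. g x = leg f x}"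

definition Delta2_max :: "(real \<Rightarrow> complex) set" where
  "Delta2_max = {f \<in> AC_loc_upto 3. f \<in> L2 \<and> leg_sq f \<in> L2}"

definition bracket_1 :: "(real \<Rightarrow> complex) \<Rightarrow> real \<Rightarrow> complex" where
  "bracket_1 f = (\<lambda>x. vd (\<lambda>t. ((1 - t\<^sup>2)\<^sup>2) *\<^sub>R (vd ^^ 2) f t) x
                      - 2 * ((1 - x\<^sup>2) *\<^sub>R vd f x))"

definition bracket_x :: "(real \<Rightarrow> complex) \<Rightarrow> real \<Rightarrow> complex" where
  "bracket_x f = (\<lambda>x. x *\<^sub>R bracket_1 f x - ((1 - x\<^sup>2)\<^sup>2) *\<^sub>R (vd ^^ 2) f x
                      + 2 * ((1 - x\<^sup>2) *\<^sub>R f x))"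

definition dom_S :: "(real \<Rightarrow> complex) set" where
  "dom_S = {f \<in> Delta2_max. lim_pm1 (bracket_1 f) 0 \<and> lim_pm1 (bracket_x f) 0}"

definition set_B :: "(real \<Rightarrow> complex) set" where
  "set_B = {f \<in> AC_loc_upto 3. (\<lambda>x. ((1 - x\<^sup>2)\<^sup>2) *\<^sub>R (vd ^^ 4) f x) \<in> L2}"

definition set_D :: "(real \<Rightarrow> complex) set" where
  "set_D = {f \<in> Delta2_max. lim_pm1 (\<lambda>x. (1 - x\<^sup>2) *\<^sub>R vd f x) 0 \<and>
              lim_pm1 (vd (\<lambda>t. ((1 - t\<^sup>2)\<^sup>2) *\<^sub>R (vd ^^ 2) f t)) 0}"

end

theory Submission
  imports Defs
begin

text \<open>
  Write \<open>p = 1 - x\<^sup>2\<close>, \<open>U = p f'\<close>, \<open>u = U' = - \<ell>[f]\<close>, \<open>v = u'\<close>, \<open>w = p v = [f,1]\<^sub>2\<close>, so that \<open>w' = \<ell>\<^sup>2[f]\<close>.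
  All regularity comes from Hardy-type estimates for \<open>p z' = - 2 c x z + k\<close> with \<open>k \<in> L\<^sup>2\<close>, obtained by
  integrating \<open>(x p \<bar>z\<bar>\<^sup>2)'\<close>.  If \<open>U\<close> and \<open>w\<close> vanish at the end points and \<open>w' \<in> L\<^sup>2\<close>, they give in turn
  \<open>v = w / p\<close>, \<open>f' = U / p\<close> (both with \<open>c = -1\<close>) and \<open>f''\<close> (\<open>c = -2\<close>) in \<open>L\<^sup>2\<close>, whence
  \<open>p\<^sup>2 f'''' \<in> L\<^sup>2\<close>.  Conversely \<open>p\<^sup>2 f'''' \<in> L\<^sup>2\<close> gives \<open>p f'''\<close> (\<open>c = 1\<close>) and \<open>f''\<close> (\<open>c = 0\<close>) in \<open>L\<^sup>2\<close>
  together with all the boundary conditions.  The estimates integrate derivatives of absolutely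
  continuous functions, which by a Vitali covering argument exist almost everywhere.
\<close>

text \<open>Each value of c belongs to a first order equation. The product rule for w' and U' reads
  p v' = 2 x v + g, with g = w', and p f'' = 2 x f' + u (c = -1). The definition of v reads p f''' =
  4 x f'' + (v + 2 f') (c = -2). For z = p f''' one has p z' + 2 x z = p^2 f'''' (c = 1), and for z
  = f'' simply p z' = p f''' (c = 0). The integrated identity carries |z|^2 with coefficient 1 - (3
  + 4 c) x^2. For c <= -1 this is at least 1, but the boundary term stands on the large side and
  needs a prior bound on p |z|^2, which the limit conditions supply. For c >= 0 the boundary term
  has the favourable sign, and limits come out as a result. Hence \<open>set_B\<close>, which
  imposes no boundary condition, can serve as the hub to which the other sets are compared. Two
  obstacles remain. \<open>dom_S\<close> does not mention the limit of U, which has to be recovered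
  from both brackets. \<open>dom_A_sq\<close> knows \<open>leg f\<close> only up to a null set and f
  only up to f', so that f'' and f''' must be constructed.\<close>

subsection \<open>Absolute continuity\<close>

text \<open>Stated with divisions instead of indexed families, so that the division calculus of
  Henstock--Kurzweil integration applies.\<close>

definition abs_cont :: "real \<Rightarrow> real \<Rightarrow> (real \<Rightarrow> 'a::real_normed_vector) \<Rightarrow> bool" where
  "abs_cont a b F \<longleftrightarrow>
     (\<forall>\<epsilon>>0. \<exists>\<delta>>0. \<forall>D. D division_of \<Union>D \<and> \<Union>D \<subseteq> {a..b} \<and> (\<Sum>k\<in>D. Sup k - Inf k) < \<delta>
        \<longrightarrow> (\<Sum>k\<in>D. norm (F (Sup k) - F (Inf k))) < \<epsilon>)"

lemma division_cell_real:
  fixes D :: "real set set"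
  assumes "D division_of S" "k \<in> D"
  shows "k = {Inf k..Sup k}" "Inf k \<le> Sup k" "measure lebesgue k = Sup k - Inf k"
proof -
  obtain u v where k: "k = cbox u v" "k \<noteq> {}"
    using assms by (metis division_ofD(3,4))
  then have "u \<le> v" by auto
  with k show "k = {Inf k..Sup k}" "Inf k \<le> Sup k" "measure lebesgue k = Sup k - Inf k"
    by auto
qed

lemma sum_division_real:
  fixes F :: "real \<Rightarrow> 'a::real_normed_vector"
  assumes "D division_of {a..b}" "a \<le> b"
  shows "(\<Sum>k\<in>D. F (Sup k) - F (Inf k)) = F b - F a"
proof -
  note cell = division_cell_real[OF assms(1)]
  \<comment> \<open>Tagging each cell with its left end point gives access to the telescoping sum
    for tagged divisions.\<close>
  have "(\<lambda>k. (Inf k, k)) ` D tagged_division_of {a..b}"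
  proof (rule tagged_division_ofI)
    show "finite ((\<lambda>k. (Inf k, k)) ` D)"
      using assms(1) by blast
    fix x k assume "(x, k) \<in> (\<lambda>k. (Inf k, k)) ` D"
    then have k: "k \<in> D" "x = Inf k" by auto
    show "x \<in> k"
      using cell(1,2)[OF k(1)] k(2) by (metis atLeastAtMost_iff order_refl)
    show "k \<subseteq> {a..b}" "\<exists>c d. k = cbox c d"
      using division_ofD(2,4)[OF assms(1) k(1)] by auto
    fix x' k' assume "(x', k') \<in> (\<lambda>k. (Inf k, k)) ` D" "(x, k) \<noteq> (x', k')"
    then show "interior k \<inter> interior k' = {}"
      using division_ofD(5)[OF assms(1)] k by auto
  next
    show "\<Union>{k. \<exists>x. (x, k) \<in> (\<lambda>k. (Inf k, k)) ` D} = {a..b}"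
      using division_ofD(6)[OF assms(1)] by (force simp: image_iff)
  qed
  from additive_tagged_division_1[OF assms(2) this, of F]
  show ?thesis
    by (subst (asm) sum.reindex) (auto simp: inj_on_def)
qed

text \<open>The cells of a division have pairwise disjoint interiors, so any enumeration of them is
  an admissible family of intervals.\<close>

lemma AC_on_imp_abs_cont:
  assumes "AC_on a b F"
  shows "abs_cont a b F"
  unfolding abs_cont_def
proof (intro allI impI)
  fix \<epsilon> :: real assume "\<epsilon> > 0"
  with assms obtain \<delta> where "\<delta> > 0" and \<delta>:
    "\<forall>(n::nat) u v. (\<forall>i<n. a \<le> u i \<and> u i \<le> v i \<and> v i \<le> b) \<and>
        (\<forall>i<n. \<forall>j<n. i \<noteq> j \<longrightarrow> {u i<..<v i} \<inter> {u j<..<v j} = {}) \<and>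
        (\<Sum>i<n. v i - u i) < \<delta> \<longrightarrow> (\<Sum>i<n. cmod (F (v i) - F (u i))) < \<epsilon>"
    unfolding AC_on_def by blast
  have "(\<Sum>k\<in>D. norm (F (Sup k) - F (Inf k))) < \<epsilon>"
    if D: "D division_of \<Union>D" "\<Union>D \<subseteq> {a..b}" "(\<Sum>k\<in>D. Sup k - Inf k) < \<delta>" for D
  proof -
    obtain e where e: "bij_betw e {..<card D} D"
      using ex_bij_betw_nat_finite[OF division_of_finite[OF D(1)]] by (auto simp: atLeast0LessThan)
    have eD: "e i \<in> D" if "i < card D" for i
      using e that by (auto simp: bij_betw_def)
    have inj: "e i \<noteq> e j" if "i < card D" "j < card D" "i \<noteq> j" for i j
      using e that by (auto simp: bij_betw_def inj_on_def)
    note cell = division_cell_real[OF D(1)]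
    have int: "interior k = {Inf k<..<Sup k}" if "k \<in> D" for k
      by (metis cell(1)[OF that] interior_atLeastAtMost_real)
    have "(\<Sum>i<card D. cmod (F (Sup (e i)) - F (Inf (e i)))) < \<epsilon>"
    proof (rule \<delta>[rule_format], intro conjI)
      show "\<forall>i<card D. a \<le> Inf (e i) \<and> Inf (e i) \<le> Sup (e i) \<and> Sup (e i) \<le> b"
      proof (intro allI impI)
        fix i assume "i < card D"
        then have "e i \<in> D" by (rule eD)
        then have "{Inf (e i)..Sup (e i)} \<subseteq> {a..b}" "Inf (e i) \<le> Sup (e i)"
          using D(2) cell[of "e i"] by auto
        then show "a \<le> Inf (e i) \<and> Inf (e i) \<le> Sup (e i) \<and> Sup (e i) \<le> b" by auto
      qed
      show "\<forall>i<card D. \<forall>j<card D. i \<noteq> j \<longrightarrow> {Inf (e i)<..<Sup (e i)} \<inter> {Inf (e j)<..<Sup (e j)} = {}"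
        by (metis D(1) division_ofD(5) eD inj int)
      have "(\<Sum>i<card D. Sup (e i) - Inf (e i)) = (\<Sum>k\<in>D. Sup k - Inf k)"
        using e by (rule sum.reindex_bij_betw)
      then show "(\<Sum>i<card D. Sup (e i) - Inf (e i)) < \<delta>" using D(3) by simp
    qed
    also have "(\<Sum>i<card D. cmod (F (Sup (e i)) - F (Inf (e i)))) = (\<Sum>k\<in>D. norm (F (Sup k) - F (Inf k)))"
      using e by (rule sum.reindex_bij_betw)
    finally show ?thesis .
  qed
  with \<open>\<delta> > 0\<close> show "\<exists>\<delta>>0. \<forall>D. D division_of \<Union>D \<and> \<Union>D \<subseteq> {a..b} \<and> (\<Sum>k\<in>D. Sup k - Inf k) < \<delta>
        \<longrightarrow> (\<Sum>k\<in>D. norm (F (Sup k) - F (Inf k))) < \<epsilon>"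
    by blast
qed

lemma abs_contE:
  assumes "abs_cont a b F" "\<epsilon> > 0"
  obtains \<delta> where "\<delta> > 0"
    "\<And>D. D division_of \<Union>D \<Longrightarrow> \<Union>D \<subseteq> {a..b} \<Longrightarrow> (\<Sum>k\<in>D. Sup k - Inf k) < \<delta>
        \<Longrightarrow> (\<Sum>k\<in>D. norm (F (Sup k) - F (Inf k))) < \<epsilon>"
  using assms unfolding abs_cont_def by meson

text \<open>Serves to pass from a complex function to its real and imaginary parts, since the
  covering arguments compare slopes of real functions.\<close>

lemma abs_cont_mono:
  assumes "abs_cont a b F" "\<And>x y. norm (G x - G y) \<le> norm (F x - F y)"
  shows "abs_cont a b G"
  unfolding abs_cont_def
proof (intro allI impI)
  fix \<epsilon> :: real assume "\<epsilon> > 0"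
  from abs_contE[OF assms(1) this] obtain \<delta> where \<delta>: "\<delta> > 0"
    "\<And>D. D division_of \<Union>D \<Longrightarrow> \<Union>D \<subseteq> {a..b} \<Longrightarrow> (\<Sum>k\<in>D. Sup k - Inf k) < \<delta>
        \<Longrightarrow> (\<Sum>k\<in>D. norm (F (Sup k) - F (Inf k))) < \<epsilon>" by blast
  have "(\<Sum>k\<in>D. norm (G (Sup k) - G (Inf k))) \<le> (\<Sum>k\<in>D. norm (F (Sup k) - F (Inf k)))" for D
    by (intro sum_mono assms(2))
  with \<delta> show "\<exists>\<delta>>0. \<forall>D. D division_of \<Union>D \<and> \<Union>D \<subseteq> {a..b} \<and> (\<Sum>k\<in>D. Sup k - Inf k) < \<delta>
        \<longrightarrow> (\<Sum>k\<in>D. norm (G (Sup k) - G (Inf k))) < \<epsilon>"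
    by (meson le_less_trans)
qed

lemma abs_cont_imp_continuous_on:
  assumes "abs_cont a b F"
  shows "continuous_on {a..b} F"
  unfolding continuous_on_iff
proof (intro ballI allI impI)
  fix x \<epsilon> :: real assume x: "x \<in> {a..b}" and "\<epsilon> > 0"
  from abs_contE[OF assms this(2)] obtain \<delta> where \<delta>: "\<delta> > 0"
    "\<And>D. D division_of \<Union>D \<Longrightarrow> \<Union>D \<subseteq> {a..b} \<Longrightarrow> (\<Sum>k\<in>D. Sup k - Inf k) < \<delta>
        \<Longrightarrow> (\<Sum>k\<in>D. norm (F (Sup k) - F (Inf k))) < \<epsilon>" by blast
  have *: "norm (F v - F u) < \<epsilon>" if "a \<le> u" "u \<le> v" "v \<le> b" "v - u < \<delta>" for u v
  proof -
    have "{{u..v}} division_of {u..v}"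
      using that division_of_self[of u v] by auto
    then show ?thesis
      using \<delta>(2)[of "{{u..v}}"] that by auto
  qed
  show "\<exists>d>0. \<forall>x'\<in>{a..b}. dist x' x < d \<longrightarrow> dist (F x') (F x) < \<epsilon>"
  proof (intro exI[of _ \<delta>] conjI ballI impI)
    fix y assume y: "y \<in> {a..b}" "dist y x < \<delta>"
    show "dist (F y) (F x) < \<epsilon>"
      using *[of x y] *[of y x] x y by (cases "x \<le> y") (auto simp: dist_norm norm_minus_commute)
  qed (use \<delta> in auto)
qed

subsection \<open>Almost everywhere differentiability\<close>

text \<open>Since \<open>x\<close> is strictly inside the intervals, this is a countable intersection of open sets
  whatever \<open>P\<close> is.\<close>

definition straddled :: "(real \<Rightarrow> real \<Rightarrow> bool) \<Rightarrow> real set" where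
  "straddled P = {x. \<forall>d>0. \<exists>u v. u < x \<and> x < v \<and> v - u < d \<and> P u v}"

lemma borel_straddled: "straddled P \<in> sets borel"
proof -
  have "straddled P = (\<Inter>n::nat. \<Union>(u,v)\<in>{(u,v). v - u < 1 / Suc n \<and> P u v}. {u<..<v})" (is "_ = ?R")
  proof (intro set_eqI iffI)
    fix x assume "x \<in> straddled P"
    then show "x \<in> ?R" unfolding straddled_def
      by clarsimp (metis of_nat_0_less_iff of_nat_Suc zero_less_Suc zero_less_divide_1_iff)
  next
    fix x assume x: "x \<in> ?R"
    show "x \<in> straddled P" unfolding straddled_def
    proof (intro CollectI allI impI)
      fix d :: real assume "d > 0"
      then obtain n where "1 / Suc n < d"
        using nat_approx_posE by blast
      moreover obtain u v where "u < x" "x < v" "v - u < 1 / Suc n" "P u v"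
        using x by force
      ultimately show "\<exists>u v. u < x \<and> x < v \<and> v - u < d \<and> P u v"
        by (meson order_less_trans)
    qed
  qed
  also have "\<dots> \<in> sets borel"
    by (intro sets.countable_INT') (auto intro!: borel_open)
  finally show ?thesis .
qed

text \<open>Short straddling intervals around a point of \<open>E\<close> stay in the open set
  \<open>G\<close>, so they form a Vitali cover of \<open>E\<close>. The covering theorem extracts a
  countable disjoint subfamily that covers almost all of \<open>E\<close>, and finitely many of its
  members suffice up to \<eta>.\<close>

lemma finite_Vitali_intervals:
  fixes E :: "real set"
  assumes E: "E \<in> lmeasurable" and G: "open G" "E \<subseteq> G" and "\<eta> > 0" and EP: "E \<subseteq> straddled P"
  obtains D where "D division_of \<Union>D" "\<Union>D \<subseteq> G" "pairwise disjnt D"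
    "\<And>k. k \<in> D \<Longrightarrow> P (Inf k) (Sup k)" "\<And>k. k \<in> D \<Longrightarrow> Inf k < Sup k"
    "measure lebesgue E - \<eta> < measure lebesgue (E \<inter> \<Union>D)"
proof -
  define K where "K = {(u,v). u < v \<and> {u..v} \<subseteq> G \<and> P u v}"
  \<comment> \<open>Midpoint and half-length, because the covering theorem speaks of balls.\<close>
  define c r where "c = (\<lambda>(u,v). (u+v)/2 :: real)" and "r = (\<lambda>(u,v). (v-u)/2 :: real)"
  have cb: "cball (c i) (r i) = {fst i..snd i}" for i
    by (cases i) (auto simp: c_def r_def dist_real_def abs_if field_simps split: if_splits)
  have cov: "\<exists>i. i \<in> K \<and> x \<in> cball (c i) (r i) \<and> r i < d" if xd: "x \<in> E" "d > 0" for x d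
  proof -
    obtain e where e: "e > 0" "ball x e \<subseteq> G"
      using openE[OF G(1), of x] G(2) xd(1) by blast
    have "min d e > 0" using e xd by simp
    then obtain u v where uv: "u < x" "x < v" "v - u < min d e" "P u v"
      using EP xd(1) unfolding straddled_def by blast
    then have "{u..v} \<subseteq> ball x e" by (auto simp: dist_real_def)
    then have "(u,v) \<in> K" using uv e by (auto simp: K_def)
    moreover have "x \<in> cball (c (u,v)) (r (u,v))" using uv by (simp add: cb)
    moreover have "r (u,v) < d" using uv by (simp add: r_def)
    ultimately show ?thesis by blast
  qed
  have r0: "0 < r i" if "i \<in> K" for i
    using that by (auto simp: K_def r_def)
  obtain C where C: "countable C" "C \<subseteq> K"
     "pairwise (\<lambda>i j. disjnt (cball (c i) (r i)) (cball (c j) (r j))) C"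
     "negligible (E - (\<Union>i \<in> C. cball (c i) (r i)))"
    by (rule Vitali_covering_theorem_cballs[OF r0 cov])
  let ?I = "\<lambda>i. {fst i..snd i::real}"
  note C = C[unfolded cb]
  have Em: "E \<inter> ?I i \<in> lmeasurable" for i
    by (simp add: E fmeasurable.Int)
  \<comment> \<open>The intervals are cut down to \<open>E\<close>, whose finite measure bounds all
    finite subunions; \<open>G\<close> may have infinite measure.\<close>
  obtain D' where D': "D' \<subseteq> (\<lambda>i. E \<inter> ?I i) ` C" "finite D'"
    "measure lebesgue (\<Union>((\<lambda>i. E \<inter> ?I i) ` C)) - \<eta> < measure lebesgue (\<Union>D')"
  proof (rule measure_countable_Union_approachable[where B = "measure lebesgue E" and \<D> = "(\<lambda>i. E \<inter> ?I i) ` C" and e = \<eta>])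
    show "measure lebesgue (\<Union>D') \<le> measure lebesgue E"
      if "D' \<subseteq> (\<lambda>i. E \<inter> ?I i) ` C" "finite D'" for D'
    proof (rule measure_mono_fmeasurable)
      show "\<Union> D' \<subseteq> E" "\<Union> D' \<in> sets lebesgue"
        using that Em by (auto intro!: sets.finite_Union)
    qed (use E in auto)
  qed (use C \<open>\<eta> > 0\<close> Em in auto)
  obtain C' where C': "C' \<subseteq> C" "finite C'" "D' = (\<lambda>i. E \<inter> ?I i) ` C'"
    using D' by (meson finite_subset_image)
  define D where "D = ?I ` C'"
  have lt: "fst i < snd i" "P (fst i) (snd i)" "?I i \<subseteq> G" if "i \<in> C'" for i
  proof -
    have "i \<in> K" using that C'(1) C(2) by blast
    then show "fst i < snd i" "P (fst i) (snd i)" "?I i \<subseteq> G"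
      by (auto simp: K_def)
  qed
  have disj: "pairwise disjnt D"
    using C(3) C'(1) unfolding D_def pairwise_def by (metis (no_types, lifting) imageE subsetD)
  show ?thesis
  proof
    show "D division_of \<Union>D"
    proof (rule division_ofI)
      fix K1 K2 assume "K1 \<in> D" "K2 \<in> D" "K1 \<noteq> K2"
      then have "K1 \<inter> K2 = {}"
        using disj by (auto simp: pairwise_def disjnt_def)
      then show "interior K1 \<inter> interior K2 = {}"
        using interior_subset by blast
    next
      fix K1 assume "K1 \<in> D"
      then show "K1 \<noteq> {}" "\<exists>a b. K1 = cbox a b"
        using lt(1) unfolding D_def by (fastforce, auto)
    qed (use C' in \<open>auto simp: D_def\<close>)
    show "\<Union>D \<subseteq> G" using lt(3) unfolding D_def by blast
    show "P (Inf k) (Sup k)" "Inf k < Sup k" if "k \<in> D" for k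
      using that lt by (force simp: D_def)+
    have "measure lebesgue E = measure lebesgue (\<Union>((\<lambda>i. E \<inter> ?I i) ` C))"
    proof (rule measure_negligible_symdiff[symmetric])
      show "negligible (E - \<Union>((\<lambda>i. E \<inter> ?I i) ` C) \<union> (\<Union>((\<lambda>i. E \<inter> ?I i) ` C) - E))"
        by (rule negligible_subset[OF C(4)]) auto
    qed (rule E)
    also have "\<dots> - \<eta> < measure lebesgue (\<Union>D')" by (rule D')
    also have "\<Union>D' = E \<inter> \<Union>D" using C' by (auto simp: D_def)
    finally show "measure lebesgue E - \<eta> < measure lebesgue (E \<inter> \<Union>D)" by simp
  qed (rule disj)
qed

lemma straddled_interval_subset:
  assumes "E \<subseteq> straddled (\<lambda>u v. a \<le> u \<and> v \<le> b \<and> P u v)"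
  shows "E \<subseteq> {a..b}"
proof
  fix x assume "x \<in> E"
  then have "\<forall>d>0. \<exists>u v. u < x \<and> x < v \<and> v - u < d \<and> a \<le> u \<and> v \<le> b \<and> P u v"
    using assms by (auto simp: straddled_def)
  then obtain u v where "u < x" "x < v" "a \<le> u" "v \<le> b"
    using zero_less_one by blast
  then show "x \<in> {a..b}" by simp
qed

text \<open>If the set had measure m > 0, most of it would be covered by disjoint intervals of slope
  below p, of total length \<open>L1\<close> barely above m, and again, inside these, by intervals
  of slope above q, of total length \<open>L2\<close> barely below m. What remains of the first
  family is short, so absolute continuity keeps the change of \<open>G\<close> on it below
  \<epsilon>. Then q L2 - \<epsilon> < p L1, which contradicts p < q.\<close>

lemma negligible_straddled_slopes:
  fixes G :: "real \<Rightarrow> real"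
  assumes ac: "abs_cont a b G" and pq: "p < q"
  shows "negligible (straddled (\<lambda>u v. a \<le> u \<and> v \<le> b \<and> G v - G u < p * (v - u)) \<inter>
                     straddled (\<lambda>u v. a \<le> u \<and> v \<le> b \<and> G v - G u > q * (v - u)))"
    (is "negligible ?E")
proof -
  define E where "E = ?E"
  let ?\<mu> = "measure (lebesgue :: real measure)"
  have Eab: "E \<subseteq> {a..b}"
    unfolding E_def by (intro straddled_interval_subset) auto
  have E: "E \<in> lmeasurable"
  proof (rule fmeasurableI2[of "{a..b}"])
    show "E \<in> sets lebesgue" unfolding E_def using borel_straddled by auto
  qed (use Eab in auto)
  define m where "m = ?\<mu> E"
  have "\<not> m > 0"
  proof
    assume m: "m > 0"
    define \<epsilon> where "\<epsilon> = (q - p) * m / 4"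
    have \<epsilon>: "\<epsilon> > 0" using m pq by (simp add: \<epsilon>_def)
    obtain \<delta> where "\<delta> > 0" and \<delta>:
      "\<And>D. D division_of \<Union>D \<Longrightarrow> \<Union>D \<subseteq> {a..b} \<Longrightarrow> (\<Sum>k\<in>D. Sup k - Inf k) < \<delta>
        \<Longrightarrow> (\<Sum>k\<in>D. norm (G (Sup k) - G (Inf k))) < \<epsilon>"
      using abs_contE[OF ac \<epsilon>] by blast
    \<comment> \<open>The first bound yields L2 > m / 2, the second keeps the leftover length L1 -
      L2 < 3 \<eta> below \<delta>, and the third makes 3 \<eta> |p| at most 3/16 of (q - p) m; the
      summand 1 covers p = 0. The contradiction is then 1/2 - 3/16 > 1/4.\<close>
    define \<eta> where "\<eta> = Min {m / 4, \<delta> / 4, (q - p) * m / (16 * (\<bar>p\<bar> + 1))}"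
    have \<eta>: "\<eta> > 0" "\<eta> \<le> m / 4" "\<eta> \<le> \<delta> / 4" "\<eta> \<le> (q - p) * m / (16 * (\<bar>p\<bar> + 1))"
    proof -
      show "\<eta> > 0" using m pq \<open>\<delta> > 0\<close> by (simp add: \<eta>_def)
      show "\<eta> \<le> m / 4" "\<eta> \<le> \<delta> / 4" "\<eta> \<le> (q - p) * m / (16 * (\<bar>p\<bar> + 1))"
        unfolding \<eta>_def by (rule Min_le; simp)+
    qed
    have p\<eta>: "\<bar>p\<bar> * \<eta> \<le> (q - p) * m / 16"
    proof -
      have "(\<bar>p\<bar> + 1) * \<eta> \<le> (q - p) * m / 16"
        using \<eta>(4) by (simp add: field_simps)
      then show ?thesis using \<eta>(1) by (simp add: algebra_simps)
    qed
    \<comment> \<open>Confining the first family to \<open>T\<close> is what bounds its total length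
      by m + \<eta>.\<close>
    obtain T where T: "open T" "E \<subseteq> T" "T - E \<in> lmeasurable" "emeasure lebesgue (T - E) < ennreal \<eta>"
      using sets_lebesgue_outer_open[OF fmeasurableD[OF E] \<eta>(1)] by blast
    have "?\<mu> (T - E) < \<eta>"
      using T \<eta>(1) by (simp add: emeasure_eq_measure2 ennreal_less_iff)
    moreover have Tl: "T \<in> lmeasurable"
      using T E by (metis Diff_partition fmeasurable.Un)
    moreover have "?\<mu> T = m + ?\<mu> (T - E)"
      using measurable_measure_Diff[OF Tl fmeasurableD[OF E] T(2)] by (simp add: m_def)
    ultimately have mT: "?\<mu> T < m + \<eta>" by simp
    obtain D where D: "D division_of \<Union>D" "\<Union>D \<subseteq> T" "pairwise disjnt D"
      "\<And>k. k \<in> D \<Longrightarrow> a \<le> Inf k \<and> Sup k \<le> b \<and> G (Sup k) - G (Inf k) < p * (Sup k - Inf k)"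
      "\<And>k. k \<in> D \<Longrightarrow> Inf k < Sup k"
      "m - \<eta> < ?\<mu> (E \<inter> \<Union>D)"
      unfolding m_def
      by (rule finite_Vitali_intervals[OF E T(1,2) \<eta>(1),
           of "\<lambda>u v. a \<le> u \<and> v \<le> b \<and> G v - G u < p * (v - u)"]) (auto simp: E_def)
    have finD: "finite D" using D(1) by blast
    have "D \<noteq> {}" using D(6) \<eta> m by auto
    \<comment> \<open>Each cell of \<open>D\<close> receives the error budget \<eta> / n, so the
      inner coverings lose at most \<eta> altogether.\<close>
    define n where "n = real (card D)"
    have n: "n > 0" using finD \<open>D \<noteq> {}\<close> by (simp add: n_def card_gt_0_iff)
    note cell = division_cell_real[OF D(1)]
    \<comment> \<open>The second covering takes place in the open set \<open>interior I\<close>.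
      Completing \<open>DI\<close> to a division \<open>QI\<close> of the whole cell makes
      increments over \<open>I\<close> telescope.\<close>
    have ex: "\<exists>DI QI. DI \<subseteq> QI \<and> QI division_of I \<and>
        (\<forall>k\<in>DI. G (Sup k) - G (Inf k) > q * (Sup k - Inf k)) \<and>
        ?\<mu> (E \<inter> I) - \<eta> / n \<le> (\<Sum>k\<in>DI. Sup k - Inf k)" if I: "I \<in> D" for I
    proof -
      have Ieq: "I = cbox (Inf I) (Sup I)" using cell(1)[OF I] by simp
      have EI: "E \<inter> interior I \<in> lmeasurable"
        using E by (intro fmeasurable_Int_fmeasurable) auto
      have EI_str: "E \<inter> interior I \<subseteq> straddled (\<lambda>u v. a \<le> u \<and> v \<le> b \<and> G v - G u > q * (v - u))"
        by (auto simp: E_def)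
      have \<eta>n: "\<eta> / n > 0" using n \<eta>(1) by simp
      obtain DI where DI: "DI division_of \<Union>DI" "\<Union>DI \<subseteq> interior I"
        "\<And>k. k \<in> DI \<Longrightarrow> a \<le> Inf k \<and> Sup k \<le> b \<and> G (Sup k) - G (Inf k) > q * (Sup k - Inf k)"
        "?\<mu> (E \<inter> interior I) - \<eta> / n < ?\<mu> (E \<inter> interior I \<inter> \<Union>DI)"
        by (rule finite_Vitali_intervals[OF EI open_interior Int_lower2 \<eta>n EI_str]) blast
      have "\<Union>DI \<subseteq> cbox (Inf I) (Sup I)"
        using DI(2) interior_subset Ieq by blast
      then obtain QI where QI: "DI \<subseteq> QI" "QI division_of cbox (Inf I) (Sup I)"
        using partial_division_extend_interval[OF DI(1)] by blast
      have "?\<mu> (E \<inter> I) = ?\<mu> (E \<inter> interior I)"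
      proof (rule measure_negligible_symdiff[OF EI])
        have "negligible (frontier I)"
          using Ieq convex_box(1)[of "Inf I" "Sup I"] by (intro negligible_convex_frontier) simp
        moreover have "I - interior I \<subseteq> frontier I"
          using closure_subset by (auto simp: frontier_def)
        ultimately have "negligible (I - interior I)"
          by (rule negligible_subset)
        then show "negligible (E \<inter> interior I - E \<inter> I \<union> (E \<inter> I - E \<inter> interior I))"
          by (rule negligible_subset) (use interior_subset in auto)
      qed
      moreover have "?\<mu> (E \<inter> interior I \<inter> \<Union>DI) \<le> ?\<mu> (\<Union>DI)"
      proof (rule measure_mono_fmeasurable)
        show "E \<inter> interior I \<inter> \<Union>DI \<in> sets lebesgue"
          using EI lmeasurable_division[OF DI(1)] by blast
      qed (use lmeasurable_division[OF DI(1)] in auto)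
      moreover have "?\<mu> (\<Union>DI) = (\<Sum>k\<in>DI. Sup k - Inf k)"
        using content_division[OF DI(1)] division_cell_real(3)[OF DI(1)] by simp
      ultimately have "?\<mu> (E \<inter> I) - \<eta> / n \<le> (\<Sum>k\<in>DI. Sup k - Inf k)"
        using DI(4) by simp
      moreover have "QI division_of I" using QI(2) Ieq by simp
      ultimately show ?thesis
        using DI(3) QI(1) by (intro exI[of _ DI] exI[of _ QI]) auto
    qed
    from bchoice[OF ballI[OF ex]] obtain DD where "\<forall>I\<in>D. \<exists>QI. DD I \<subseteq> QI \<and> QI division_of I \<and>
        (\<forall>k\<in>DD I. G (Sup k) - G (Inf k) > q * (Sup k - Inf k)) \<and>
        ?\<mu> (E \<inter> I) - \<eta> / n \<le> (\<Sum>k\<in>DD I. Sup k - Inf k)" ..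
    from bchoice[OF this] obtain QQ where "\<forall>I\<in>D. DD I \<subseteq> QQ I \<and> QQ I division_of I \<and>
        (\<forall>k\<in>DD I. G (Sup k) - G (Inf k) > q * (Sup k - Inf k)) \<and>
        ?\<mu> (E \<inter> I) - \<eta> / n \<le> (\<Sum>k\<in>DD I. Sup k - Inf k)" ..
    then have DQ: "\<And>I. I \<in> D \<Longrightarrow> DD I \<subseteq> QQ I" "\<And>I. I \<in> D \<Longrightarrow> QQ I division_of I"
        "\<And>I k. I \<in> D \<Longrightarrow> k \<in> DD I \<Longrightarrow> G (Sup k) - G (Inf k) > q * (Sup k - Inf k)"
        "\<And>I. I \<in> D \<Longrightarrow> ?\<mu> (E \<inter> I) - \<eta> / n \<le> (\<Sum>k\<in>DD I. Sup k - Inf k)"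
      by simp_all
    have finQ: "finite (QQ I)" if "I \<in> D" for I using DQ(2)[OF that] by blast
    \<comment> \<open>The leftover: pieces of the first family that are not among the intervals of
      slope above q.\<close>
    define R where "R = (\<Union>I\<in>D. QQ I - DD I)"
    have kI: "k \<noteq> {}" "k \<subseteq> I" "\<exists>c d. k = cbox c d" if "I \<in> D" "k \<in> QQ I" for I k
      using division_ofD(2-4)[OF DQ(2)[OF that(1)] that(2)] by auto
    have disj: "I \<inter> J = {}" if "I \<in> D" "J \<in> D" "I \<noteq> J" for I J
      using D(3) that by (auto simp: pairwise_def disjnt_def)
    have R: "R division_of \<Union>R"
    proof (rule division_ofI)
      show "finite R" using finD finQ by (auto simp: R_def)
    next
      fix K assume "K \<in> R" then show "K \<noteq> {}" "\<exists>c d. K = cbox c d" "K \<subseteq> \<Union>R"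
        using kI by (auto simp: R_def)
    next
      fix K K' assume "K \<in> R" "K' \<in> R" and ne: "K \<noteq> K'"
      then obtain I I' where I: "I \<in> D" "K \<in> QQ I" "I' \<in> D" "K' \<in> QQ I'"
        by (auto simp: R_def)
      show "interior K \<inter> interior K' = {}"
      proof (cases "I = I'")
        case True
        then show ?thesis using division_ofD(5)[OF DQ(2)] I ne by metis
      next
        case False
        then have "K \<inter> K' = {}" using disj[of I I'] I kI(2) by blast
        then show ?thesis using interior_subset by blast
      qed
    qed auto
    \<comment> \<open>Kept general in \<open>H\<close>, since it is applied to lengths
      (\<open>H\<close> the identity) and to increments of \<open>G\<close>.\<close>
    have sumR: "(\<Sum>k\<in>R. H (Sup k) - H (Inf k)) =
        (\<Sum>I\<in>D. H (Sup I) - H (Inf I)) - (\<Sum>I\<in>D. \<Sum>k\<in>DD I. H (Sup k) - H (Inf k))" for H :: "real \<Rightarrow> real"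
    proof -
      have "(\<Sum>k\<in>R. H (Sup k) - H (Inf k)) = (\<Sum>I\<in>D. \<Sum>k\<in>QQ I - DD I. H (Sup k) - H (Inf k))"
        unfolding R_def
      proof (rule sum.UNION_disjoint)
        show "\<forall>i\<in>D. \<forall>j\<in>D. i \<noteq> j \<longrightarrow> (QQ i - DD i) \<inter> (QQ j - DD j) = {}"
        proof (intro ballI impI)
          fix I J assume IJ: "I \<in> D" "J \<in> D" "I \<noteq> J"
          have False if "k \<in> QQ I" "k \<in> QQ J" for k
            using kI(1,2)[OF IJ(1) that(1)] kI(2)[OF IJ(2) that(2)] disj[OF IJ] by auto
          then show "(QQ I - DD I) \<inter> (QQ J - DD J) = {}" by auto
        qed
      qed (use finD finQ in auto)
      also have "\<dots> = (\<Sum>I\<in>D. (H (Sup I) - H (Inf I)) - (\<Sum>k\<in>DD I. H (Sup k) - H (Inf k)))"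
      proof (rule sum.cong)
        fix I assume I: "I \<in> D"
        have "(\<Sum>k\<in>QQ I - DD I. H (Sup k) - H (Inf k))
            = (\<Sum>k\<in>QQ I. H (Sup k) - H (Inf k)) - (\<Sum>k\<in>DD I. H (Sup k) - H (Inf k))"
          by (rule sum_diff[OF finQ[OF I] DQ(1)[OF I]])
        also have "(\<Sum>k\<in>QQ I. H (Sup k) - H (Inf k)) = H (Sup I) - H (Inf I)"
          using sum_division_real[of "QQ I" "Inf I" "Sup I" H] DQ(2)[OF I] cell(1,2)[OF I] by simp
        finally show "(\<Sum>k\<in>QQ I - DD I. H (Sup k) - H (Inf k))
            = H (Sup I) - H (Inf I) - (\<Sum>k\<in>DD I. H (Sup k) - H (Inf k))" .
      qed simp
      finally show ?thesis by (simp add: sum_subtractf)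
    qed
    define L1 where "L1 = (\<Sum>I\<in>D. Sup I - Inf I)"
    define L2 where "L2 = (\<Sum>I\<in>D. \<Sum>k\<in>DD I. Sup k - Inf k)"
    have "L1 = ?\<mu> (\<Union>D)"
      using content_division[OF D(1)] cell(3) by (simp add: L1_def)
    also have "\<dots> \<le> ?\<mu> T"
      using D(2) lmeasurable_division[OF D(1)] Tl by (intro measure_mono_fmeasurable) auto
    finally have L1: "L1 < m + \<eta>" using mT by simp
    have "m - \<eta> < ?\<mu> (E \<inter> \<Union>D)" by (rule D(6))
    also have "E \<inter> \<Union>D = (\<Union>I\<in>D. E \<inter> I)" by auto
    also have "?\<mu> \<dots> \<le> (\<Sum>I\<in>D. ?\<mu> (E \<inter> I))"
    proof (rule measure_UNION_le[OF finD])
      fix I assume "I \<in> D"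
      then show "E \<inter> I \<in> sets lebesgue"
        using E D(1) by (metis division_ofD(4) fmeasurableD fmeasurable.Int lmeasurable_cbox)
    qed
    also have "\<dots> = (\<Sum>I\<in>D. ?\<mu> (E \<inter> I) - \<eta> / n) + \<eta>"
      using n by (simp add: sum_subtractf n_def)
    also have "\<dots> \<le> L2 + \<eta>"
      unfolding L2_def by (intro add_right_mono sum_mono DQ(4))
    finally have L2: "L2 > m - 2 * \<eta>" by simp
    have RL: "(\<Sum>k\<in>R. Sup k - Inf k) = L1 - L2"
      using sumR[of "\<lambda>x. x"] by (simp add: L1_def L2_def)
    have "(\<Sum>k\<in>R. norm (G (Sup k) - G (Inf k))) < \<epsilon>"
    proof (rule \<delta>[OF R])
      show "\<Union>R \<subseteq> {a..b}"
      proof -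
        have "I \<subseteq> {a..b}" if "I \<in> D" for I
          using cell(1)[OF that] D(4)[OF that] by (metis atLeastatMost_subset_iff)
        then show ?thesis using kI(2) by (force simp: R_def)
      qed
      show "(\<Sum>k\<in>R. Sup k - Inf k) < \<delta>"
        using RL L1 L2 \<eta> \<open>\<delta> > 0\<close> by simp
    qed
    then have "\<bar>\<Sum>k\<in>R. G (Sup k) - G (Inf k)\<bar> < \<epsilon>"
      by (intro le_less_trans[OF sum_abs]) simp
    then have 1: "(\<Sum>I\<in>D. \<Sum>k\<in>DD I. G (Sup k) - G (Inf k)) - \<epsilon> < (\<Sum>I\<in>D. G (Sup I) - G (Inf I))"
      using sumR[of G] by simp
    have 2: "(\<Sum>I\<in>D. G (Sup I) - G (Inf I)) \<le> p * L1"
      unfolding L1_def sum_distrib_left using D(4) by (intro sum_mono) force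
    have 3: "q * L2 \<le> (\<Sum>I\<in>D. \<Sum>k\<in>DD I. G (Sup k) - G (Inf k))"
      unfolding L2_def sum_distrib_left using DQ(3) by (intro sum_mono) force
    have "q * L2 - p * L1 < \<epsilon>" using 1 2 3 by simp
    moreover have "q * L2 - p * L1 = (q - p) * L2 - p * (L1 - L2)" by (simp add: algebra_simps)
    moreover have "(q - p) * L2 \<ge> (q - p) * (m / 2)"
      using L2 \<eta>(2) pq by (intro mult_left_mono) auto
    moreover have "p * (L1 - L2) \<le> \<bar>p\<bar> * (3 * \<eta>)"
    proof -
      have "0 \<le> (\<Sum>k\<in>R. Sup k - Inf k)"
        using division_cell_real(2)[OF R] by (intro sum_nonneg) simp
      then have "L1 - L2 \<ge> 0" using RL by simp
      then have "p * (L1 - L2) \<le> \<bar>p\<bar> * (L1 - L2)" by (intro mult_right_mono) auto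
      also have "\<dots> \<le> \<bar>p\<bar> * (3 * \<eta>)" using L1 L2 by (intro mult_left_mono) auto
      finally show ?thesis .
    qed
    ultimately have "(q - p) * (m / 2) - 3 * ((q - p) * m / 16) < (q - p) * m / 4"
      using p\<eta> unfolding \<epsilon>_def by linarith
    then have "(q - p) * m < 0" by (simp add: field_simps)
    then show False using m pq by (simp add: mult_less_0_iff)
  qed
  then have "m = 0" using measure_nonneg[of lebesgue E] by (simp add: m_def)
  then show ?thesis
    using negligible_iff_measure0[OF E] by (simp add: m_def E_def)
qed

text \<open>Excludes infinite derivatives, which the comparison of two slopes cannot detect. A ball
  of radius \<delta> / 4 has length below \<delta>, so the increments of \<open>G\<close> over a
  division inside it sum to less than 1. If the set had measure m > 0 in that ball, intervals of
  slope above M > 2 / m and of total length at least m / 2 would give a sum above 1.\<close>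

lemma negligible_straddled_steep:
  fixes G :: "real \<Rightarrow> real"
  assumes ac: "abs_cont a b G"
  shows "negligible (\<Inter>M::nat. straddled (\<lambda>u v. a \<le> u \<and> v \<le> b \<and> \<bar>G v - G u\<bar> > real M * (v - u)))"
    (is "negligible ?E")
proof -
  define E where "E = ?E"
  let ?\<mu> = "measure (lebesgue :: real measure)"
  have Eb: "E \<in> sets borel"
    unfolding E_def by (intro sets.countable_INT') (auto simp: borel_straddled)
  obtain \<delta> where "\<delta> > 0" and \<delta>:
    "\<And>D. D division_of \<Union>D \<Longrightarrow> \<Union>D \<subseteq> {a..b} \<Longrightarrow> (\<Sum>k\<in>D. Sup k - Inf k) < \<delta>
      \<Longrightarrow> (\<Sum>k\<in>D. norm (G (Sup k) - G (Inf k))) < 1"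
    using abs_contE[OF ac zero_less_one] by blast
  have null: "negligible (E \<inter> ball z (\<delta> / 4))" for z
  proof -
    define E' where "E' = E \<inter> ball z (\<delta> / 4)"
    have E': "E' \<in> lmeasurable"
      unfolding E'_def using Eb by (metis fmeasurable_Int_fmeasurable inf_commute lmeasurable_ball sets_completionI_sets sets_lborel)
    define m where "m = ?\<mu> E'"
    have "\<not> m > 0"
    proof
      assume m: "m > 0"
      obtain M :: nat where M: "2 / m < real M" using reals_Archimedean2 by blast
      have E'_sub: "E' \<subseteq> ball z (\<delta> / 4)" by (auto simp: E'_def)
      have E'_str: "E' \<subseteq> straddled (\<lambda>u v. a \<le> u \<and> v \<le> b \<and> \<bar>G v - G u\<bar> > real M * (v - u))"
        by (auto simp: E'_def E_def)
      have m2: "?\<mu> E' / 2 > 0" using m by (simp add: m_def)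
      obtain D where D: "D division_of \<Union>D" "\<Union>D \<subseteq> ball z (\<delta> / 4)"
        "\<And>k. k \<in> D \<Longrightarrow> a \<le> Inf k \<and> Sup k \<le> b \<and> \<bar>G (Sup k) - G (Inf k)\<bar> > real M * (Sup k - Inf k)"
        "m - m / 2 < ?\<mu> (E' \<inter> \<Union>D)"
        unfolding m_def
        by (rule finite_Vitali_intervals[OF E' open_ball E'_sub m2 E'_str]) blast
      have len: "?\<mu> (\<Union>D) = (\<Sum>k\<in>D. Sup k - Inf k)"
        using content_division[OF D(1)] division_cell_real(3)[OF D(1)] by simp
      have "?\<mu> (\<Union>D) \<le> ?\<mu> (ball z (\<delta> / 4))"
        using D(2) lmeasurable_division[OF D(1)] by (intro measure_mono_fmeasurable) auto
      also have "\<dots> < \<delta>" using \<open>\<delta> > 0\<close> by (simp add: ball_eq_greaterThanLessThan)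
      finally have "(\<Sum>k\<in>D. norm (G (Sup k) - G (Inf k))) < 1"
        using D(3) division_cell_real(1)[OF D(1)] len
        by (intro \<delta>[OF D(1)]) (force, simp)
      moreover have "(\<Sum>k\<in>D. norm (G (Sup k) - G (Inf k))) \<ge> real M * (\<Sum>k\<in>D. Sup k - Inf k)"
        unfolding sum_distrib_left using D(3) by (intro sum_mono) force
      moreover have "(\<Sum>k\<in>D. Sup k - Inf k) \<ge> m / 2"
      proof -
        have "?\<mu> (E' \<inter> \<Union>D) \<le> ?\<mu> (\<Union>D)"
          using E' lmeasurable_division[OF D(1)] by (intro measure_mono_fmeasurable) auto
        then show ?thesis using D(4) len by simp
      qed
      then have "real M * (\<Sum>k\<in>D. Sup k - Inf k) \<ge> real M * (m / 2)"
        by (intro mult_left_mono) auto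
      moreover have "real M * (m / 2) > 1" using M m by (simp add: field_simps)
      ultimately show False by simp
    qed
    then have "m = 0" using measure_nonneg[of lebesgue E'] by (simp add: m_def)
    then show ?thesis
      using negligible_iff_measure0[OF E'] by (simp add: m_def E'_def)
  qed
  have "negligible E"
  proof (rule locally_negligible_alt[THEN iffD2], rule ballI)
    fix x assume "x \<in> E"
    then show "\<exists>U. openin (top_of_set E) U \<and> x \<in> U \<and> negligible U"
      using null[of x] \<open>\<delta> > 0\<close> by (intro exI[of _ "E \<inter> ball x (\<delta> / 4)"]) (auto intro: openin_open_Int)
  qed
  then show ?thesis by (simp add: E_def)
qed

text \<open>The limit is the supremum of the eventual lower bounds. Separation is demanded only for
  rational pairs, so that the application has to discard only countably many null sets.\<close>

lemma convergent_if_slopes_separated: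
  fixes s :: "real \<Rightarrow> real"
  assumes "Fl \<noteq> bot" and bd: "\<forall>\<^sub>F y in Fl. \<bar>s y\<bar> \<le> M"
    and sep: "\<And>p q. p \<in> \<rat> \<Longrightarrow> q \<in> \<rat> \<Longrightarrow> p < q \<Longrightarrow> (\<forall>\<^sub>F y in Fl. p \<le> s y) \<or> (\<forall>\<^sub>F y in Fl. s y \<le> q)"
  obtains L where "(s \<longlongrightarrow> L) Fl"
proof -
  define A where "A = {p. \<forall>\<^sub>F y in Fl. p \<le> s y}"
  have "- M \<in> A" unfolding A_def using bd by (auto elim!: eventually_mono)
  have A_le: "p \<le> M" if "p \<in> A" for p
  proof -
    have "\<forall>\<^sub>F y in Fl. p \<le> s y \<and> \<bar>s y\<bar> \<le> M"
      using bd that by (auto simp: A_def eventually_conj_iff)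
    then obtain y where "p \<le> s y" "\<bar>s y\<bar> \<le> M"
      using \<open>Fl \<noteq> bot\<close> eventually_happens' by blast
    then show ?thesis by simp
  qed
  then have bdd: "bdd_above A" by (auto simp: bdd_above_def)
  have "(s \<longlongrightarrow> Sup A) Fl"
    unfolding tendsto_iff
  proof (intro allI impI)
    fix e :: real assume e: "e > 0"
    have "Sup A - e < Sup A" using e by simp
    then obtain p0 where p0: "p0 \<in> A" "Sup A - e < p0"
      using less_cSup_iff[OF _ bdd, of "Sup A - e"] \<open>- M \<in> A\<close> by blast
    \<comment> \<open>A rational p just above the supremum is not an eventual lower bound, so
      \<open>sep\<close> turns the next rational q into an eventual upper bound.\<close>
    obtain p where p: "p \<in> \<rat>" "Sup A < p" "p < Sup A + e" using Rats_dense_in_real[of "Sup A" "Sup A + e"] e by auto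
    obtain q where q: "q \<in> \<rat>" "p < q" "q < Sup A + e" using Rats_dense_in_real[of p "Sup A + e"] p by auto
    have "p \<notin> A" using cSup_upper[OF _ bdd, of p] p by auto
    then have "\<forall>\<^sub>F y in Fl. s y \<le> q" using sep[OF p(1) q(1,2)] by (auto simp: A_def)
    moreover have "\<forall>\<^sub>F y in Fl. p0 \<le> s y" using p0 by (simp add: A_def)
    ultimately show "\<forall>\<^sub>F y in Fl. dist (s y) (Sup A) < e"
      by eventually_elim (use p0 q in \<open>auto simp: dist_real_def abs_if\<close>)
  qed
  then show thesis by (rule that)
qed

text \<open>Straddling intervals may have an end point arbitrarily close to the point straddled, so by
  continuity their slopes control the difference quotients at that point.\<close>

lemma eventually_slope_if_not_straddled:
  fixes G :: "real \<Rightarrow> real"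
  assumes G: "continuous_on {a..b} G" and x: "a < x" "x < b"
    and ns: "x \<notin> straddled (\<lambda>u v. a \<le> u \<and> v \<le> b \<and> G v - G u < p * (v - u))"
  shows "\<forall>\<^sub>F y in at x. p \<le> (G y - G x) / (y - x)"
proof -
  obtain d where d: "d > 0" and
    st': "\<not> (\<exists>u v. u < x \<and> x < v \<and> v - u < d \<and> a \<le> u \<and> v \<le> b \<and> G v - G u < p * (v - u))"
    using ns unfolding straddled_def by blast
  have st: "p * (v - u) \<le> G v - G u" if "u < x" "x < v" "v - u < d" "a \<le> u" "v \<le> b" for u v
    using st' that by (meson not_less)
  \<comment> \<open>With e at most d / 2, two points on either side of x and within e of it are less
    than d apart.\<close>
  define e where "e = Min {d / 2, x - a, b - x}"
  have e: "e > 0" "e \<le> d / 2" "e \<le> x - a" "e \<le> b - x"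
  proof -
    show "e > 0" using d x by (simp add: e_def)
    show "e \<le> d / 2" "e \<le> x - a" "e \<le> b - x" unfolding e_def by (rule Min_le; simp)+
  qed
  have cont: "isCont G x"
    using G x by (intro continuous_on_interior[of "{a..b}"]) auto
  then have tl: "(G \<longlongrightarrow> G x) (at_left x)" and tr: "(G \<longlongrightarrow> G x) (at_right x)"
    by (auto simp: isCont_def filterlim_at_split)
  have right: "p * (y - x) \<le> G y - G x" if y: "x < y" "y < x + e" for y
  proof (rule tendsto_le)
    show "((\<lambda>u. p * (y - u)) \<longlongrightarrow> p * (y - x)) (at_left x)" by (intro tendsto_intros)
    show "((\<lambda>u. G y - G u) \<longlongrightarrow> G y - G x) (at_left x)" by (intro tendsto_intros tl)
    have "\<forall>\<^sub>F u in at_left x. u \<in> {x - e<..<x}"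
      using e by (intro eventually_at_left_real) auto
    then show "\<forall>\<^sub>F u in at_left x. p * (y - u) \<le> G y - G u"
      by eventually_elim (use y e in \<open>auto intro!: st\<close>)
  qed simp
  have left: "p * (x - y) \<le> G x - G y" if y: "x - e < y" "y < x" for y
  proof (rule tendsto_le)
    show "((\<lambda>v. p * (v - y)) \<longlongrightarrow> p * (x - y)) (at_right x)" by (intro tendsto_intros)
    show "((\<lambda>v. G v - G y) \<longlongrightarrow> G x - G y) (at_right x)" by (intro tendsto_intros tr)
    have "\<forall>\<^sub>F v in at_right x. v \<in> {x<..<x + e}"
      using e by (intro eventually_at_right_real) auto
    then show "\<forall>\<^sub>F v in at_right x. p * (v - y) \<le> G v - G y"
      by eventually_elim (use y e in \<open>auto intro!: st\<close>)
  qed simp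
  show ?thesis
    unfolding eventually_at
  proof (intro exI[of _ e] conjI ballI impI)
    fix y assume y: "y \<noteq> x \<and> dist y x < e"
    show "p \<le> (G y - G x) / (y - x)"
    proof (cases "x < y")
      case True
      then show ?thesis using right[of y] y by (simp add: dist_real_def field_simps)
    next
      case False
      then have "y < x" using y by simp
      then show ?thesis using left[of y] y by (simp add: dist_real_def field_simps)
    qed
  qed (rule e)
qed

text \<open>Off a null set the difference quotients are bounded and do not oscillate across any pair
  of rationals, hence they converge.\<close>

lemma abs_cont_real_differentiable_ae:
  fixes G :: "real \<Rightarrow> real"
  assumes ac: "abs_cont a b G"
  shows "negligible {x\<in>{a<..<b}. \<not> G differentiable (at x)}"
proof -
  let ?L = "\<lambda>p. straddled (\<lambda>u v. a \<le> u \<and> v \<le> b \<and> G v - G u < p * (v - u))"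
  let ?U = "\<lambda>q. straddled (\<lambda>u v. a \<le> u \<and> v \<le> b \<and> G v - G u > q * (v - u))"
  let ?S = "\<lambda>M::nat. straddled (\<lambda>u v. a \<le> u \<and> v \<le> b \<and> \<bar>G v - G u\<bar> > real M * (v - u))"
  let ?N = "(\<Union>(p,q)\<in>{(p,q). p \<in> \<rat> \<and> q \<in> \<rat> \<and> p < q}. ?L p \<inter> ?U q) \<union> (\<Inter>M. ?S M)"
  have "countable {(p,q). p \<in> \<rat> \<and> q \<in> \<rat> \<and> p < (q::real)}"
    by (rule countable_subset[of _ "\<rat> \<times> \<rat>"]) (auto simp: countable_rat)
  then have "negligible ?N"
    using negligible_straddled_slopes[OF ac] negligible_straddled_steep[OF ac]
    by (intro negligible_Un negligible_countable_Union) auto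
  moreover have "{x\<in>{a<..<b}. \<not> G differentiable (at x)} \<subseteq> ?N"
  proof (rule ccontr)
    assume "\<not> ?thesis"
    then obtain x where x: "a < x" "x < b" "\<not> G differentiable (at x)"
      "\<And>p q. p \<in> \<rat> \<Longrightarrow> q \<in> \<rat> \<Longrightarrow> p < q \<Longrightarrow> x \<notin> ?L p \<or> x \<notin> ?U q" "\<exists>M. x \<notin> ?S M"
      by fastforce
    note cont = abs_cont_imp_continuous_on[OF ac]
    let ?s = "\<lambda>y. (G y - G x) / (y - x)"
    have low: "\<forall>\<^sub>F y in at x. p \<le> ?s y" if "x \<notin> ?L p" for p
      by (rule eventually_slope_if_not_straddled[OF cont x(1,2) that])
    have upp: "\<forall>\<^sub>F y in at x. ?s y \<le> q" if "x \<notin> ?U q" for q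
    proof -
      \<comment> \<open>Upper bounds on the slopes of \<open>G\<close> are lower bounds on those of
        \<open>- G\<close>.\<close>
      have "\<forall>\<^sub>F y in at x. - q \<le> (- G y - - G x) / (y - x)"
      proof (rule eventually_slope_if_not_straddled[OF _ x(1,2)])
        show "x \<notin> straddled (\<lambda>u v. a \<le> u \<and> v \<le> b \<and> - G v - - G u < - q * (v - u))"
          using that by (simp add: algebra_simps)
      qed (intro continuous_intros cont)
      then show ?thesis
      proof eventually_elim
        case (elim y)
        have "(- G y - - G x) / (y - x) = - ?s y" by (simp add: minus_divide_left)
        with elim show ?case by linarith
      qed
    qed
    obtain M where M: "x \<notin> ?S M" using x(5) by blast
    have "\<forall>\<^sub>F y in at x. - real M \<le> ?s y"
    proof (rule low)
      show "x \<notin> ?L (- real M)"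
        using M unfolding straddled_def by simp (smt (verit, best))
    qed
    moreover have "\<forall>\<^sub>F y in at x. ?s y \<le> real M"
    proof (rule upp)
      show "x \<notin> ?U (real M)"
        using M unfolding straddled_def by simp (smt (verit, best))
    qed
    ultimately have "\<forall>\<^sub>F y in at x. \<bar>?s y\<bar> \<le> real M"
      by eventually_elim (rule abs_leI; linarith)
    then obtain L where "(?s \<longlongrightarrow> L) (at x)"
    proof (rule convergent_if_slopes_separated[rotated])
      fix p q :: real assume pq: "p \<in> \<rat>" "q \<in> \<rat>" "p < q"
      show "(\<forall>\<^sub>F y in at x. p \<le> ?s y) \<or> (\<forall>\<^sub>F y in at x. ?s y \<le> q)"
        using x(4)[OF pq] low[of p] upp[of q] by meson
    qed auto
    then have "(G has_field_derivative L) (at x)"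
      by (simp add: has_field_derivative_iff)
    then show False using x(3) real_differentiable_def by blast
  qed
  ultimately show ?thesis by (rule negligible_subset)
qed

lemma abs_cont_differentiable_ae:
  fixes F :: "real \<Rightarrow> complex"
  assumes ac: "abs_cont a b F"
  shows "negligible {x\<in>{a<..<b}. \<not> F differentiable (at x)}"
proof -
  have re: "abs_cont a b (\<lambda>x. Re (F x))" and im: "abs_cont a b (\<lambda>x. Im (F x))"
    by (rule abs_cont_mono[OF ac], metis abs_Re_le_cmod minus_complex.sel(1) real_norm_def,
        rule abs_cont_mono[OF ac], metis abs_Im_le_cmod minus_complex.sel(2) real_norm_def)
  have "F differentiable (at x)"
    if ri: "(\<lambda>x. Re (F x)) differentiable (at x)" "(\<lambda>x. Im (F x)) differentiable (at x)" for x
  proof -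
    obtain c d where "((\<lambda>x. Re (F x)) has_vector_derivative c) (at x)"
      "((\<lambda>x. Im (F x)) has_vector_derivative d) (at x)"
      using ri by (meson vector_derivative_works)
    then have "((\<lambda>x. Complex (Re (F x)) (Im (F x))) has_vector_derivative Complex c d) (at x)"
      by (simp add: has_vector_derivative_complex_iff has_real_derivative_iff_has_vector_derivative)
    then show ?thesis by (auto intro: differentiableI_vector)
  qed
  then show ?thesis
    by (intro negligible_subset[OF negligible_Un[OF abs_cont_real_differentiable_ae[OF re]
          abs_cont_real_differentiable_ae[OF im]]]) auto
qed

subsection \<open>The fundamental theorem of calculus\<close>

text \<open>The Henstock sum has two kinds of cells. At tags off the exceptional set,
  differentiability makes the error at most e / 2 times the length. Cells tagged in the exceptional
  set are forced by the gauge into an open set \<open>T\<close> of measure below \<delta>; there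
  \<open>h'\<close> contributes 0 and absolute continuity bounds the increments of \<open>F\<close>
  by the other half.\<close>

lemma fundamental_theorem_abs_cont:
  fixes F :: "real \<Rightarrow> 'a::banach"
  assumes ac: "abs_cont a b F" and ab: "a \<le> b" and N: "negligible N"
    and der: "\<And>x. x \<in> {a<..<b} - N \<Longrightarrow> (F has_vector_derivative h x) (at x)"
  shows "(h has_integral F b - F a) {a..b}"
proof (cases "a = b")
  case True
  then show ?thesis using has_integral_refl[of h b] by simp
next
  case False
  with ab have ab: "a < b" by simp
  \<comment> \<open>The derivative is assumed in the interior only, so the end points join the
    exceptional set.\<close>
  define N' where "N' = N \<union> {a, b}"
  define h' where "h' = (\<lambda>x. if x \<in> N' then 0 else h x)"
  have N': "negligible N'" using N by (simp add: N'_def)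
  have "(h' has_integral F b - F a) {a..b}"
    unfolding has_integral_factor_content_real
  proof (intro allI impI)
    fix e :: real assume e: "e > 0"
    define e' where "e' = e / 2"
    have e': "e' > 0" using e by (simp add: e'_def)
    then have "e' * (b - a) > 0" using ab by simp
    from abs_contE[OF ac this] obtain \<delta> where "\<delta> > 0" and \<delta>:
      "\<And>D. D division_of \<Union>D \<Longrightarrow> \<Union>D \<subseteq> {a..b} \<Longrightarrow> (\<Sum>k\<in>D. Sup k - Inf k) < \<delta>
        \<Longrightarrow> (\<Sum>k\<in>D. norm (F (Sup k) - F (Inf k))) < e' * (b - a)" by blast
    obtain T where T: "open T" "N' \<subseteq> T" "T - N' \<in> lmeasurable" "emeasure lebesgue (T - N') < ennreal \<delta>"
      using sets_lebesgue_outer_open[OF negligible_imp_sets[OF N'] \<open>\<delta> > 0\<close>] by blast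
    have N'm: "N' \<in> lmeasurable" using N' by (rule negligible_imp_measurable)
    have Tl: "T \<in> lmeasurable"
      using T N'm by (metis Diff_partition fmeasurable.Un)
    have "measure lebesgue (T - N') < \<delta>"
      using T \<open>\<delta> > 0\<close> by (simp add: emeasure_eq_measure2 ennreal_less_iff)
    then have mT: "measure lebesgue T < \<delta>"
      using measurable_measure_Diff[OF Tl fmeasurableD[OF N'm] T(2)] negligible_imp_measure0[OF N'] by simp
    have "\<exists>d>0. \<forall>y\<in>{a..b}. \<bar>y - x\<bar> < d \<longrightarrow> norm (F y - F x - (y - x) *\<^sub>R h x) \<le> e' * \<bar>y - x\<bar>"
      if "x \<in> {a..b} - N'" for x
    proof -
      have "x \<in> {a<..<b} - N" using that by (auto simp: N'_def)
      from der[OF this] have "\<exists>d>0. \<forall>y. \<bar>y - x\<bar> < d \<longrightarrow> norm (F y - F x - (y - x) *\<^sub>R h x) \<le> e' * \<bar>y - x\<bar>"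
        using e' unfolding has_vector_derivative_def has_derivative_at_alt by auto
      then show ?thesis by blast
    qed
    then obtain d where d: "\<And>x. x \<in> {a..b} - N' \<Longrightarrow> d x > 0"
      "\<And>x y. x \<in> {a..b} - N' \<Longrightarrow> y \<in> {a..b} \<Longrightarrow> \<bar>y - x\<bar> < d x \<Longrightarrow>
          norm (F y - F x - (y - x) *\<^sub>R h x) \<le> e' * \<bar>y - x\<bar>"
      by metis
    define \<gamma> where "\<gamma> = (\<lambda>x. if x \<in> N' then T else if x \<in> {a..b} then ball x (d x) else UNIV)"
    have g1: "gauge \<gamma>"
      using T(1,2) d(1) by (auto simp: gauge_def \<gamma>_def)
    have g2: "norm ((\<Sum>(x,k)\<in>p. Sigma_Algebra.measure lborel k *\<^sub>R h' x) - (F b - F a)) \<le> e * Sigma_Algebra.measure lborel {a..b}"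
      if p: "p tagged_division_of {a..b}" and fine: "\<gamma> fine p" for p
    proof -
      note pD = tagged_division_ofD[OF p]
      have cell: "k = {Inf k..Sup k}" "Inf k \<le> Sup k" "x \<in> k" "k \<subseteq> {a..b}" "k \<subseteq> \<gamma> x"
          "Sigma_Algebra.measure lborel k = Sup k - Inf k" if xk: "(x, k) \<in> p" for x k
      proof -
        obtain u v where uv: "k = cbox u v" using pD(4)[OF xk] by blast
        moreover have "x \<in> k" by (rule pD(2)[OF xk])
        ultimately have "u \<le> v" by auto
        with uv show "k = {Inf k..Sup k}" "Inf k \<le> Sup k" "Sigma_Algebra.measure lborel k = Sup k - Inf k"
          by auto
        show "x \<in> k" "k \<subseteq> {a..b}" "k \<subseteq> \<gamma> x"
          using pD(2,3)[OF xk] fine xk by (auto simp: fine_def)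
      qed
      define q where "q = {(x,k)\<in>p. x \<in> N'}"
      have qp: "q \<subseteq> p" by (auto simp: q_def)
      have fp: "finite p" by (rule pD(1))
      have "q tagged_partial_division_of {a..b}"
        using p qp by (metis tagged_division_of_def tagged_partial_division_subset)
      then have q: "q tagged_division_of \<Union>(snd ` q)"
        by (rule tagged_partial_division_of_Union_self)
      have sq: "snd ` q division_of \<Union>(snd ` q)"
        by (rule division_of_tagged_division[OF q])
      have qb: "(\<Sum>(x,k)\<in>q. norm (F (Sup k) - F (Inf k))) < e' * (b - a)"
      proof -
        \<comment> \<open>The transfer from tagged cells to cells requires the value 0 on every
          degenerate box; the case distinction covers the empty one, where \<open>Sup\<close> and
          \<open>Inf\<close> carry no information.\<close>
        let ?d = "\<lambda>k. if k = {} then 0 else norm (F (Sup k) - F (Inf k))"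
        have ne: "k \<noteq> {}" if "(x, k) \<in> q" for x k
          using cell(3) that qp by blast
        have "(\<Sum>(x,k)\<in>q. norm (F (Sup k) - F (Inf k))) = (\<Sum>(x,k)\<in>q. ?d k)"
          by (rule sum.cong) (use ne in auto)
        also have "\<dots> = (\<Sum>k\<in>snd ` q. ?d k)"
        proof (rule sum.over_tagged_division_lemma[OF q])
          fix u v :: real assume "box u v = {}"
          then have "v \<le> u" by simp
          then show "?d (cbox u v) = 0"
            by (cases "u = v") auto
        qed
        also have "\<dots> = (\<Sum>k\<in>snd ` q. norm (F (Sup k) - F (Inf k)))"
          by (rule sum.cong) (use ne in auto)
        also have "\<dots> < e' * (b - a)"
        proof (rule \<delta>[OF sq])
          show "\<Union>(snd ` q) \<subseteq> {a..b}" using cell(4) qp by fastforce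
          have "(\<Sum>k\<in>snd ` q. Sup k - Inf k) = measure lebesgue (\<Union>(snd ` q))"
            using content_division[OF sq] division_cell_real(3)[OF sq] by simp
          also have "\<dots> \<le> measure lebesgue T"
          proof (rule measure_mono_fmeasurable)
            show "\<Union>(snd ` q) \<subseteq> T"
              using cell(5) by (fastforce simp: q_def \<gamma>_def)
          qed (use lmeasurable_division[OF sq] Tl in auto)
          finally show "(\<Sum>k\<in>snd ` q. Sup k - Inf k) < \<delta>" using mT by simp
        qed
        finally show ?thesis .
      qed
      have good: "norm ((Sup k - Inf k) *\<^sub>R h x - (F (Sup k) - F (Inf k))) \<le> e' * (Sup k - Inf k)"
        if xk: "(x, k) \<in> p" "x \<notin> N'" for x k
      proof -
        note c = cell[OF xk(1)]
        have x: "x \<in> {a..b} - N'" using c(3,4) xk(2) by auto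
        have kx: "k \<subseteq> ball x (d x)" using c(5) x by (simp add: \<gamma>_def)
        have ends: "Inf k \<in> k" "Sup k \<in> k" using c(1,2) by (metis atLeastAtMost_iff order_refl)+
        have xin: "Inf k \<le> x" "x \<le> Sup k" using c(1,3) by (metis atLeastAtMost_iff)+
        have "Inf k \<in> {a..b}" "Sup k \<in> {a..b}" "\<bar>Inf k - x\<bar> < d x" "\<bar>Sup k - x\<bar> < d x"
          using subsetD[OF kx ends(1)] subsetD[OF kx ends(2)] subsetD[OF c(4) ends(1)] subsetD[OF c(4) ends(2)]
          by (auto simp: dist_real_def abs_minus_commute)
        note dd = d(2)[OF x this(1,3)] d(2)[OF x this(2,4)]
        have b1: "norm (F (Sup k) - F x - (Sup k - x) *\<^sub>R h x) \<le> e' * (Sup k - x)"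
          using dd(2) xin by simp
        have b2: "norm (F (Inf k) - F x - (Inf k - x) *\<^sub>R h x) \<le> e' * (x - Inf k)"
          using dd(1) xin by simp
        have "(Sup k - Inf k) *\<^sub>R h x - (F (Sup k) - F (Inf k)) =
            (F (Inf k) - F x - (Inf k - x) *\<^sub>R h x) - (F (Sup k) - F x - (Sup k - x) *\<^sub>R h x)"
          by (simp add: algebra_simps)
        also have "norm \<dots> \<le> e' * (x - Inf k) + e' * (Sup k - x)"
          by (rule order_trans[OF norm_triangle_ineq4 add_mono[OF b2 b1]])
        also have "\<dots> = e' * (Sup k - Inf k)" by (simp add: algebra_simps)
        finally show ?thesis .
      qed
      have tot: "(\<Sum>(x,k)\<in>p. Sup k - Inf k) = b - a"
        using additive_tagged_division_1[OF less_imp_le[OF ab] p, of "\<lambda>x. x"] by simp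
      have "(\<Sum>(x,k)\<in>p. Sigma_Algebra.measure lborel k *\<^sub>R h' x) - (F b - F a)
          = (\<Sum>(x,k)\<in>p. (Sup k - Inf k) *\<^sub>R h' x - (F (Sup k) - F (Inf k)))"
      proof -
        have "(\<Sum>(x,k)\<in>p. Sigma_Algebra.measure lborel k *\<^sub>R h' x) = (\<Sum>(x,k)\<in>p. (Sup k - Inf k) *\<^sub>R h' x)"
          by (rule sum.cong) (auto simp: cell(6))
        moreover have "F b - F a = (\<Sum>(x,k)\<in>p. F (Sup k) - F (Inf k))"
          using additive_tagged_division_1[OF less_imp_le[OF ab] p, of F] by simp
        ultimately show ?thesis by (simp add: sum_subtractf case_prod_unfold)
      qed
      also have "norm \<dots> \<le> (\<Sum>(x,k)\<in>p. norm ((Sup k - Inf k) *\<^sub>R h' x - (F (Sup k) - F (Inf k))))"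
        by (rule order_trans[OF norm_sum]) (simp add: case_prod_unfold)
      also have "\<dots> = (\<Sum>(x,k)\<in>p - q. norm ((Sup k - Inf k) *\<^sub>R h' x - (F (Sup k) - F (Inf k))))
          + (\<Sum>(x,k)\<in>q. norm ((Sup k - Inf k) *\<^sub>R h' x - (F (Sup k) - F (Inf k))))"
        by (rule sum.subset_diff[OF qp fp])
      also have "(\<Sum>(x,k)\<in>q. norm ((Sup k - Inf k) *\<^sub>R h' x - (F (Sup k) - F (Inf k))))
          = (\<Sum>(x,k)\<in>q. norm (F (Sup k) - F (Inf k)))"
        by (rule sum.cong) (auto simp: q_def h'_def norm_minus_commute)
      also have "(\<Sum>(x,k)\<in>p - q. norm ((Sup k - Inf k) *\<^sub>R h' x - (F (Sup k) - F (Inf k))))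
          \<le> (\<Sum>(x,k)\<in>p - q. e' * (Sup k - Inf k))"
      proof (rule sum_mono)
        fix z assume "z \<in> p - q"
        then obtain x k where z: "z = (x, k)" "(x, k) \<in> p" "x \<notin> N'"
          by (cases z) (auto simp: q_def)
        show "(case z of (x, k) \<Rightarrow> norm ((Sup k - Inf k) *\<^sub>R h' x - (F (Sup k) - F (Inf k))))
            \<le> (case z of (x, k) \<Rightarrow> e' * (Sup k - Inf k))"
          using good[OF z(2,3)] z by (simp add: h'_def)
      qed
      also have "(\<Sum>(x,k)\<in>p - q. e' * (Sup k - Inf k)) \<le> (\<Sum>(x,k)\<in>p. e' * (Sup k - Inf k))"
        using fp cell(2) e' by (intro sum_mono2) auto
      also have "\<dots> = e' * (b - a)"
        using tot by (simp add: case_prod_unfold flip: sum_distrib_left)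
      finally have "norm ((\<Sum>(x,k)\<in>p. Sigma_Algebra.measure lborel k *\<^sub>R h' x) - (F b - F a)) \<le> e' * (b - a) + e' * (b - a)"
        using qb by simp
      then show ?thesis using ab by (simp add: e'_def)
    qed
    show "\<exists>d. gauge d \<and> (\<forall>p. p tagged_division_of {a..b} \<and> d fine p \<longrightarrow>
        norm ((\<Sum>(x,k)\<in>p. Sigma_Algebra.measure lborel k *\<^sub>R h' x) - (F b - F a)) \<le> e * Sigma_Algebra.measure lborel {a..b})"
      by (intro exI[of _ \<gamma>] conjI allI impI g1 g2) simp_all
  qed
  then show ?thesis
    by (rule has_integral_spike[OF N', rotated]) (simp add: h'_def)
qed

lemma abs_cont_subinterval:
  assumes "abs_cont a b F" "a \<le> c" "d \<le> b"
  shows "abs_cont c d F"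
proof -
  have sub: "{c..d} \<subseteq> {a..b}" using assms by auto
  show ?thesis
    unfolding abs_cont_def
  proof (intro allI impI)
    fix \<epsilon> :: real assume "\<epsilon> > 0"
    from abs_contE[OF assms(1) this] obtain \<delta> where \<delta>: "\<delta> > 0"
      "\<And>D. D division_of \<Union>D \<Longrightarrow> \<Union>D \<subseteq> {a..b} \<Longrightarrow> (\<Sum>k\<in>D. Sup k - Inf k) < \<delta>
          \<Longrightarrow> (\<Sum>k\<in>D. norm (F (Sup k) - F (Inf k))) < \<epsilon>" by blast
    show "\<exists>\<delta>>0. \<forall>D. D division_of \<Union>D \<and> \<Union>D \<subseteq> {c..d} \<and> (\<Sum>k\<in>D. Sup k - Inf k) < \<delta>
        \<longrightarrow> (\<Sum>k\<in>D. norm (F (Sup k) - F (Inf k))) < \<epsilon>"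
      using \<delta>(1) by (intro exI[of _ \<delta>] conjI allI impI \<delta>(2)) (use sub in auto)
  qed
qed

text \<open>On intervals shorter than \<delta> the sums of the norms of integrals of
  \<open>h\<close> over a division are increments of \<open>F\<close> and total at most 1, so
  \<open>h\<close> has an integrable norm there; integrability over \<open>{a..b}\<close> then
  follows from that on all sufficiently small subintervals.\<close>

lemma fundamental_theorem_abs_cont_absolutely_integrable:
  fixes F :: "real \<Rightarrow> 'a::euclidean_space"
  assumes ac: "abs_cont a b F" and ab: "a \<le> b" and N: "negligible N"
    and der: "\<And>x. x \<in> {a<..<b} - N \<Longrightarrow> (F has_vector_derivative h x) (at x)"
  shows "h absolutely_integrable_on {a..b}"
proof -
  have ftc: "(h has_integral F v - F u) {u..v}" if "a \<le> u" "u \<le> v" "v \<le> b" for u v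
    using that by (intro fundamental_theorem_abs_cont[OF abs_cont_subinterval[OF ac] _ N] der) auto
  obtain \<delta> where "\<delta> > 0" and \<delta>:
      "\<And>D. D division_of \<Union>D \<Longrightarrow> \<Union>D \<subseteq> {a..b} \<Longrightarrow> (\<Sum>k\<in>D. Sup k - Inf k) < \<delta>
        \<Longrightarrow> (\<Sum>k\<in>D. norm (F (Sup k) - F (Inf k))) < 1"
    using abs_contE[OF ac zero_less_one] by blast
  have small: "h absolutely_integrable_on {u..v}" if uv: "a \<le> u" "u \<le> v" "v \<le> b" "v - u < \<delta>" for u v
  proof -
    have "h absolutely_integrable_on cbox u v"
    proof (rule bounded_variation_absolutely_integrable_interval)
      show "h integrable_on cbox u v" using ftc[OF uv(1-3)] by auto
      fix D assume "D division_of cbox u v"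
      then have D: "D division_of {u..v}" by simp
      have DU: "\<Union>D = {u..v}" by (rule division_ofD(6)[OF D])
      note cell = division_cell_real[OF D]
      have "(\<Sum>k\<in>D. norm (integral k h)) = (\<Sum>k\<in>D. norm (F (Sup k) - F (Inf k)))"
      proof (rule sum.cong)
        fix k assume k: "k \<in> D"
        have "k \<subseteq> {u..v}" by (rule division_ofD(2)[OF D k])
        then have "a \<le> Inf k" "Sup k \<le> b"
          using cell(1,2)[OF k] uv by (metis atLeastatMost_subset_iff order_trans)+
        then have "integral {Inf k..Sup k} h = F (Sup k) - F (Inf k)"
          using ftc cell(2)[OF k] by (intro integral_unique) auto
        then show "norm (integral k h) = norm (F (Sup k) - F (Inf k))"
          using cell(1)[OF k] by simp
      qed simp
      also have "\<dots> \<le> 1"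
      proof (rule less_imp_le, rule \<delta>)
        show "(\<Sum>k\<in>D. Sup k - Inf k) < \<delta>"
          using sum_division_real[OF D uv(2), of "\<lambda>x. x"] uv(4) by simp
      qed (use D DU uv in auto)
      finally show "(\<Sum>k\<in>D. norm (integral k h)) \<le> 1" .
    qed
    then show ?thesis by simp
  qed
  have "(\<lambda>x. norm (h x)) integrable_on cbox a b"
  proof (rule integrable_on_little_subintervals)
    show "\<forall>x\<in>cbox a b. \<exists>d>0. \<forall>u v. x \<in> cbox u v \<and> cbox u v \<subseteq> ball x d \<and> cbox u v \<subseteq> cbox a b \<longrightarrow>
        (\<lambda>x. norm (h x)) integrable_on cbox u v"
    proof (intro ballI exI[of _ "\<delta> / 2"] conjI allI impI)
      fix x u v assume "x \<in> cbox a b" and uv: "x \<in> cbox u v \<and> cbox u v \<subseteq> ball x (\<delta> / 2) \<and> cbox u v \<subseteq> cbox a b"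
      then have "u \<le> v" by auto
      then have "u \<in> ball x (\<delta> / 2)" "v \<in> ball x (\<delta> / 2)" "a \<le> u" "v \<le> b"
        using uv by (auto simp only: box_real atLeastAtMost_iff subset_iff)
      then have "v - u < \<delta>" by (auto simp: dist_real_def abs_if split: if_splits)
      then show "(\<lambda>x. norm (h x)) integrable_on cbox u v"
        using small[OF \<open>a \<le> u\<close> \<open>u \<le> v\<close> \<open>v \<le> b\<close>] by (auto simp: absolutely_integrable_on_def)
    qed (use \<open>\<delta> > 0\<close> in auto)
  qed
  moreover have "h integrable_on {a..b}" using ftc[of a b] ab by auto
  ultimately show ?thesis by (simp add: absolutely_integrable_on_def)
qed

text \<open>The common source of the closure properties: sums, products, conjugates, Lipschitz
  functions and functions agreeing on the interval differ only in how their increments are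
  bounded.\<close>

lemma AC_on_dominated:
  assumes F: "AC_on a b F" and G: "AC_on a b G" and "A \<ge> 0" "B \<ge> 0"
    and H: "\<And>u v. a \<le> u \<Longrightarrow> u \<le> v \<Longrightarrow> v \<le> b \<Longrightarrow>
        cmod (H v - H u) \<le> A * cmod (F v - F u) + B * cmod (G v - G u)"
  shows "AC_on a b H"
  unfolding AC_on_def
proof (intro allI impI)
  fix \<epsilon> :: real assume "\<epsilon> > 0"
  define \<epsilon>' where "\<epsilon>' = \<epsilon> / (A + B + 1)"
  have \<epsilon>': "\<epsilon>' > 0" using \<open>\<epsilon> > 0\<close> assms(3,4) by (simp add: \<epsilon>'_def)
  obtain d1 where d1: "d1 > 0" "\<forall>(n::nat) u v. (\<forall>i<n. a \<le> u i \<and> u i \<le> v i \<and> v i \<le> b) \<and>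
        (\<forall>i<n. \<forall>j<n. i \<noteq> j \<longrightarrow> {u i<..<v i} \<inter> {u j<..<v j} = {}) \<and>
        (\<Sum>i<n. v i - u i) < d1 \<longrightarrow> (\<Sum>i<n. cmod (F (v i) - F (u i))) < \<epsilon>'"
    using F \<epsilon>' unfolding AC_on_def by blast
  obtain d2 where d2: "d2 > 0" "\<forall>(n::nat) u v. (\<forall>i<n. a \<le> u i \<and> u i \<le> v i \<and> v i \<le> b) \<and>
        (\<forall>i<n. \<forall>j<n. i \<noteq> j \<longrightarrow> {u i<..<v i} \<inter> {u j<..<v j} = {}) \<and>
        (\<Sum>i<n. v i - u i) < d2 \<longrightarrow> (\<Sum>i<n. cmod (G (v i) - G (u i))) < \<epsilon>'"
    using G \<epsilon>' unfolding AC_on_def by blast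
  show "\<exists>\<delta>>0. \<forall>(n::nat) (u::nat \<Rightarrow> real) (v::nat \<Rightarrow> real).
        (\<forall>i<n. a \<le> u i \<and> u i \<le> v i \<and> v i \<le> b) \<and>
        (\<forall>i<n. \<forall>j<n. i \<noteq> j \<longrightarrow> {u i<..<v i} \<inter> {u j<..<v j} = {}) \<and>
        (\<Sum>i<n. v i - u i) < \<delta>
        \<longrightarrow> (\<Sum>i<n. cmod (H (v i) - H (u i))) < \<epsilon>"
  proof (intro exI[of _ "min d1 d2"] conjI allI impI)
    fix n :: nat and u v :: "nat \<Rightarrow> real"
    assume *: "(\<forall>i<n. a \<le> u i \<and> u i \<le> v i \<and> v i \<le> b) \<and>
        (\<forall>i<n. \<forall>j<n. i \<noteq> j \<longrightarrow> {u i<..<v i} \<inter> {u j<..<v j} = {}) \<and>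
        (\<Sum>i<n. v i - u i) < min d1 d2"
    have 1: "(\<Sum>i<n. cmod (F (v i) - F (u i))) < \<epsilon>'"
      by (rule d1(2)[rule_format]) (use * in auto)
    have 2: "(\<Sum>i<n. cmod (G (v i) - G (u i))) < \<epsilon>'"
      by (rule d2(2)[rule_format]) (use * in auto)
    have "(\<Sum>i<n. cmod (H (v i) - H (u i))) \<le> (\<Sum>i<n. A * cmod (F (v i) - F (u i)) + B * cmod (G (v i) - G (u i)))"
      using * by (intro sum_mono H) auto
    also have "\<dots> = A * (\<Sum>i<n. cmod (F (v i) - F (u i))) + B * (\<Sum>i<n. cmod (G (v i) - G (u i)))"
      by (simp add: sum.distrib sum_distrib_left)
    also have "\<dots> \<le> A * \<epsilon>' + B * \<epsilon>'"
      using 1 2 assms(3,4) by (intro add_mono mult_left_mono) auto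
    also have "\<dots> < (A + B + 1) * \<epsilon>'"
      using \<epsilon>' by (simp add: algebra_simps)
    also have "\<dots> = \<epsilon>" using assms(3,4) by (simp add: \<epsilon>'_def)
    finally show "(\<Sum>i<n. cmod (H (v i) - H (u i))) < \<epsilon>" .
  qed (use d1 d2 in auto)
qed

text \<open>The comparison function through which Lipschitz bounds enter
  \<open>AC_on_dominated\<close>.\<close>

lemma AC_on_of_real: "AC_on a b of_real"
  unfolding AC_on_def
proof (intro allI impI)
  fix \<epsilon> :: real assume e: "\<epsilon> > 0"
  show "\<exists>\<delta>>0. \<forall>(n::nat) (u::nat \<Rightarrow> real) (v::nat \<Rightarrow> real).
        (\<forall>i<n. a \<le> u i \<and> u i \<le> v i \<and> v i \<le> b) \<and>
        (\<forall>i<n. \<forall>j<n. i \<noteq> j \<longrightarrow> {u i<..<v i} \<inter> {u j<..<v j} = {}) \<and>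
        (\<Sum>i<n. v i - u i) < \<delta>
        \<longrightarrow> (\<Sum>i<n. cmod (of_real (v i) - of_real (u i))) < \<epsilon>"
  proof (intro exI[of _ \<epsilon>] conjI allI impI e)
    fix n :: nat and u v :: "nat \<Rightarrow> real"
    assume *: "(\<forall>i<n. a \<le> u i \<and> u i \<le> v i \<and> v i \<le> b) \<and>
        (\<forall>i<n. \<forall>j<n. i \<noteq> j \<longrightarrow> {u i<..<v i} \<inter> {u j<..<v j} = {}) \<and>
        (\<Sum>i<n. v i - u i) < \<epsilon>"
    have "(\<Sum>i<n. cmod (of_real (v i) - of_real (u i))) = (\<Sum>i<n. v i - u i)"
      using * by (intro sum.cong) (auto simp flip: of_real_diff)
    then show "(\<Sum>i<n. cmod (of_real (v i) - of_real (u i))) < \<epsilon>" using * by simp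
  qed
qed

lemma AC_on_lipschitz:
  assumes "B \<ge> 0" "\<And>u v. a \<le> u \<Longrightarrow> u \<le> v \<Longrightarrow> v \<le> b \<Longrightarrow> cmod (H v - H u) \<le> B * (v - u)"
  shows "AC_on a b H"
  by (rule AC_on_dominated[OF AC_on_of_real AC_on_of_real assms(1), of 0])
     (use assms in \<open>auto simp flip: of_real_diff\<close>)

lemma AC_on_mult:
  assumes F: "AC_on a b F" and G: "AC_on a b G"
  shows "AC_on a b (\<lambda>x. F x * G x)"
proof -
  have "bounded (F ` {a..b})" "bounded (G ` {a..b})"
    using F G by (auto intro!: compact_imp_bounded compact_continuous_image abs_cont_imp_continuous_on AC_on_imp_abs_cont)
  then obtain A B where A: "A > 0" "\<And>x. x \<in> {a..b} \<Longrightarrow> cmod (F x) \<le> A"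
    and B: "B > 0" "\<And>x. x \<in> {a..b} \<Longrightarrow> cmod (G x) \<le> B"
    unfolding bounded_pos by auto
  show ?thesis
  proof (rule AC_on_dominated[OF F G, of B A])
    fix u v assume uv: "a \<le> u" "u \<le> v" "v \<le> b"
    have "F v * G v - F u * G u = (F v - F u) * G v + F u * (G v - G u)"
      by (simp add: algebra_simps)
    also have "cmod \<dots> \<le> cmod (F v - F u) * cmod (G v) + cmod (F u) * cmod (G v - G u)"
      by (rule order_trans[OF norm_triangle_ineq]) (simp add: norm_mult)
    also have "\<dots> \<le> cmod (F v - F u) * B + A * cmod (G v - G u)"
      using A B uv by (intro add_mono mult_left_mono mult_right_mono) auto
    finally show "cmod (F v * G v - F u * G u) \<le> B * cmod (F v - F u) + A * cmod (G v - G u)"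
      by (simp add: mult.commute)
  qed (use A B in auto)
qed

lemma AC_on_cong:
  assumes "AC_on a b F" "\<And>x. x \<in> {a..b} \<Longrightarrow> G x = F x"
  shows "AC_on a b G"
  by (rule AC_on_dominated[OF assms(1,1), of 1 0]) (use assms(2) in auto)

section \<open>Local absolute continuity on the open interval\<close>

lemma AC_locD: "F \<in> AC_loc \<Longrightarrow> -1 < a \<Longrightarrow> a \<le> b \<Longrightarrow> b < 1 \<Longrightarrow> AC_on a b F"
  by (simp add: AC_loc_def)

lemma AC_loc_cong:
  assumes "F \<in> AC_loc" "\<And>x. x \<in> {-1<..<1} \<Longrightarrow> G x = F x"
  shows "G \<in> AC_loc"
  unfolding AC_loc_def
proof (intro CollectI allI impI)
  fix a b :: real assume "-1 < a \<and> a \<le> b \<and> b < 1"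
  then show "AC_on a b G"
    by (intro AC_on_cong[OF AC_locD[OF assms(1)]] assms(2)) auto
qed

lemma AC_loc_mult: "F \<in> AC_loc \<Longrightarrow> G \<in> AC_loc \<Longrightarrow> (\<lambda>x. F x * G x) \<in> AC_loc"
  by (simp add: AC_loc_def AC_on_mult)

lemma AC_loc_add:
  assumes "F \<in> AC_loc" "G \<in> AC_loc"
  shows "(\<lambda>x. F x + G x) \<in> AC_loc"
  unfolding AC_loc_def
proof (intro CollectI allI impI)
  fix a b :: real assume ab: "-1 < a \<and> a \<le> b \<and> b < 1"
  show "AC_on a b (\<lambda>x. F x + G x)"
  proof (rule AC_on_dominated[OF AC_locD[OF assms(1)] AC_locD[OF assms(2)], of a b 1 1])
    fix u v
    show "cmod (F v + G v - (F u + G u)) \<le> 1 * cmod (F v - F u) + 1 * cmod (G v - G u)"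
      using norm_triangle_ineq[of "F v - F u" "G v - G u"] by (simp add: algebra_simps)
  qed (use ab in auto)
qed

lemma AC_loc_cnj:
  assumes "F \<in> AC_loc"
  shows "(\<lambda>x. cnj (F x)) \<in> AC_loc"
  unfolding AC_loc_def
proof (intro CollectI allI impI)
  fix a b :: real assume ab: "-1 < a \<and> a \<le> b \<and> b < 1"
  show "AC_on a b (\<lambda>x. cnj (F x))"
    by (rule AC_on_dominated[OF AC_locD[OF assms] AC_locD[OF assms], where A = 1 and B = 0])
       (use ab in \<open>auto simp flip: complex_cnj_diff\<close>)
qed

lemma continuous_on_AC_loc:
  assumes "F \<in> AC_loc"
  shows "continuous_on {-1<..<1} F"
proof -
  have "isCont F x" if x: "x \<in> {-1<..<1}" for x
  proof (rule continuous_on_interior)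
    show "continuous_on {(x - 1) / 2..(x + 1) / 2} F"
      using x by (intro abs_cont_imp_continuous_on AC_on_imp_abs_cont AC_locD[OF assms]) auto
    show "x \<in> interior {(x - 1) / 2..(x + 1) / 2}" using x by auto
  qed
  then show ?thesis by (intro continuous_at_imp_continuous_on) auto
qed

lemma AC_loc_C1:
  assumes der: "\<And>x. x \<in> {-1<..<1} \<Longrightarrow> (F has_vector_derivative F' x) (at x)"
    and cont: "continuous_on {-1<..<1} F'"
  shows "F \<in> AC_loc"
  unfolding AC_loc_def
proof (intro CollectI allI impI)
  fix a b :: real assume ab: "-1 < a \<and> a \<le> b \<and> b < 1"
  have "compact (F' ` {a..b})"
    using ab by (intro compact_continuous_image continuous_on_subset[OF cont]) auto
  then obtain B where B: "B > 0" "\<And>x. x \<in> {a..b} \<Longrightarrow> cmod (F' x) \<le> B"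
    by (auto dest!: compact_imp_bounded simp: bounded_pos)
  show "AC_on a b F"
  proof (rule AC_on_lipschitz)
    fix u v assume uv: "a \<le> u" "u \<le> v" "v \<le> b"
    have "norm (F v - F u) \<le> B * norm (v - u)"
    proof (rule differentiable_bound)
      fix x assume "x \<in> {u..v}"
      then have x: "x \<in> {a..b}" "x \<in> {-1<..<1}" using uv ab by auto
      show "(F has_derivative (\<lambda>t. t *\<^sub>R F' x)) (at x within {u..v})"
        using has_vector_derivative_at_within[OF der[OF x(2)]] by (simp add: has_vector_derivative_def)
      show "onorm (\<lambda>t. t *\<^sub>R F' x) \<le> B"
      proof (rule onorm_le)
        fix t :: real
        show "norm (t *\<^sub>R F' x) \<le> B * norm t"
          using mult_left_mono[OF B(2)[OF x(1)], of "\<bar>t\<bar>"] by (simp add: mult.commute)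
      qed
    qed (use uv in auto)
    then show "cmod (F v - F u) \<le> B * (v - u)" using uv by simp
  qed (use B in auto)
qed

subsection \<open>Derivatives almost everywhere\<close>

text \<open>A relation rather than a function such as \<open>vd\<close>: an explicit formula for the
  derivative can be carried through the product and sum rules and altered on null sets, with no
  unspecified values.\<close>

definition has_ae_deriv :: "(real \<Rightarrow> complex) \<Rightarrow> (real \<Rightarrow> complex) \<Rightarrow> bool" where
  "has_ae_deriv F h \<longleftrightarrow> F \<in> AC_loc \<and>
     (\<exists>N. negligible N \<and> (\<forall>x\<in>{-1<..<1} - N. (F has_vector_derivative h x) (at x)))"

lemma has_ae_derivE:
  assumes "has_ae_deriv F h"
  obtains N where "negligible N" "\<And>x. x \<in> {-1<..<1} - N \<Longrightarrow> (F has_vector_derivative h x) (at x)"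
  using assms unfolding has_ae_deriv_def by blast

lemma has_ae_deriv_AC_loc: "has_ae_deriv F h \<Longrightarrow> F \<in> AC_loc"
  by (simp add: has_ae_deriv_def)

text \<open>Differentiability almost everywhere is known on compact intervals; exhausting (-1,1) by
  symmetric ones leaves a countable union of null sets.\<close>

lemma has_ae_deriv_vd:
  assumes F: "F \<in> AC_loc"
  shows "has_ae_deriv F (vd F)"
proof -
  let ?r = "\<lambda>n::nat. 1 - 1 / real (n + 2)"
  define N where "N = (\<Union>n. {x \<in> {- ?r n<..<?r n}. \<not> F differentiable (at x)})"
  have "negligible N"
    unfolding N_def
  proof (rule negligible_countable_Union)
    fix X assume "X \<in> range (\<lambda>n. {x \<in> {- ?r n<..<?r n}. \<not> F differentiable (at x)})"
    then obtain n where X: "X = {x \<in> {- ?r n<..<?r n}. \<not> F differentiable (at x)}" by blast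
    have "AC_on (- ?r n) (?r n) F"
      by (rule AC_locD[OF F]) (auto simp: field_simps)
    then show "negligible X"
      unfolding X by (intro abs_cont_differentiable_ae AC_on_imp_abs_cont)
  qed auto
  moreover have "(F has_vector_derivative vd F x) (at x)" if x: "x \<in> {-1<..<1} - N" for x
  proof -
    have "1 - \<bar>x\<bar> > 0" using x by auto
    then obtain n where n: "inverse (real (Suc n)) < 1 - \<bar>x\<bar>" using reals_Archimedean by blast
    have "1 / real (n + 2) \<le> inverse (real (Suc n))" by (simp add: field_simps)
    then have "x \<in> {- ?r n<..<?r n}" using n by auto
    then have "F differentiable (at x)" using x unfolding N_def by blast
    then show ?thesis unfolding vd_def by (simp add: vector_derivative_works)
  qed
  ultimately show ?thesis
    using F unfolding has_ae_deriv_def by blast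
qed

lemma has_ae_deriv_C1:
  assumes "\<And>x. x \<in> {-1<..<1} \<Longrightarrow> (F has_vector_derivative F' x) (at x)"
    and "continuous_on {-1<..<1} F'"
  shows "has_ae_deriv F F'"
  using assms AC_loc_C1[OF assms] unfolding has_ae_deriv_def by (intro conjI exI[of _ "{}"]) auto

lemma has_vector_derivative_cong_OI:
  assumes "(F has_vector_derivative h) (at x)" "x \<in> {-1<..<1::real}" "\<And>x. x \<in> {-1<..<1} \<Longrightarrow> G x = F x"
  shows "(G has_vector_derivative h) (at x)"
  by (rule has_vector_derivative_transform_within_open[OF assms(1) open_greaterThanLessThan assms(2)])
     (simp add: assms(3))

text \<open>Both functions have the same derivatives at x, if any. Since
  \<open>vector_derivative\<close> is chosen from this set of derivatives, the values agree even
  where there is none.\<close>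

lemma vd_cong:
  assumes "\<And>x. x \<in> {-1<..<1} \<Longrightarrow> G x = F x" "x \<in> {-1<..<1}"
  shows "vd G x = vd F x"
proof -
  have "(G has_vector_derivative h) (at x) \<longleftrightarrow> (F has_vector_derivative h) (at x)" for h
    using has_vector_derivative_cong_OI[of F h x G] has_vector_derivative_cong_OI[of G h x F] assms by auto
  then show ?thesis unfolding vd_def vector_derivative_def by simp
qed

lemma vd_eqI: "(F has_vector_derivative h) (at x) \<Longrightarrow> vd F x = h"
  unfolding vd_def by (rule vector_derivative_at)

lemma has_ae_deriv_cong:
  assumes "has_ae_deriv F h" "\<And>x. x \<in> {-1<..<1} \<Longrightarrow> G x = F x" "negligible {x\<in>{-1<..<1}. k x \<noteq> h x}"
  shows "has_ae_deriv G k"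
proof -
  from assms(1) obtain N where N: "negligible N"
    "\<And>x. x \<in> {-1<..<1} - N \<Longrightarrow> (F has_vector_derivative h x) (at x)"
    by (rule has_ae_derivE) blast
  let ?N = "N \<union> {x\<in>{-1<..<1}. k x \<noteq> h x}"
  have "(G has_vector_derivative k x) (at x)" if x: "x \<in> {-1<..<1} - ?N" for x
  proof -
    have "k x = h x" using x by auto
    then show ?thesis
      using x assms(2) by (auto intro!: has_vector_derivative_cong_OI[OF N(2)])
  qed
  moreover have "negligible ?N" using N(1) assms(3) by (rule negligible_Un)
  ultimately show ?thesis
    using AC_loc_cong[OF has_ae_deriv_AC_loc[OF assms(1)] assms(2)] unfolding has_ae_deriv_def by blast
qed

lemma has_ae_deriv_cong':
  assumes "has_ae_deriv F h" "\<And>x. x \<in> {-1<..<1} \<Longrightarrow> G x = F x" "\<And>x. x \<in> {-1<..<1} \<Longrightarrow> k x = h x"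
  shows "has_ae_deriv G k"
proof (rule has_ae_deriv_cong[OF assms(1,2)])
  have "{x\<in>{-1<..<1}. k x \<noteq> h x} = {}" using assms(3) by blast
  then show "negligible {x\<in>{-1<..<1}. k x \<noteq> h x}" by (simp only: negligible_empty)
qed

lemma has_ae_deriv_unique:
  assumes "has_ae_deriv F h" "has_ae_deriv F k"
  shows "negligible {x\<in>{-1<..<1}. h x \<noteq> k x}"
proof -
  from assms(1) obtain N where N: "negligible N"
    "\<And>x. x \<in> {-1<..<1} - N \<Longrightarrow> (F has_vector_derivative h x) (at x)"
    by (rule has_ae_derivE) blast
  from assms(2) obtain M where M: "negligible M"
    "\<And>x. x \<in> {-1<..<1} - M \<Longrightarrow> (F has_vector_derivative k x) (at x)"
    by (rule has_ae_derivE) blast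
  show ?thesis
    by (rule negligible_subset[OF negligible_Un[OF N(1) M(1)]])
       (use N(2) M(2) vector_derivative_unique_at in blast)
qed

lemma has_ae_deriv_integral:
  assumes "has_ae_deriv F h" "-1 < a" "a \<le> b" "b < 1"
  shows "(h has_integral F b - F a) {a..b}" "h absolutely_integrable_on {a..b}"
proof -
  from assms(1) obtain N where N: "negligible N"
    "\<And>x. x \<in> {-1<..<1} - N \<Longrightarrow> (F has_vector_derivative h x) (at x)"
    by (rule has_ae_derivE) blast
  have ac: "abs_cont a b F"
    by (rule AC_on_imp_abs_cont[OF AC_locD[OF has_ae_deriv_AC_loc[OF assms(1)] assms(2-4)]])
  have d: "(F has_vector_derivative h x) (at x)" if "x \<in> {a<..<b} - N" for x
    using that assms(2,4) by (intro N(2)) auto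
  show "(h has_integral F b - F a) {a..b}" "h absolutely_integrable_on {a..b}"
    by (rule fundamental_theorem_abs_cont[OF ac assms(3) N(1) d]
             fundamental_theorem_abs_cont_absolutely_integrable[OF ac assms(3) N(1) d]; assumption)+
qed

lemma has_ae_deriv_add:
  assumes "has_ae_deriv F h" "has_ae_deriv G k"
  shows "has_ae_deriv (\<lambda>x. F x + G x) (\<lambda>x. h x + k x)"
proof -
  from assms(1) obtain N where N: "negligible N"
    "\<And>x. x \<in> {-1<..<1} - N \<Longrightarrow> (F has_vector_derivative h x) (at x)"
    by (rule has_ae_derivE) blast
  from assms(2) obtain M where M: "negligible M"
    "\<And>x. x \<in> {-1<..<1} - M \<Longrightarrow> (G has_vector_derivative k x) (at x)"
    by (rule has_ae_derivE) blast
  show ?thesis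
    unfolding has_ae_deriv_def
    using assms negligible_Un[OF N(1) M(1)]
    by (auto intro!: AC_loc_add exI[of _ "N \<union> M"] has_vector_derivative_add N M dest: has_ae_deriv_AC_loc)
qed

lemma has_ae_deriv_mult:
  assumes "has_ae_deriv F h" "has_ae_deriv G k"
  shows "has_ae_deriv (\<lambda>x. F x * G x) (\<lambda>x. F x * k x + h x * G x)"
proof -
  from assms(1) obtain N where N: "negligible N"
    "\<And>x. x \<in> {-1<..<1} - N \<Longrightarrow> (F has_vector_derivative h x) (at x)"
    by (rule has_ae_derivE) blast
  from assms(2) obtain M where M: "negligible M"
    "\<And>x. x \<in> {-1<..<1} - M \<Longrightarrow> (G has_vector_derivative k x) (at x)"
    by (rule has_ae_derivE) blast
  show ?thesis
    unfolding has_ae_deriv_def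
    using assms negligible_Un[OF N(1) M(1)]
    by (auto intro!: AC_loc_mult exI[of _ "N \<union> M"] has_vector_derivative_mult N M dest: has_ae_deriv_AC_loc)
qed

lemma has_ae_deriv_cnj:
  assumes "has_ae_deriv F h"
  shows "has_ae_deriv (\<lambda>x. cnj (F x)) (\<lambda>x. cnj (h x))"
proof -
  from assms(1) obtain N where N: "negligible N"
    "\<And>x. x \<in> {-1<..<1} - N \<Longrightarrow> (F has_vector_derivative h x) (at x)"
    by (rule has_ae_derivE) blast
  show ?thesis
    unfolding has_ae_deriv_def
    using assms N(1)
    by (auto intro!: AC_loc_cnj exI[of _ N] has_vector_derivative_cnj N dest: has_ae_deriv_AC_loc)
qed

lemma has_ae_deriv_scaleR:
  assumes "\<And>x. x \<in> {-1<..<1} \<Longrightarrow> (c has_real_derivative c' x) (at x)" "continuous_on {-1<..<1} c'"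
    and "has_ae_deriv F h"
  shows "has_ae_deriv (\<lambda>x. c x *\<^sub>R F x) (\<lambda>x. c x *\<^sub>R h x + c' x *\<^sub>R F x)"
proof -
  have "has_ae_deriv (\<lambda>x. of_real (c x)) (\<lambda>x. of_real (c' x))"
  proof (rule has_ae_deriv_C1)
    show "((\<lambda>x. complex_of_real (c x)) has_vector_derivative complex_of_real (c' x)) (at x)"
      if "x \<in> {-1<..<1}" for x
      using assms(1)[OF that] by (simp add: has_vector_derivative_of_real has_real_derivative_iff_has_vector_derivative)
  qed (intro continuous_intros assms(2))
  from has_ae_deriv_mult[OF this assms(3)] show ?thesis
    by (simp add: scaleR_conv_of_real)
qed

text \<open>\<open>F\<close> is an integral of \<open>h\<close> up to a constant, and integrals of
  continuous functions are differentiable everywhere. This promotes almost everywhere identities to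
  classical ones.\<close>

lemma has_ae_deriv_continuous:
  assumes h: "has_ae_deriv F h" and cont: "continuous_on {-1<..<1} h" and x: "x \<in> {-1<..<1}"
  shows "(F has_vector_derivative h x) (at x)"
proof -
  \<comment> \<open>The midpoints between x and the two ends of (-1,1).\<close>
  let ?a = "(x - 1) / 2" and ?b = "(x + 1) / 2"
  have ab: "-1 < ?a" "?a < x" "x < ?b" "?b < 1" using x by auto
  have "((\<lambda>u. F ?a + integral {?a..u} h) has_vector_derivative h x) (at x within {?a..?b})"
    using ab by (auto intro!: derivative_eq_intros integral_has_vector_derivative continuous_on_subset[OF cont])
  moreover have "F ?a + integral {?a..u} h = F u" if "u \<in> {?a..?b}" for u
  proof -
    have "(h has_integral F u - F ?a) {?a..u}"
      using that ab by (intro has_ae_deriv_integral[OF h]) auto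
    then show ?thesis by (simp add: integral_unique)
  qed
  ultimately have "(F has_vector_derivative h x) (at x within {?a..?b})"
    using ab by (intro has_vector_derivative_transform[of x "{?a..?b}" F]) auto
  then show ?thesis
    using ab by (simp add: at_within_Icc_at)
qed

subsection \<open>Square integrable functions\<close>

text \<open>For nonnegative functions gauge and Lebesgue integrability agree; this allows all
  estimates to be made with \<open>has_integral\<close>.\<close>

lemma L2_iff: "f \<in> L2 \<longleftrightarrow> f \<in> borel_measurable (lebesgue_on {-1<..<1}) \<and>
    (\<lambda>x. (cmod (f x))\<^sup>2) integrable_on {-1<..<1}"
proof -
  have "integrable (lebesgue_on {-1<..<1}) (\<lambda>x. (cmod (f x))\<^sup>2) \<longleftrightarrow> (\<lambda>x. (cmod (f x))\<^sup>2) integrable_on {-1<..<1}"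
  proof
    assume "(\<lambda>x. (cmod (f x))\<^sup>2) integrable_on {-1<..<1}"
    then have "(\<lambda>x. (cmod (f x))\<^sup>2) absolutely_integrable_on {-1<..<1}"
      by (rule nonnegative_absolutely_integrable_1) auto
    then show "integrable (lebesgue_on {-1<..<1}) (\<lambda>x. (cmod (f x))\<^sup>2)"
      by (rule absolutely_integrable_imp_integrable) auto
  qed (auto intro: integrable_on_lebesgue_on)
  then show ?thesis by (simp add: L2_def)
qed

lemma L2_measurable: "f \<in> L2 \<Longrightarrow> f \<in> borel_measurable (lebesgue_on {-1<..<1})"
  and L2_integrable: "f \<in> L2 \<Longrightarrow> (\<lambda>x. (cmod (f x))\<^sup>2) integrable_on {-1<..<1}"
  by (simp_all add: L2_iff)

lemma L2_dominated:
  assumes "f \<in> borel_measurable (lebesgue_on {-1<..<1})" "g integrable_on {-1<..<1}"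
    "\<And>x. x \<in> {-1<..<1} \<Longrightarrow> (cmod (f x))\<^sup>2 \<le> g x"
  shows "f \<in> L2"
  unfolding L2_iff
proof
  have "(\<lambda>x. (cmod (f x))\<^sup>2) \<in> borel_measurable (lebesgue_on {-1<..<1})"
    using assms(1) by measurable
  then show "(\<lambda>x. (cmod (f x))\<^sup>2) integrable_on {-1<..<1}"
    by (rule measurable_bounded_by_integrable_imp_integrable_real[OF _ assms(2)]) (use assms(3) in auto)
qed (rule assms(1))

lemma L2_add:
  assumes "f \<in> L2" "g \<in> L2"
  shows "(\<lambda>x. f x + g x) \<in> L2"
proof (rule L2_dominated)
  show "(\<lambda>x. f x + g x) \<in> borel_measurable (lebesgue_on {-1<..<1})"
    using assms[THEN L2_measurable] by measurable
  show "(\<lambda>x. 2 * (cmod (f x))\<^sup>2 + 2 * (cmod (g x))\<^sup>2) integrable_on {-1<..<1}"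
    using assms[THEN L2_integrable] by (intro integrable_add integrable_on_mult_right)
  show "(cmod (f x + g x))\<^sup>2 \<le> 2 * (cmod (f x))\<^sup>2 + 2 * (cmod (g x))\<^sup>2" for x
  proof -
    have "(cmod (f x + g x))\<^sup>2 \<le> (cmod (f x) + cmod (g x))\<^sup>2"
      by (intro power_mono norm_triangle_ineq) auto
    moreover have "0 \<le> (cmod (f x) - cmod (g x))\<^sup>2" by simp
    ultimately show ?thesis by (simp add: power2_sum power2_diff)
  qed
qed

lemma L2_scaleR:
  assumes "f \<in> L2" "continuous_on {-1<..<1} c" "\<And>x. x \<in> {-1<..<1} \<Longrightarrow> \<bar>c x\<bar> \<le> C"
  shows "(\<lambda>x. c x *\<^sub>R f x) \<in> L2"
proof (rule L2_dominated)
  have "c \<in> borel_measurable (lebesgue_on {-1<..<1})"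
    using assms(2) by (rule continuous_imp_measurable_on_sets_lebesgue) auto
  then show "(\<lambda>x. c x *\<^sub>R f x) \<in> borel_measurable (lebesgue_on {-1<..<1})"
    using L2_measurable[OF assms(1)] by measurable
  show "(\<lambda>x. C\<^sup>2 * (cmod (f x))\<^sup>2) integrable_on {-1<..<1}"
    using L2_integrable[OF assms(1)] by (intro integrable_on_mult_right)
  show "(cmod (c x *\<^sub>R f x))\<^sup>2 \<le> C\<^sup>2 * (cmod (f x))\<^sup>2" if "x \<in> {-1<..<1}" for x
  proof -
    have "\<bar>c x\<bar>\<^sup>2 \<le> C\<^sup>2" using assms(3)[OF that] by (intro power_mono) auto
    then show ?thesis by (simp add: power_mult_distrib mult_right_mono)
  qed
qed

text \<open>Measurability survives a change on a null set because Lebesgue measure is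
  complete.\<close>

lemma L2_cong_ae:
  assumes "f \<in> L2" and neg: "negligible {x\<in>{-1<..<1}. g x \<noteq> f x}"
  shows "g \<in> L2"
  unfolding L2_iff
proof
  let ?N = "{x\<in>{-1<..<1}. g x \<noteq> f x}"
  show "(\<lambda>x. (cmod (g x))\<^sup>2) integrable_on {-1<..<1}"
    by (rule integrable_spike[OF L2_integrable[OF assms(1)] neg]) auto
  have "(\<lambda>x. if x \<in> {-1<..<1} then f x else 0) \<in> borel_measurable lebesgue"
    using L2_measurable[OF assms(1)] by (subst borel_measurable_if) auto
  moreover have "AE x in lebesgue. (if x \<in> {-1<..<1} then f x else 0) = (if x \<in> {-1<..<1} then g x else 0)"
    using neg by (intro AE_I'[of ?N]) (auto simp: negligible_iff_null_sets)
  ultimately have "(\<lambda>x. if x \<in> {-1<..<1} then g x else 0) \<in> borel_measurable lebesgue"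
    by (rule borel_measurable_AE)
  then show "g \<in> borel_measurable (lebesgue_on {-1<..<1})"
    by (subst (asm) borel_measurable_if) auto
qed

lemma L2_cong:
  assumes "f \<in> L2" "\<And>x. x \<in> {-1<..<1} \<Longrightarrow> g x = f x"
  shows "g \<in> L2"
proof (rule L2_cong_ae[OF assms(1)])
  have "{x\<in>{-1<..<1}. g x \<noteq> f x} = {}" using assms(2) by blast
  then show "negligible {x\<in>{-1<..<1}. g x \<noteq> f x}" by (simp only: negligible_empty)
qed

lemma integrable_const_OI: "(\<lambda>x. c::real) integrable_on {-1<..<1::real}"
  using integrable_on_open_interval[of "\<lambda>x. c" "-1" "1::real"] by auto

lemma L2_bounded:
  assumes "continuous_on {-1<..<1} f" "\<And>x. x \<in> {-1<..<1} \<Longrightarrow> cmod (f x) \<le> C"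
  shows "f \<in> L2"
proof (rule L2_dominated)
  show "f \<in> borel_measurable (lebesgue_on {-1<..<1})"
    using assms(1) by (rule continuous_imp_measurable_on_sets_lebesgue) auto
  show "(cmod (f x))\<^sup>2 \<le> C\<^sup>2" if "x \<in> {-1<..<1}" for x
    using assms(2)[OF that] by (intro power_mono) auto
qed (rule integrable_const_OI)

lemma integral_cmod_square_nonneg: "0 \<le> integral S (\<lambda>x. (cmod (f x))\<^sup>2)"
  by (cases "(\<lambda>x. (cmod (f x))\<^sup>2) integrable_on S")
     (auto intro: Henstock_Kurzweil_Integration.integral_nonneg simp: not_integrable_integral)

section \<open>Exhaustion by compact subintervals, and increments of functions with
  \<open>L2\<close> derivative\<close>

lemma L2_subinterval:
  assumes "k \<in> L2" "-1 \<le> a" "b \<le> 1"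
  shows "(\<lambda>x. (cmod (k x))\<^sup>2) integrable_on {a..b}"
    "integral {a..b} (\<lambda>x. (cmod (k x))\<^sup>2) \<le> integral {-1<..<1} (\<lambda>x. (cmod (k x))\<^sup>2)"
proof -
  have "(\<lambda>x. (cmod (k x))\<^sup>2) integrable_on {-1..1}"
    using L2_integrable[OF assms(1)] integrable_on_open_interval_real by blast
  then show i: "(\<lambda>x. (cmod (k x))\<^sup>2) integrable_on {a..b}"
    by (rule integrable_on_subinterval) (use assms in auto)
  have "integral {a..b} (\<lambda>x. (cmod (k x))\<^sup>2) \<le> integral {-1..1} (\<lambda>x. (cmod (k x))\<^sup>2)"
    by (rule integral_subset_le) (use assms i \<open>_ integrable_on {-1..1}\<close> in auto)
  also have "\<dots> = integral {-1<..<1} (\<lambda>x. (cmod (k x))\<^sup>2)"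
    by (rule integral_open_interval_real)
  finally show "integral {a..b} (\<lambda>x. (cmod (k x))\<^sup>2) \<le> integral {-1<..<1} (\<lambda>x. (cmod (k x))\<^sup>2)" .
qed

text \<open>Monotone convergence along the radii 1 - 1 / (n + 2), all at least 1/2. The energy
  estimates below live on such compact intervals, with bounds independent of the radius.\<close>

lemma L2I_exhaustion:
  assumes cont: "continuous_on {-1<..<1} z"
    and bd: "\<And>r. 1/2 \<le> r \<Longrightarrow> r < 1 \<Longrightarrow> integral {-r..r} (\<lambda>x. (cmod (z x))\<^sup>2) \<le> C"
  shows "z \<in> L2"
  unfolding L2_iff
proof
  show "z \<in> borel_measurable (lebesgue_on {-1<..<1})"
    using cont by (rule continuous_imp_measurable_on_sets_lebesgue) auto
  define r where "r = (\<lambda>n::nat. 1 - 1 / real (n + 2))"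
  have r: "1/2 \<le> r n" "r n < 1" "r n \<le> r (Suc n)" for n
    by (auto simp: r_def field_simps)
  let ?f = "\<lambda>n x. if x \<in> {- r n..r n} then (cmod (z x))\<^sup>2 else 0"
  have hi: "(?f n has_integral integral {- r n..r n} (\<lambda>x. (cmod (z x))\<^sup>2)) {-1<..<1}" for n
  proof -
    have "(\<lambda>x. (cmod (z x))\<^sup>2) integrable_on {- r n..r n}"
      using r[of n] by (intro integrable_continuous_interval continuous_intros continuous_on_subset[OF cont]) auto
    then have "((\<lambda>x. (cmod (z x))\<^sup>2) has_integral integral {- r n..r n} (\<lambda>x. (cmod (z x))\<^sup>2)) {- r n..r n}"
      by (rule integrable_integral)
    then show ?thesis
      using r[of n] by (subst has_integral_restrict) auto
  qed
  have "(\<lambda>x. (cmod (z x))\<^sup>2) integrable_on {-1<..<1} \<and>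
      (\<lambda>n. integral {-1<..<1} (?f n)) \<longlonglongrightarrow> integral {-1<..<1} (\<lambda>x. (cmod (z x))\<^sup>2)"
  proof (rule monotone_convergence_increasing)
    show "?f n integrable_on {-1<..<1}" for n using hi[of n] by blast
    show "?f n x \<le> ?f (Suc n) x" for n x using r(3)[of n] by auto
    show "(\<lambda>n. ?f n x) \<longlonglongrightarrow> (cmod (z x))\<^sup>2" if "x \<in> {-1<..<1}" for x
    proof (rule tendsto_eventually)
      have "1 - \<bar>x\<bar> > 0" using that by auto
      then obtain N where N: "inverse (real (Suc N)) < 1 - \<bar>x\<bar>" using reals_Archimedean by blast
      show "\<forall>\<^sub>F n in sequentially. ?f n x = (cmod (z x))\<^sup>2"
        using eventually_ge_at_top[of N]
      proof eventually_elim
        case (elim n)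
        have "1 / real (n + 2) \<le> inverse (real (Suc N))" using elim by (simp add: field_simps)
        then have "x \<in> {- r n..r n}" using N by (auto simp: r_def)
        then show ?case by simp
      qed
    qed
    show "bounded (range (\<lambda>n. integral {-1<..<1} (?f n)))"
    proof (rule boundedI)
      fix y assume "y \<in> range (\<lambda>n. integral {-1<..<1} (?f n))"
      then obtain n where y: "y = integral {- r n..r n} (\<lambda>x. (cmod (z x))\<^sup>2)"
        using integral_unique[OF hi] by auto
      moreover have "0 \<le> integral {- r n..r n} (\<lambda>x. (cmod (z x))\<^sup>2)"
        by (rule integral_cmod_square_nonneg)
      ultimately show "norm y \<le> C" using bd[of "r n"] r[of n] by simp
    qed
  qed
  then show "(\<lambda>x. (cmod (z x))\<^sup>2) integrable_on {-1<..<1}" ..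
qed

text \<open>Young's inequality replaces Cauchy--Schwarz; the parameter \<open>t\<close> is chosen to suit the application.\<close>

lemma increment_bound:
  assumes F: "has_ae_deriv F h" and k: "k \<in> L2" and t: "t > 0" and ab: "-1 < a" "a \<le> b" "b < 1" and "M \<ge> 0"
    and hk: "\<And>x. a \<le> x \<Longrightarrow> x \<le> b \<Longrightarrow> cmod (h x) \<le> M * cmod (k x)"
  shows "cmod (F b - F a) \<le> M * (t / 2 * (b - a) + integral {a..b} (\<lambda>x. (cmod (k x))\<^sup>2) / (2 * t))"
proof -
  let ?J = "integral {a..b} (\<lambda>x. (cmod (k x))\<^sup>2)"
  have i: "((\<lambda>x. (cmod (k x))\<^sup>2) has_integral ?J) {a..b}"
    using ab by (intro integrable_integral L2_subinterval[OF k]) auto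
  have "((\<lambda>x. M * (t / 2 + (cmod (k x))\<^sup>2 / (2 * t))) has_integral M * (t / 2 * (b - a) + ?J / (2 * t))) {a..b}"
    using has_integral_const_real[of "t / 2" a b] ab
    by (intro has_integral_mult_right has_integral_add has_integral_divide i) (simp add: mult.commute)
  moreover have "cmod (h x) \<le> M * (t / 2 + (cmod (k x))\<^sup>2 / (2 * t))" if "x \<in> {a..b}" for x
  proof -
    have "0 \<le> (t - cmod (k x))\<^sup>2 / (2 * t)" using t by simp
    also have "\<dots> = t / 2 + (cmod (k x))\<^sup>2 / (2 * t) - cmod (k x)"
      using t by (simp add: power2_diff field_simps power2_eq_square)
    finally have "cmod (k x) \<le> t / 2 + (cmod (k x))\<^sup>2 / (2 * t)" by simp
    then have "M * cmod (k x) \<le> M * (t / 2 + (cmod (k x))\<^sup>2 / (2 * t))"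
      using \<open>M \<ge> 0\<close> by (rule mult_left_mono)
    then show ?thesis using hk[of x] that by simp
  qed
  ultimately show ?thesis
    using integral_norm_bound_integral[of h "{a..b}" "\<lambda>x. M * (t / 2 + (cmod (k x))\<^sup>2 / (2 * t))"]
      has_ae_deriv_integral(1)[OF F ab] by (metis has_integral_iff)
qed

text \<open>The choice t = 1 / sqrt d in \<open>increment_bound\<close> makes both terms multiples
  of sqrt d. The length enters only through the upper bound d, which later is
  \<open>1 - x\<^sup>2\<close> in place of the distance from x to an end point.\<close>

lemma holder_bound:
  assumes F: "has_ae_deriv F h" and k: "k \<in> L2" and ab: "-1 < a" "a \<le> b" "b < 1" and "M \<ge> 0" and d: "b - a \<le> d" "d > 0"
    and hk: "\<And>x. a \<le> x \<Longrightarrow> x \<le> b \<Longrightarrow> cmod (h x) \<le> M * cmod (k x)"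
  shows "cmod (F b - F a) \<le> M * sqrt d * (1 + integral {-1<..<1} (\<lambda>x. (cmod (k x))\<^sup>2))"
proof -
  let ?N = "integral {-1<..<1} (\<lambda>x. (cmod (k x))\<^sup>2)"
  let ?J = "integral {a..b} (\<lambda>x. (cmod (k x))\<^sup>2)"
  have J: "?J \<le> ?N" using L2_subinterval(2)[OF k, of a b] ab by simp
  have J0: "0 \<le> ?J" by (rule integral_cmod_square_nonneg)
  have sd: "sqrt d > 0" "sqrt d * sqrt d = d" using d by simp_all
  have "cmod (F b - F a) \<le> M * (1 / sqrt d / 2 * (b - a) + ?J / (2 * (1 / sqrt d)))"
    using sd by (intro increment_bound[OF F k _ ab \<open>M \<ge> 0\<close> hk]) auto
  also have "\<dots> \<le> M * (1 / sqrt d / 2 * d + ?N * sqrt d)"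
  proof -
    have "?J / (2 * (1 / sqrt d)) = ?J * sqrt d / 2" by simp
    also have "\<dots> \<le> ?J * sqrt d" using J0 sd by simp
    also have "\<dots> \<le> ?N * sqrt d" using J sd by (intro mult_right_mono) auto
    finally show ?thesis
      using d sd \<open>M \<ge> 0\<close> by (intro mult_left_mono add_mono) auto
  qed
  also have "1 / sqrt d / 2 * d = sqrt d / 2"
    using sd by (simp add: field_simps)
  also have "M * (sqrt d / 2 + ?N * sqrt d) \<le> M * (sqrt d + ?N * sqrt d)"
    using sd \<open>M \<ge> 0\<close> by (intro mult_left_mono add_right_mono) auto
  finally show ?thesis by (simp add: algebra_simps)
qed

text \<open>The bound of order sqrt d gives uniform continuity, hence a continuous extension to
  [-1,1]. The increment estimate passes to the extension by continuity, and summing it over disjoint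
  intervals yields absolute continuity.\<close>

lemma L2_deriv_imp_AC_closed:
  assumes F: "has_ae_deriv F h" and h: "h \<in> L2"
  shows "F \<in> AC_closed"
proof -
  let ?q = "\<lambda>x. (cmod (h x))\<^sup>2"
  let ?N = "integral {-1<..<1} ?q"
  have N0: "?N \<ge> 0" by (rule integral_cmod_square_nonneg)
  have "uniformly_continuous_on {-1<..<1} F"
    unfolding uniformly_continuous_on_def
  proof (intro allI impI)
    fix e :: real assume e: "e > 0"
    define c where "c = e / (2 * (1 + ?N))"
    define d where "d = c\<^sup>2"
    have "e / (2 * (1 + n)) * (1 + n) = e / 2" if "n \<ge> 0" for n :: real
      using that by (simp add: divide_simps)
    from this[OF N0] have "c * (1 + ?N) = e / 2" by (simp only: c_def)
    moreover have "c > 0" using e N0 by (simp add: c_def add_pos_nonneg)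
    ultimately have d: "d > 0" "sqrt d * (1 + ?N) < e"
      using e by (simp_all add: d_def)
    have *: "cmod (F y - F x) < e" if "-1 < x" "x \<le> y" "y < 1" "y - x \<le> d" for x y
      using holder_bound[OF F h that(1-3) zero_le_one that(4) d(1)] d(2) by simp
    show "\<exists>d>0. \<forall>x\<in>{-1<..<1}. \<forall>x'\<in>{-1<..<1}. dist x' x < d \<longrightarrow> dist (F x') (F x) < e"
    proof (intro exI[of _ d] conjI ballI impI d(1))
      fix x x' :: real assume "x \<in> {-1<..<1}" "x' \<in> {-1<..<1}" "dist x' x < d"
      then show "dist (F x') (F x) < e"
        using *[of x x'] *[of x' x] by (cases "x \<le> x'") (auto simp: dist_norm norm_minus_commute)
    qed
  qed
  then obtain g where g: "uniformly_continuous_on (closure {-1<..<1}) g" "\<And>x. x \<in> {-1<..<1} \<Longrightarrow> F x = g x"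
    by (rule uniformly_continuous_on_extension_on_closure) blast
  have gc: "continuous_on {-1..1} g"
    using uniformly_continuous_imp_continuous[OF g(1)] by simp
  have inc: "cmod (g v - g u) \<le> t / 2 * (v - u) + integral {u..v} ?q / (2 * t)"
    if uv: "-1 \<le> u" "u \<le> v" "v \<le> 1" and t: "t > 0" for u v t
  proof (cases "u = v")
    case True
    then show ?thesis by simp
  next
    case False
    \<comment> \<open>[u,v] is shrunk by s n at both ends to stay inside (-1,1); the denominator n +
      3 keeps s n at most a third of the length, so the shrunken interval is not reversed.\<close>
    define s where "s = (\<lambda>n::nat. (v - u) / real (n + 3))"
    have s: "0 < s n" "s n \<le> (v - u) / 3" for n
      using False uv unfolding s_def by (simp, intro divide_left_mono) auto
    have s0: "s \<longlonglongrightarrow> 0"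
      unfolding s_def by (rule LIMSEQ_ignore_initial_segment[OF lim_const_over_n])
    show ?thesis
    proof (rule tendsto_upperbound)
      have "(\<lambda>n. v - s n) \<longlonglongrightarrow> v - 0" "(\<lambda>n. u + s n) \<longlonglongrightarrow> u + 0"
        by (intro tendsto_intros s0)+
      moreover have "v - s n \<in> {-1..1}" "u + s n \<in> {-1..1}" for n
        using s[of n] uv by (auto simp: field_simps)
      ultimately have "(\<lambda>n. g (v - s n)) \<longlonglongrightarrow> g v" "(\<lambda>n. g (u + s n)) \<longlonglongrightarrow> g u"
        using uv by (auto intro!: continuous_on_tendsto_compose[OF gc])
      then show "(\<lambda>n. cmod (g (v - s n) - g (u + s n))) \<longlonglongrightarrow> cmod (g v - g u)"
        by (intro tendsto_intros)
      show "\<forall>\<^sub>F n in sequentially. cmod (g (v - s n) - g (u + s n)) \<le> t / 2 * (v - u) + integral {u..v} ?q / (2 * t)"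
      proof (intro always_eventually allI)
        fix n
        let ?a = "u + s n" and ?b = "v - s n"
        have ab: "-1 < ?a" "?a \<le> ?b" "?b < 1" "u \<le> ?a" "?b \<le> v"
          using s[of n] uv by auto
        have "cmod (F ?b - F ?a) \<le> 1 * (t / 2 * (?b - ?a) + integral {?a..?b} ?q / (2 * t))"
          by (rule increment_bound[OF F h t ab(1-3)]) auto
        also have "\<dots> \<le> t / 2 * (v - u) + integral {u..v} ?q / (2 * t)"
        proof -
          have "integral {?a..?b} ?q \<le> integral {u..v} ?q"
            using ab uv by (intro integral_subset_le L2_subinterval[OF h]) auto
          moreover have "t / 2 * (?b - ?a) \<le> t / 2 * (v - u)"
            using t ab by (intro mult_left_mono) auto
          ultimately show ?thesis using t by (simp add: divide_right_mono add_mono)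
        qed
        finally show "cmod (g ?b - g ?a) \<le> t / 2 * (v - u) + integral {u..v} ?q / (2 * t)"
          using ab g(2)[of ?a] g(2)[of ?b] by simp
      qed
    qed simp
  qed
  have "AC_on (-1) 1 g"
    unfolding AC_on_def
  proof (intro allI impI)
    fix \<epsilon> :: real assume e: "\<epsilon> > 0"
    \<comment> \<open>t is fixed first, so that the integral part stays below \<epsilon> / 2 for
      every disjoint family; the length bound \<epsilon> / t then makes the other part at most
      \<epsilon> / 2.\<close>
    define t where "t = (1 + ?N) / \<epsilon>"
    have t: "t > 0" using e N0 by (simp add: t_def add_pos_nonneg)
    have tN: "?N / (2 * t) < \<epsilon> / 2"
      using e N0 by (simp add: t_def field_simps)
    show "\<exists>\<delta>>0. \<forall>(n::nat) (u::nat \<Rightarrow> real) (v::nat \<Rightarrow> real).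
        (\<forall>i<n. -1 \<le> u i \<and> u i \<le> v i \<and> v i \<le> 1) \<and>
        (\<forall>i<n. \<forall>j<n. i \<noteq> j \<longrightarrow> {u i<..<v i} \<inter> {u j<..<v j} = {}) \<and>
        (\<Sum>i<n. v i - u i) < \<delta>
        \<longrightarrow> (\<Sum>i<n. cmod (g (v i) - g (u i))) < \<epsilon>"
    proof (intro exI[of _ "\<epsilon> / t"] conjI allI impI)
      fix n :: nat and u v :: "nat \<Rightarrow> real"
      assume *: "(\<forall>i<n. -1 \<le> u i \<and> u i \<le> v i \<and> v i \<le> 1) \<and>
        (\<forall>i<n. \<forall>j<n. i \<noteq> j \<longrightarrow> {u i<..<v i} \<inter> {u j<..<v j} = {}) \<and>
        (\<Sum>i<n. v i - u i) < \<epsilon> / t"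
      let ?f = "\<lambda>i x. if x \<in> {u i<..<v i} then ?q x else 0"
      have fi: "(?f i has_integral integral {u i..v i} ?q) {-1<..<1}" if "i < n" for i
      proof -
        have "?q integrable_on {u i..v i}"
          using * that by (intro L2_subinterval[OF h]) auto
        then have "(?q has_integral integral {u i..v i} ?q) {u i<..<v i}"
          using integrable_integral has_integral_open_interval[of ?q _ "u i" "v i"] by simp
        then show ?thesis
          using * that by (subst has_integral_restrict) auto
      qed
      have sf: "((\<lambda>x. \<Sum>i<n. ?f i x) has_integral (\<Sum>i<n. integral {u i..v i} ?q)) {-1<..<1}"
        using fi by (intro has_integral_sum) auto
      \<comment> \<open>The open intervals are disjoint, so at most one summand is nonzero at each
        point. This bounds the sum of the local integrals by the integral over (-1,1).\<close>
      have sum_le: "(\<Sum>i<n. ?f i x) \<le> ?q x" for x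
      proof (cases "\<exists>i<n. x \<in> {u i<..<v i}")
        case True
        then obtain i where i: "i < n" "x \<in> {u i<..<v i}" by blast
        have "?f j x = 0" if "j \<in> {..<n} - {i}" for j
          using * i that by (metis (no_types, lifting) DiffE IntI empty_iff insert_iff lessThan_iff)
        then have "(\<Sum>j<n. ?f j x) = ?f i x"
          using i by (subst sum.remove[of _ i]) (auto intro!: sum.neutral)
        then show ?thesis by simp
      next
        case False
        then have "(\<Sum>j<n. ?f j x) = 0" by (intro sum.neutral) auto
        then show ?thesis by simp
      qed
      have "(\<Sum>i<n. integral {u i..v i} ?q) \<le> ?N"
        by (rule has_integral_le[OF sf integrable_integral[OF L2_integrable[OF h]]]) (rule sum_le)
      then have "(\<Sum>i<n. integral {u i..v i} ?q) / (2 * t) < \<epsilon> / 2"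
        using tN t by (intro le_less_trans[OF divide_right_mono tN]) auto
      moreover have "t / 2 * (\<Sum>i<n. v i - u i) \<le> \<epsilon> / 2"
        using * t by (simp add: field_simps)
      moreover have "(\<Sum>i<n. cmod (g (v i) - g (u i))) \<le> (\<Sum>i<n. t / 2 * (v i - u i) + integral {u i..v i} ?q / (2 * t))"
        using * t by (intro sum_mono inc) auto
      moreover have "\<dots> = t / 2 * (\<Sum>i<n. v i - u i) + (\<Sum>i<n. integral {u i..v i} ?q) / (2 * t)"
        by (simp add: sum.distrib sum_distrib_left sum_divide_distrib)
      ultimately show "(\<Sum>i<n. cmod (g (v i) - g (u i))) < \<epsilon>" by linarith
    qed (use e t in auto)
  qed
  then show ?thesis
    unfolding AC_closed_def using g(2) by force
qed

lemma AC_closed_bounded: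
  assumes "F \<in> AC_closed"
  obtains C where "C > 0" "\<And>x. x \<in> {-1<..<1} \<Longrightarrow> cmod (F x) \<le> C"
proof -
  obtain g where g: "AC_on (-1) 1 g" "\<forall>x\<in>{-1<..<1}. g x = F x"
    using assms by (auto simp: AC_closed_def)
  have "bounded (g ` {-1..1})"
    by (intro compact_imp_bounded compact_continuous_image abs_cont_imp_continuous_on AC_on_imp_abs_cont g) auto
  then obtain C where C: "C > 0" "\<And>x. x \<in> {-1..1} \<Longrightarrow> cmod (g x) \<le> C" unfolding bounded_pos by auto
  have "cmod (F x) \<le> C" if "x \<in> {-1<..<1}" for x
    using C(2)[of x] g(2) that by force
  with C(1) show thesis by (rule that)
qed

subsection \<open>Limits at the end points\<close>

lemma lim_pm1_sandwich:
  assumes bd: "\<And>x. x \<in> {-1<..<1} \<Longrightarrow> 1/2 \<le> \<bar>x\<bar> \<Longrightarrow> cmod (F x) \<le> \<phi> x"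
    and \<phi>: "isCont \<phi> 1" "\<phi> 1 = 0" "isCont \<phi> (-1)" "\<phi> (-1) = 0"
  shows "lim_pm1 F 0"
  unfolding lim_pm1_def
proof
  show "(F \<longlongrightarrow> 0) (at_left 1)"
  proof (rule Lim_null_comparison)
    have "\<forall>\<^sub>F x in at_left 1. x \<in> {1/2<..<1::real}"
      by (rule eventually_at_left_real) simp
    then show "\<forall>\<^sub>F x in at_left 1. norm (F x) \<le> \<phi> x"
      by eventually_elim (use bd in auto)
    show "(\<phi> \<longlongrightarrow> 0) (at_left 1)"
      using \<phi>(1,2) by (simp add: isCont_def filterlim_at_split)
  qed
  show "(F \<longlongrightarrow> 0) (at_right (-1))"
  proof (rule Lim_null_comparison)
    have "\<forall>\<^sub>F x in at_right (-1). x \<in> {-1<..<-1/2::real}"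
      by (rule eventually_at_right_real) simp
    then show "\<forall>\<^sub>F x in at_right (-1). norm (F x) \<le> \<phi> x"
      by eventually_elim (use bd in auto)
    show "(\<phi> \<longlongrightarrow> 0) (at_right (-1))"
      using \<phi>(3,4) by (simp add: isCont_def filterlim_at_split)
  qed
qed

lemma lim_pm1_add: "lim_pm1 F 0 \<Longrightarrow> lim_pm1 G 0 \<Longrightarrow> lim_pm1 (\<lambda>x. F x + G x) 0"
  unfolding lim_pm1_def by (auto intro: tendsto_add_zero)

lemma lim_pm1_scaleR:
  assumes "isCont c 1" "isCont c (-1)" "lim_pm1 F 0"
  shows "lim_pm1 (\<lambda>x. c x *\<^sub>R F x) 0"
proof -
  have "(c \<longlongrightarrow> c 1) (at_left 1)" "(c \<longlongrightarrow> c (-1)) (at_right (-1))"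
    using assms(1,2) by (simp_all add: isCont_def filterlim_at_split)
  then show ?thesis
    using assms(3) tendsto_scaleR[of c "c 1" "at_left 1" F 0] tendsto_scaleR[of c "c (-1)" "at_right (-1)" F 0]
    unfolding lim_pm1_def by simp
qed

lemma lim_pm1_cong:
  assumes "lim_pm1 F c" "\<And>x. x \<in> {-1<..<1} \<Longrightarrow> G x = F x"
  shows "lim_pm1 G c"
proof -
  have "\<forall>\<^sub>F x in at_left 1. x \<in> {-1<..<1::real}" "\<forall>\<^sub>F x in at_right (-1). x \<in> {-1<..<1::real}"
    by (rule eventually_at_left_real eventually_at_right_real; simp)+
  then have "\<forall>\<^sub>F x in at_left 1. F x = G x" "\<forall>\<^sub>F x in at_right (-1). F x = G x"
    by (auto elim!: eventually_mono simp: assms(2))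
  then show ?thesis
    using assms(1) unfolding lim_pm1_def by (auto elim: Lim_transform_eventually)
qed

lemma one_minus_square_pos: "x \<in> {-1<..<1::real} \<Longrightarrow> 0 < 1 - x\<^sup>2"
  by (simp add: abs_square_less_1 abs_less_iff)

subsection \<open>Weighted estimates\<close>

text \<open>Integrating \<open>(x (1 - x\<^sup>2) \<bar>z\<bar>\<^sup>2)'\<close> for a solution of \<open>(1 - x\<^sup>2) z' = - 2 c x z + k\<close>.  The sign of the
  coefficient \<open>1 - (3 + 4 c) x\<^sup>2\<close> near the end points decides whether the boundary term is
  controlled by the integral (\<open>c \<ge> 0\<close>) or has to be controlled beforehand (\<open>c \<le> -1\<close>).\<close>

lemma energy_identity:
  assumes z: "has_ae_deriv z z'" and r: "0 < r" "r < 1"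
    and k: "\<And>x. x \<in> {-1<..<1} \<Longrightarrow> k x = (1 - x\<^sup>2) *\<^sub>R z' x + (2 * c * x) *\<^sub>R z x"
  shows "((\<lambda>x. (1 - (3 + 4 * c) * x\<^sup>2) * (cmod (z x))\<^sup>2 + 2 * x * Re (cnj (z x) * k x)) has_integral
      r * (1 - r\<^sup>2) * ((cmod (z r))\<^sup>2 + (cmod (z (-r)))\<^sup>2)) {-r..r}"
proof -
  \<comment> \<open>The factor x makes the weight odd, so the contributions of r and -r add up
    instead of being subtracted.\<close>
  let ?w = "\<lambda>x::real. x * (1 - x\<^sup>2)"
  let ?\<phi> = "\<lambda>x. ?w x *\<^sub>R (z x * cnj (z' x) + z' x * cnj (z x)) + (1 - 3 * x\<^sup>2) *\<^sub>R (z x * cnj (z x))"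
  have "has_ae_deriv (\<lambda>x. ?w x *\<^sub>R (z x * cnj (z x))) ?\<phi>"
  proof (rule has_ae_deriv_scaleR)
    show "((\<lambda>x. x * (1 - x\<^sup>2)) has_real_derivative 1 - 3 * x\<^sup>2) (at x)" for x :: real
      by (auto intro!: derivative_eq_intros simp: power2_eq_square)
  qed (intro continuous_intros has_ae_deriv_mult has_ae_deriv_cnj z)+
  from has_ae_deriv_integral(1)[OF this, of "-r" r]
  have "(?\<phi> has_integral ?w r *\<^sub>R (z r * cnj (z r)) - ?w (-r) *\<^sub>R (z (-r) * cnj (z (-r)))) {-r..r}"
    using r by simp
  from has_integral_Re[OF this]
  have "((\<lambda>x. Re (?\<phi> x)) has_integral r * (1 - r\<^sup>2) * ((cmod (z r))\<^sup>2 + (cmod (z (-r)))\<^sup>2)) {-r..r}"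
    by (simp add: complex_mult_cnj cmod_power2 algebra_simps)
  moreover have "Re (?\<phi> x) = (1 - (3 + 4 * c) * x\<^sup>2) * (cmod (z x))\<^sup>2 + 2 * x * Re (cnj (z x) * k x)"
    if "x \<in> {-r..r}" for x
  proof -
    have kx: "k x = (1 - x\<^sup>2) *\<^sub>R z' x + (2 * c * x) *\<^sub>R z x" using that r by (intro k) auto
    have "Re (?\<phi> x) = x * (2 * (1 - x\<^sup>2) * (Re (z x) * Re (z' x) + Im (z x) * Im (z' x)))
        + (1 - 3 * x\<^sup>2) * ((Re (z x))\<^sup>2 + (Im (z x))\<^sup>2)"
      by (simp add: algebra_simps power2_eq_square)
    also have "\<dots> = (1 - (3 + 4 * c) * x\<^sup>2) * (cmod (z x))\<^sup>2 + 2 * x * Re (cnj (z x) * k x)"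
      unfolding kx cmod_power2 by (simp add: algebra_simps power2_eq_square)
    finally show ?thesis .
  qed
  ultimately show ?thesis by (rule has_integral_eq[rotated]) simp
qed

text \<open>Young's inequality with the factor 1/2 on |z|^2, small enough to be absorbed by the main
  term of \<open>energy_identity\<close>.\<close>

lemma cross_term_bound:
  fixes x :: real
  assumes "\<bar>x\<bar> \<le> 1"
  shows "\<bar>2 * x * Re (cnj z * k)\<bar> \<le> (cmod z)\<^sup>2 / 2 + 2 * (cmod k)\<^sup>2"
proof -
  have "\<bar>2 * x * Re (cnj z * k)\<bar> = 2 * (\<bar>x\<bar> * \<bar>Re (cnj z * k)\<bar>)"
    by (simp add: abs_mult)
  also have "\<bar>x\<bar> * \<bar>Re (cnj z * k)\<bar> \<le> 1 * (cmod z * cmod k)"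
    using abs_Re_le_cmod[of "cnj z * k"] assms by (intro mult_mono) (auto simp: norm_mult)
  also have "2 * (1 * (cmod z * cmod k)) \<le> (cmod z)\<^sup>2 / 2 + 2 * (cmod k)\<^sup>2"
    using zero_le_power2[of "cmod z - 2 * cmod k"] by (simp add: power2_eq_square algebra_simps)
  finally show ?thesis by simp
qed

lemma integrable_cmod_square_continuous:
  fixes z :: "real \<Rightarrow> complex"
  assumes "continuous_on {-1<..<1} z" "0 < r" "r < 1"
  shows "(\<lambda>x. (cmod (z x))\<^sup>2) integrable_on {-r..r}"
  by (intro integrable_continuous_interval continuous_intros continuous_on_subset[OF assms(1)]) (use assms in auto)

text \<open>Since 3 + 4 c <= -1, the coefficient of |z|^2 is at least 1. Half of |z|^2 absorbs the
  cross term and the boundary term is at most 2 B, which bounds the integrals of |z|^2 independently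
  of r.\<close>

lemma weighted_L2_boundary_controlled:
  assumes z: "has_ae_deriv z z'" and c: "c \<le> -1"
    and kL2: "(\<lambda>x. (1 - x\<^sup>2) *\<^sub>R z' x + (2 * c * x) *\<^sub>R z x) \<in> L2"
    and bdry: "\<And>x. x \<in> {-1<..<1} \<Longrightarrow> (1 - x\<^sup>2) * (cmod (z x))\<^sup>2 \<le> B"
  shows "z \<in> L2"
proof -
  define k where "k = (\<lambda>x. (1 - x\<^sup>2) *\<^sub>R z' x + (2 * c * x) *\<^sub>R z x)"
  have kL2: "k \<in> L2" using kL2 by (simp add: k_def)
  let ?N = "integral {-1<..<1} (\<lambda>x. (cmod (k x))\<^sup>2)"
  have cont: "continuous_on {-1<..<1} z"
    by (rule continuous_on_AC_loc[OF has_ae_deriv_AC_loc[OF z]])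
  show ?thesis
  proof (rule L2I_exhaustion[OF cont])
    fix r :: real assume r: "1/2 \<le> r" "r < 1"
    let ?Z = "integral {-r..r} (\<lambda>x. (cmod (z x))\<^sup>2)" and ?K = "integral {-r..r} (\<lambda>x. (cmod (k x))\<^sup>2)"
    have Z: "((\<lambda>x. (cmod (z x))\<^sup>2) has_integral ?Z) {-r..r}"
      using r by (intro integrable_integral integrable_cmod_square_continuous cont) auto
    have K: "((\<lambda>x. (cmod (k x))\<^sup>2) has_integral ?K) {-r..r}" "?K \<le> ?N"
      using r L2_subinterval[OF kL2, of "-r" r] by (auto intro: integrable_integral)
    have id: "((\<lambda>x. (1 - (3 + 4 * c) * x\<^sup>2) * (cmod (z x))\<^sup>2 + 2 * x * Re (cnj (z x) * k x)) has_integral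
      r * (1 - r\<^sup>2) * ((cmod (z r))\<^sup>2 + (cmod (z (-r)))\<^sup>2)) {-r..r}"
      by (rule energy_identity[OF z]) (use r in \<open>auto simp: k_def\<close>)
    have "((\<lambda>x. (cmod (z x))\<^sup>2 / 2 - 2 * (cmod (k x))\<^sup>2) has_integral (?Z / 2 - 2 * ?K)) {-r..r}"
      by (intro has_integral_diff has_integral_divide has_integral_mult_right Z K)
    then have "?Z / 2 - 2 * ?K \<le> r * (1 - r\<^sup>2) * ((cmod (z r))\<^sup>2 + (cmod (z (-r)))\<^sup>2)"
    proof (rule has_integral_le[OF _ id])
      fix x assume "x \<in> {-r..r}"
      then have x: "\<bar>x\<bar> \<le> 1" using r by auto
      have "(3 + 4 * c) * x\<^sup>2 \<le> 0" using c by (intro mult_nonpos_nonneg) auto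
      then have "1 * (cmod (z x))\<^sup>2 \<le> (1 - (3 + 4 * c) * x\<^sup>2) * (cmod (z x))\<^sup>2"
        by (intro mult_right_mono) auto
      then show "(cmod (z x))\<^sup>2 / 2 - 2 * (cmod (k x))\<^sup>2
          \<le> (1 - (3 + 4 * c) * x\<^sup>2) * (cmod (z x))\<^sup>2 + 2 * x * Re (cnj (z x) * k x)"
        using cross_term_bound[OF x, of "z x" "k x"] by linarith
    qed
    also have "\<dots> = r * ((1 - r\<^sup>2) * (cmod (z r))\<^sup>2 + (1 - (-r)\<^sup>2) * (cmod (z (-r)))\<^sup>2)"
      by (simp add: algebra_simps)
    also have "\<dots> \<le> 1 * (B + B)"
      using r by (intro mult_mono add_mono bdry) (auto intro!: add_nonneg_nonneg mult_nonneg_nonneg simp: abs_square_le_1)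
    finally show "?Z \<le> 4 * B + 4 * ?N" using K(2) by simp
  qed
qed

lemma weighted_L2:
  assumes z: "has_ae_deriv z z'" and c: "c \<ge> 0"
    and kL2: "(\<lambda>x. (1 - x\<^sup>2) *\<^sub>R z' x + (2 * c * x) *\<^sub>R z x) \<in> L2"
  shows "z \<in> L2" "lim_pm1 (\<lambda>x. (1 - x\<^sup>2) *\<^sub>R z x) 0"
proof -
  define k where "k = (\<lambda>x. (1 - x\<^sup>2) *\<^sub>R z' x + (2 * c * x) *\<^sub>R z x)"
  have kL2: "k \<in> L2" using kL2 by (simp add: k_def)
  let ?N = "integral {-1<..<1} (\<lambda>x. (cmod (k x))\<^sup>2)"
  have cont: "continuous_on {-1<..<1} z"
    by (rule continuous_on_AC_loc[OF has_ae_deriv_AC_loc[OF z]])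
  \<comment> \<open>After the cross term the remaining coefficient is 3 x^2 - 3/2, which exceeds 3/4
    as soon as |x| >= 7/8. On the compact middle part the deficit (9/4 - 3 x^2) |z|^2 is at most 9/4
    M^2.\<close>
  have "bounded (z ` {-7/8..7/8})"
    by (intro compact_imp_bounded compact_continuous_image continuous_on_subset[OF cont]) auto
  then obtain M where "M > 0" and M': "\<forall>x\<in>{-7/8..7/8}. cmod (z x) \<le> M"
    unfolding bounded_pos by auto
  have M: "cmod (z x) \<le> M" if "\<bar>x\<bar> \<le> 7/8" for x
    using that by (intro M'[rule_format]) (auto simp: abs_le_iff)
  have id: "((\<lambda>x. (1 - (3 + 4 * c) * x\<^sup>2) * (cmod (z x))\<^sup>2 + 2 * x * Re (cnj (z x) * k x)) has_integral
      r * (1 - r\<^sup>2) * ((cmod (z r))\<^sup>2 + (cmod (z (-r)))\<^sup>2)) {-r..r}" if "1/2 \<le> r" "r < 1" for r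
    by (rule energy_identity[OF z]) (use that in \<open>auto simp: k_def\<close>)
  have K: "((\<lambda>x. (cmod (k x))\<^sup>2) has_integral integral {-r..r} (\<lambda>x. (cmod (k x))\<^sup>2)) {-r..r}"
    "integral {-r..r} (\<lambda>x. (cmod (k x))\<^sup>2) \<le> ?N" if "1/2 \<le> r" "r < 1" for r
    using that L2_subinterval[OF kL2, of "-r" r] by (auto intro: integrable_integral)
  have Z: "((\<lambda>x. (cmod (z x))\<^sup>2) has_integral integral {-r..r} (\<lambda>x. (cmod (z x))\<^sup>2)) {-r..r}"
    if "1/2 \<le> r" "r < 1" for r
    using that by (intro integrable_integral integrable_cmod_square_continuous cont) auto
  show zL2: "z \<in> L2"
  proof (rule L2I_exhaustion[OF cont])
    fix r :: real assume r: "1/2 \<le> r" "r < 1"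
    let ?Z = "integral {-r..r} (\<lambda>x. (cmod (z x))\<^sup>2)" and ?K = "integral {-r..r} (\<lambda>x. (cmod (k x))\<^sup>2)"
    have "((\<lambda>x. 3 / 4 * (cmod (z x))\<^sup>2 - 2 * (cmod (k x))\<^sup>2 - 9 / 4 * M\<^sup>2) has_integral
        3 / 4 * ?Z - 2 * ?K - 2 * r * (9 / 4 * M\<^sup>2)) {-r..r}"
      using has_integral_const_real[of "9 / 4 * M\<^sup>2" "-r" r] r
      by (intro has_integral_diff has_integral_mult_right Z K) auto
    moreover have "((\<lambda>x. - ((1 - (3 + 4 * c) * x\<^sup>2) * (cmod (z x))\<^sup>2 + 2 * x * Re (cnj (z x) * k x))) has_integral
      - (r * (1 - r\<^sup>2) * ((cmod (z r))\<^sup>2 + (cmod (z (-r)))\<^sup>2))) {-r..r}"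
      by (rule has_integral_neg[OF id[OF r]])
    ultimately have "3 / 4 * ?Z - 2 * ?K - 2 * r * (9 / 4 * M\<^sup>2)
        \<le> - (r * (1 - r\<^sup>2) * ((cmod (z r))\<^sup>2 + (cmod (z (-r)))\<^sup>2))"
    proof (rule has_integral_le)
      fix x assume "x \<in> {-r..r}"
      then have x: "\<bar>x\<bar> \<le> 1" using r by auto
      have "3 / 4 * (cmod (z x))\<^sup>2 - 9 / 4 * M\<^sup>2 \<le> (3 * x\<^sup>2 - 3 / 2) * (cmod (z x))\<^sup>2"
      proof (cases "\<bar>x\<bar> \<le> 7 / 8")
        case True
        have "(9 / 4 - 3 * x\<^sup>2) * (cmod (z x))\<^sup>2 \<le> 9 / 4 * M\<^sup>2"
          using M[OF True] by (intro mult_mono power_mono) auto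
        then show ?thesis by (simp add: algebra_simps)
      next
        case False
        then have "(7/8)\<^sup>2 \<le> \<bar>x\<bar>\<^sup>2" by (intro power_mono) auto
        then have "3 / 4 * (cmod (z x))\<^sup>2 \<le> (3 * x\<^sup>2 - 3 / 2) * (cmod (z x))\<^sup>2"
          by (intro mult_right_mono) (auto simp: power2_eq_square)
        moreover have "0 \<le> 9 / 4 * M\<^sup>2" by simp
        ultimately show ?thesis by linarith
      qed
      moreover have "(3 * x\<^sup>2 - 1) * (cmod (z x))\<^sup>2 \<le> ((3 + 4 * c) * x\<^sup>2 - 1) * (cmod (z x))\<^sup>2"
        using c by (intro mult_right_mono) (auto simp: algebra_simps)
      ultimately show "3 / 4 * (cmod (z x))\<^sup>2 - 2 * (cmod (k x))\<^sup>2 - 9 / 4 * M\<^sup>2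
          \<le> - ((1 - (3 + 4 * c) * x\<^sup>2) * (cmod (z x))\<^sup>2 + 2 * x * Re (cnj (z x) * k x))"
        using cross_term_bound[OF x, of "z x" "k x"] by (simp add: algebra_simps)
    qed
    also have "\<dots> \<le> 0" using r by (simp add: abs_square_le_1)
    finally have "3 / 4 * ?Z \<le> 2 * ?N + 2 * r * (9 / 4 * M\<^sup>2)" using K(2)[OF r] by simp
    also have "\<dots> \<le> 2 * ?N + 2 * 1 * (9 / 4 * M\<^sup>2)" using r by (intro add_left_mono mult_right_mono) auto
    finally show "?Z \<le> 4 / 3 * (2 * ?N + 2 * 1 * (9 / 4 * M\<^sup>2))" by simp
  qed
  let ?NZ = "integral {-1<..<1} (\<lambda>x. (cmod (z x))\<^sup>2)"
  \<comment> \<open>The coefficient of |z|^2 is at most 4 c + 4, the cross term adds 1/2, and the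
    factor 2 removes the r >= 1/2 in front of the boundary term.\<close>
  define C where "C = 2 * ((4 * c + 9 / 2) * ?NZ + 2 * ?N)"
  have bdry: "(1 - r\<^sup>2) * ((cmod (z r))\<^sup>2 + (cmod (z (-r)))\<^sup>2) \<le> C" if r: "1/2 \<le> r" "r < 1" for r
  proof -
    let ?Z = "integral {-r..r} (\<lambda>x. (cmod (z x))\<^sup>2)" and ?K = "integral {-r..r} (\<lambda>x. (cmod (k x))\<^sup>2)"
    have "((\<lambda>x. (4 * c + 9 / 2) * (cmod (z x))\<^sup>2 + 2 * (cmod (k x))\<^sup>2) has_integral (4 * c + 9 / 2) * ?Z + 2 * ?K) {-r..r}"
      using r by (intro has_integral_add has_integral_mult_right Z K) auto
    then have "r * (1 - r\<^sup>2) * ((cmod (z r))\<^sup>2 + (cmod (z (-r)))\<^sup>2) \<le> (4 * c + 9 / 2) * ?Z + 2 * ?K"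
    proof (rule has_integral_le[OF id[OF r]])
      fix x assume "x \<in> {-r..r}"
      then have x: "\<bar>x\<bar> \<le> 1" using r by auto
      have "(1 - (3 + 4 * c) * x\<^sup>2) * (cmod (z x))\<^sup>2 \<le> (4 * c + 4) * (cmod (z x))\<^sup>2"
      proof (rule mult_right_mono)
        have "0 \<le> (3 + 4 * c) * x\<^sup>2" using c by simp
        then show "1 - (3 + 4 * c) * x\<^sup>2 \<le> 4 * c + 4" using c by linarith
      qed simp
      then show "(1 - (3 + 4 * c) * x\<^sup>2) * (cmod (z x))\<^sup>2 + 2 * x * Re (cnj (z x) * k x)
          \<le> (4 * c + 9 / 2) * (cmod (z x))\<^sup>2 + 2 * (cmod (k x))\<^sup>2"
        using cross_term_bound[OF x, of "z x" "k x"] by (simp add: algebra_simps)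
    qed
    also have "\<dots> \<le> C / 2"
      unfolding C_def nonzero_mult_div_cancel_left[OF zero_neq_numeral[symmetric]]
      using K(2)[OF r] L2_subinterval(2)[OF zL2, of "-r" r] r c
      by (intro add_mono mult_left_mono) auto
    finally have "r * ((1 - r\<^sup>2) * ((cmod (z r))\<^sup>2 + (cmod (z (-r)))\<^sup>2)) \<le> C / 2"
      by (simp only: mult.assoc)
    moreover have "1 / 2 * ((1 - r\<^sup>2) * ((cmod (z r))\<^sup>2 + (cmod (z (-r)))\<^sup>2))
        \<le> r * ((1 - r\<^sup>2) * ((cmod (z r))\<^sup>2 + (cmod (z (-r)))\<^sup>2))"
      using r by (intro mult_right_mono mult_nonneg_nonneg) (auto simp: abs_square_le_1)
    ultimately show ?thesis by simp
  qed
  show "lim_pm1 (\<lambda>x. (1 - x\<^sup>2) *\<^sub>R z x) 0"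
  proof (rule lim_pm1_sandwich[where \<phi> = "\<lambda>x. sqrt ((1 - x\<^sup>2) * C)"])
    fix x :: real assume x: "x \<in> {-1<..<1}" "1/2 \<le> \<bar>x\<bar>"
    have p: "1 - x\<^sup>2 > 0" by (rule one_minus_square_pos[OF x(1)])
    have "(1 - x\<^sup>2) * (cmod (z x))\<^sup>2 \<le> (1 - \<bar>x\<bar>\<^sup>2) * ((cmod (z \<bar>x\<bar>))\<^sup>2 + (cmod (z (-\<bar>x\<bar>)))\<^sup>2)"
      using p by (cases "x \<ge> 0") (auto intro!: mult_left_mono)
    also have "\<dots> \<le> C" using x by (intro bdry) auto
    finally have "(1 - x\<^sup>2) * ((1 - x\<^sup>2) * (cmod (z x))\<^sup>2) \<le> (1 - x\<^sup>2) * C"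
      using p by (intro mult_left_mono) auto
    then have "(cmod ((1 - x\<^sup>2) *\<^sub>R z x))\<^sup>2 \<le> (1 - x\<^sup>2) * C"
      by (simp add: power_mult_distrib power2_eq_square mult_ac)
    then show "cmod ((1 - x\<^sup>2) *\<^sub>R z x) \<le> sqrt ((1 - x\<^sup>2) * C)"
      by (rule real_le_rsqrt)
  qed (auto intro!: continuous_intros)
qed

text \<open>q is integrated from x to the nearer end, where it vanishes. On the way the weight p^j
  is at most its value at x, and the distance is at most p, since 1 - |x| <= (1 - |x|) (1 + |x|).
  \<open>holder_bound\<close> then gives |q| <= N p^(j + 1/2) for a constant N.\<close>

lemma vanishing_at_ends_bound:
  fixes j :: nat
  assumes q: "has_ae_deriv q (\<lambda>x. (1 - x\<^sup>2) ^ j *\<^sub>R k x)" and k: "k \<in> L2" and q0: "lim_pm1 q 0"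
  obtains C where "\<And>x. x \<in> {-1<..<1} \<Longrightarrow> (cmod (q x))\<^sup>2 \<le> C * (1 - x\<^sup>2) ^ (2 * j + 1)"
proof -
  let ?N = "1 + integral {-1<..<1} (\<lambda>x. (cmod (k x))\<^sup>2)"
  have N0: "?N \<ge> 0" using integral_cmod_square_nonneg[of "{-1<..<1}" k] by simp
  have main: "cmod (q x) \<le> (1 - x\<^sup>2) ^ j * sqrt (1 - x\<^sup>2) * ?N" if x: "x \<in> {-1<..<1}" for x
  proof -
    let ?m = "(1 - x\<^sup>2) ^ j"
    have p: "1 - x\<^sup>2 > 0" by (rule one_minus_square_pos[OF x])
    have hk: "cmod ((1 - s\<^sup>2) ^ j *\<^sub>R k s) \<le> ?m * cmod (k s)" if s: "\<bar>s\<bar> < 1" "\<bar>x\<bar> \<le> \<bar>s\<bar>" for s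
    proof -
      have "x\<^sup>2 \<le> s\<^sup>2" using s by (simp add: abs_le_square_iff)
      moreover have "s\<^sup>2 \<le> 1" using s by (simp add: abs_square_le_1)
      ultimately have "(1 - s\<^sup>2) ^ j \<le> ?m" "(1 - s\<^sup>2) ^ j \<ge> 0" by (auto intro!: power_mono)
      then show ?thesis by (simp add: mult_right_mono)
    qed
    show ?thesis
    proof (cases "x \<ge> 0")
      case True
      have d: "1 - x \<le> 1 - x\<^sup>2" using True x by (simp add: power2_eq_square mult_left_le)
      have lim: "((\<lambda>t. cmod (q t - q x)) \<longlongrightarrow> cmod (0 - q x)) (at_left 1)"
        using q0 unfolding lim_pm1_def by (intro tendsto_intros) auto
      have "\<forall>\<^sub>F t in at_left 1. t \<in> {x<..<1}"
        using x by (intro eventually_at_left_real) auto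
      then have "\<forall>\<^sub>F t in at_left 1. cmod (q t - q x) \<le> ?m * sqrt (1 - x\<^sup>2) * ?N"
      proof eventually_elim
        case (elim t)
        show ?case
          using elim True x p d by (intro holder_bound[OF q k] hk) auto
      qed
      from tendsto_upperbound[OF lim this] show ?thesis by simp
    next
      case False
      have d: "1 + x \<le> 1 - x\<^sup>2"
      proof -
        have "(1 + x) * 1 \<le> (1 + x) * (1 - x)" using False x by (intro mult_left_mono) auto
        then show ?thesis by (simp add: power2_eq_square algebra_simps)
      qed
      have lim: "((\<lambda>t. cmod (q x - q t)) \<longlongrightarrow> cmod (q x - 0)) (at_right (-1))"
        using q0 unfolding lim_pm1_def by (intro tendsto_intros) auto
      have "\<forall>\<^sub>F t in at_right (-1). t \<in> {-1<..<x}"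
        using x by (intro eventually_at_right_real) auto
      then have "\<forall>\<^sub>F t in at_right (-1). cmod (q x - q t) \<le> ?m * sqrt (1 - x\<^sup>2) * ?N"
      proof eventually_elim
        case (elim t)
        show ?case
          using elim False x p d by (intro holder_bound[OF q k] hk) auto
      qed
      from tendsto_upperbound[OF lim this] show ?thesis by simp
    qed
  qed
  show thesis
  proof (rule that[of "?N\<^sup>2"])
    fix x :: real assume x: "x \<in> {-1<..<1}"
    have p: "1 - x\<^sup>2 > 0" by (rule one_minus_square_pos[OF x])
    have "(cmod (q x))\<^sup>2 \<le> ((1 - x\<^sup>2) ^ j * sqrt (1 - x\<^sup>2) * ?N)\<^sup>2"
      using main[OF x] by (intro power_mono) auto
    also have "\<dots> = ?N\<^sup>2 * (1 - x\<^sup>2) ^ (2 * j + 1)"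
      using p by (simp add: power_mult_distrib power_mult[symmetric] mult.commute)
    finally show "(cmod (q x))\<^sup>2 \<le> ?N\<^sup>2 * (1 - x\<^sup>2) ^ (2 * j + 1)" .
  qed
qed

text \<open>The product rule turns (p z)' = k into p z' = 2 x z + k, the case c = -1, and
  \<open>vanishing_at_ends_bound\<close> with j = 0 supplies the bound on p |z|^2.\<close>

lemma Hardy_L2:
  assumes q: "has_ae_deriv (\<lambda>x. (1 - x\<^sup>2) *\<^sub>R z x) k" and k: "k \<in> L2" and z: "has_ae_deriv z z'"
    and q0: "lim_pm1 (\<lambda>x. (1 - x\<^sup>2) *\<^sub>R z x) 0"
  shows "z \<in> L2"
proof -
  obtain C where C: "\<And>x. x \<in> {-1<..<1} \<Longrightarrow> (cmod ((1 - x\<^sup>2) *\<^sub>R z x))\<^sup>2 \<le> C * (1 - x\<^sup>2) ^ (2 * 0 + 1)"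
    using vanishing_at_ends_bound[of _ 0 k, OF _ k q0] q by auto
  show ?thesis
  proof (rule weighted_L2_boundary_controlled[OF z, of "-1" C])
    have "has_ae_deriv (\<lambda>x. (1 - x\<^sup>2) *\<^sub>R z x) (\<lambda>x. (1 - x\<^sup>2) *\<^sub>R z' x + (- 2 * x) *\<^sub>R z x)"
      by (rule has_ae_deriv_scaleR[OF _ _ z]) (auto intro!: derivative_eq_intros continuous_intros)
    from has_ae_deriv_unique[OF this q] L2_cong_ae[OF k]
    show "(\<lambda>x. (1 - x\<^sup>2) *\<^sub>R z' x + (2 * - 1 * x) *\<^sub>R z x) \<in> L2"
      by simp
    fix x :: real assume x: "x \<in> {-1<..<1}"
    have p: "1 - x\<^sup>2 > 0" by (rule one_minus_square_pos[OF x])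
    have "(1 - x\<^sup>2) * ((1 - x\<^sup>2) * (cmod (z x))\<^sup>2) \<le> (1 - x\<^sup>2) * C"
      using C[OF x] by (simp add: power_mult_distrib power2_eq_square mult_ac)
    then show "(1 - x\<^sup>2) * (cmod (z x))\<^sup>2 \<le> C" using p by simp
  qed simp
qed

subsection \<open>Functions with three derivatives\<close>

lemma AC_loc_scaleR:
  assumes "\<And>x. x \<in> {-1<..<1} \<Longrightarrow> (c has_real_derivative c' x) (at x)" "continuous_on {-1<..<1} c'"
    and "F \<in> AC_loc"
  shows "(\<lambda>x. c x *\<^sub>R F x) \<in> AC_loc"
  by (rule has_ae_deriv_AC_loc[OF has_ae_deriv_scaleR[OF assms(1,2) has_ae_deriv_vd[OF assms(3)]]])

lemma AC_closed_L2:
  assumes "F \<in> AC_loc" "F \<in> AC_closed"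
  shows "F \<in> L2"
proof -
  obtain C where "\<And>x. x \<in> {-1<..<1} \<Longrightarrow> cmod (F x) \<le> C"
    using AC_closed_bounded[OF assms(2)] by blast
  then show ?thesis by (rule L2_bounded[OF continuous_on_AC_loc[OF assms(1)]])
qed

lemma AC_closed_lim_pm1:
  assumes "F \<in> AC_closed"
  shows "lim_pm1 (\<lambda>x. (1 - x\<^sup>2) *\<^sub>R F x) 0"
proof -
  obtain C where C: "C > 0" "\<And>x. x \<in> {-1<..<1} \<Longrightarrow> cmod (F x) \<le> C"
    using AC_closed_bounded[OF assms] by blast
  show ?thesis
  proof (rule lim_pm1_sandwich[where \<phi> = "\<lambda>x. (1 - x\<^sup>2) * C"])
    fix x :: real assume x: "x \<in> {-1<..<1}"
    show "cmod ((1 - x\<^sup>2) *\<^sub>R F x) \<le> (1 - x\<^sup>2) * C"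
      using one_minus_square_pos[OF x] C(2)[OF x] by (simp add: mult_left_mono)
  qed (auto intro!: continuous_intros)
qed

text \<open>The derivatives are parameters instead of iterates of \<open>vd\<close>: for
  \<open>dom_A_sq\<close> they are first constructed by formulas and identified with the iterates
  afterwards. The fourth is known almost everywhere only.\<close>

locale legendre_jet =
  fixes f f1 f2 f3 f4 :: "real \<Rightarrow> complex"
  assumes d0: "x \<in> {-1<..<1} \<Longrightarrow> (f has_vector_derivative f1 x) (at x)"
    and d1: "x \<in> {-1<..<1} \<Longrightarrow> (f1 has_vector_derivative f2 x) (at x)"
    and d2: "x \<in> {-1<..<1} \<Longrightarrow> (f2 has_vector_derivative f3 x) (at x)"
    and d3: "has_ae_deriv f3 f4"
begin

text \<open>\<open>U = (1 - x\<^sup>2) f'\<close>, \<open>u = U' = - \<ell>[f]\<close>, \<open>v = u'\<close>, \<open>w = (1 - x\<^sup>2) v = [f,1]\<^sub>2\<close> and \<open>g = w' = \<ell>\<^sup>2[f]\<close>.\<close>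

definition U where "U x = (1 - x\<^sup>2) *\<^sub>R f1 x"
definition u where "u x = (1 - x\<^sup>2) *\<^sub>R f2 x - (2 * x) *\<^sub>R f1 x"
definition v where "v x = (1 - x\<^sup>2) *\<^sub>R f3 x - (4 * x) *\<^sub>R f2 x - 2 *\<^sub>R f1 x"
definition w where "w x = (1 - x\<^sup>2) *\<^sub>R v x"
definition g where "g x = (1 - x\<^sup>2)\<^sup>2 *\<^sub>R f4 x - (8 * x * (1 - x\<^sup>2)) *\<^sub>R f3 x
    + (14 * x\<^sup>2 - 6) *\<^sub>R f2 x + (4 * x) *\<^sub>R f1 x"

lemma cont: "continuous_on {-1<..<1} f" "continuous_on {-1<..<1} f1" "continuous_on {-1<..<1} f2"
    "continuous_on {-1<..<1} f3"
  using has_vector_derivative_continuous[OF d0] has_vector_derivative_continuous[OF d1]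
    has_vector_derivative_continuous[OF d2] continuous_on_AC_loc[OF has_ae_deriv_AC_loc[OF d3]]
  by (simp_all add: continuous_at_imp_continuous_on)

lemma ae: "has_ae_deriv f f1" "has_ae_deriv f1 f2" "has_ae_deriv f2 f3"
  by (rule has_ae_deriv_C1; fact d0 d1 d2 cont)+

lemma AC: "f \<in> AC_loc" "f1 \<in> AC_loc" "f2 \<in> AC_loc" "f3 \<in> AC_loc"
  using ae d3 by (auto dest: has_ae_deriv_AC_loc)

lemma dU: "x \<in> {-1<..<1} \<Longrightarrow> (U has_vector_derivative u x) (at x)"
  unfolding U_def[abs_def] u_def
  by (auto intro!: derivative_eq_intros d1 simp: algebra_simps)

lemma du: "x \<in> {-1<..<1} \<Longrightarrow> (u has_vector_derivative v x) (at x)"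
  unfolding u_def[abs_def] v_def
  by (auto intro!: derivative_eq_intros d1 d2 simp: complex_eq_iff algebra_simps)

lemma cont_uv: "continuous_on {-1<..<1} u" "continuous_on {-1<..<1} v"
  unfolding u_def[abs_def] v_def[abs_def] by (intro continuous_intros cont)+

lemma ae_Uu: "has_ae_deriv U u" "has_ae_deriv u v"
  by (rule has_ae_deriv_C1; fact dU du cont_uv)+

lemma poly_deriv:
  "((\<lambda>x. 1 - x\<^sup>2) has_real_derivative - 2 * x) (at x)"
  "((\<lambda>x. (1 - x\<^sup>2)\<^sup>2) has_real_derivative - 4 * x * (1 - x\<^sup>2)) (at x)"
  by (auto intro!: derivative_eq_intros)

lemma ae_v: "has_ae_deriv v (\<lambda>x. (1 - x\<^sup>2) *\<^sub>R f4 x - (6 * x) *\<^sub>R f3 x - 6 *\<^sub>R f2 x)"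
proof -
  have 1: "has_ae_deriv (\<lambda>x. (1 - x\<^sup>2) *\<^sub>R f3 x) (\<lambda>x. (1 - x\<^sup>2) *\<^sub>R f4 x + (- 2 * x) *\<^sub>R f3 x)"
    by (rule has_ae_deriv_scaleR[OF poly_deriv(1) _ d3]) (intro continuous_intros)
  have 2: "has_ae_deriv (\<lambda>x. (- 4 * x) *\<^sub>R f2 x) (\<lambda>x. (- 4 * x) *\<^sub>R f3 x + (- 4) *\<^sub>R f2 x)"
    by (rule has_ae_deriv_scaleR[OF _ _ ae(3)]) (auto intro!: derivative_eq_intros)
  have 3: "has_ae_deriv (\<lambda>x. (- 2) *\<^sub>R f1 x) (\<lambda>x. (- 2) *\<^sub>R f2 x + 0 *\<^sub>R f1 x)"
    by (rule has_ae_deriv_scaleR[OF _ _ ae(2)]) (auto intro!: derivative_eq_intros)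
  show ?thesis
    by (rule has_ae_deriv_cong'[OF has_ae_deriv_add[OF has_ae_deriv_add[OF 1 2] 3]])
       (simp_all add: v_def algebra_simps flip: scaleR_add_left)
qed

lemma ae_w: "has_ae_deriv w g"
proof -
  have "has_ae_deriv (\<lambda>x. (1 - x\<^sup>2) *\<^sub>R v x) (\<lambda>x. (1 - x\<^sup>2) *\<^sub>R ((1 - x\<^sup>2) *\<^sub>R f4 x - (6 * x) *\<^sub>R f3 x - 6 *\<^sub>R f2 x) + (- 2 * x) *\<^sub>R v x)"
    by (rule has_ae_deriv_scaleR[OF poly_deriv(1) _ ae_v]) (intro continuous_intros)
  then show ?thesis
    by (rule has_ae_deriv_cong')
       (simp_all add: w_def g_def v_def complex_eq_iff algebra_simps power2_eq_square)
qed

text \<open>The exponent 1 is written out to match \<open>vanishing_at_ends_bound\<close> with j =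
  1, which is how decay of p^2 f'' is obtained.\<close>

lemma ae_q: "has_ae_deriv (\<lambda>x. (1 - x\<^sup>2)\<^sup>2 *\<^sub>R f2 x) (\<lambda>x. (1 - x\<^sup>2) ^ 1 *\<^sub>R (v x + 2 *\<^sub>R f1 x))"
proof -
  have "has_ae_deriv (\<lambda>x. (1 - x\<^sup>2)\<^sup>2 *\<^sub>R f2 x) (\<lambda>x. (1 - x\<^sup>2)\<^sup>2 *\<^sub>R f3 x + (- 4 * x * (1 - x\<^sup>2)) *\<^sub>R f2 x)"
    by (rule has_ae_deriv_scaleR[OF poly_deriv(2) _ ae(3)]) (intro continuous_intros)
  then show ?thesis
    by (rule has_ae_deriv_cong')
       (simp_all add: v_def complex_eq_iff algebra_simps power2_eq_square)
qed

lemma dq: "x \<in> {-1<..<1} \<Longrightarrow> ((\<lambda>x. (1 - x\<^sup>2)\<^sup>2 *\<^sub>R f2 x) has_vector_derivative w x + 2 *\<^sub>R U x) (at x)"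
proof -
  have "continuous_on {-1<..<1} (\<lambda>x. (1 - x\<^sup>2) ^ 1 *\<^sub>R (v x + 2 *\<^sub>R f1 x))"
    by (intro continuous_intros cont cont_uv)
  moreover assume "x \<in> {-1<..<1}"
  ultimately have "((\<lambda>x. (1 - x\<^sup>2)\<^sup>2 *\<^sub>R f2 x) has_vector_derivative (1 - x\<^sup>2) ^ 1 *\<^sub>R (v x + 2 *\<^sub>R f1 x)) (at x)"
    by (rule has_ae_deriv_continuous[OF ae_q])
  then show ?thesis by (simp add: w_def U_def algebra_simps)
qed

lemma poly_bound: "x \<in> {-1<..<1} \<Longrightarrow> \<bar>c * x\<bar> \<le> \<bar>c\<bar>" for c x :: real
  by (auto simp: abs_mult intro!: mult_left_le)

section \<open>Consequences of square integrability of \<open>v\<close> and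
  \<open>f2\<close>\<close>

lemma vL2_imp:
  assumes "v \<in> L2"
  shows "u \<in> AC_closed" "u \<in> L2" "U \<in> AC_closed"
proof -
  show u: "u \<in> AC_closed" by (rule L2_deriv_imp_AC_closed[OF ae_Uu(2) assms])
  show "u \<in> L2" by (rule AC_closed_L2[OF has_ae_deriv_AC_loc[OF ae_Uu(2)] u])
  then show "U \<in> AC_closed" by (rule L2_deriv_imp_AC_closed[OF ae_Uu(1)])
qed

lemma f2L2_imp:
  assumes "f2 \<in> L2"
  shows "f1 \<in> AC_closed" "f1 \<in> L2" "f \<in> AC_closed" "f \<in> L2"
proof -
  show f1: "f1 \<in> AC_closed" by (rule L2_deriv_imp_AC_closed[OF ae(2) assms])
  show "f1 \<in> L2" by (rule AC_closed_L2[OF AC(2) f1])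
  then show f: "f \<in> AC_closed" by (rule L2_deriv_imp_AC_closed[OF ae(1)])
  show "f \<in> L2" by (rule AC_closed_L2[OF AC(1) f])
qed

lemma L2_linear_comb:
  assumes "f1 \<in> L2" "f2 \<in> L2" "h \<in> L2"
    and "\<And>x. k x = h x + (a * x) *\<^sub>R f2 x + b *\<^sub>R f1 x"
  shows "k \<in> L2"
proof (rule L2_cong)
  show "(\<lambda>x. h x + (a * x) *\<^sub>R f2 x + b *\<^sub>R f1 x) \<in> L2"
    by (intro L2_add L2_scaleR[where C = "\<bar>a\<bar>"] L2_scaleR[where C = "\<bar>b\<bar>"] assms continuous_intros poly_bound order_refl)
qed (simp add: assms(4))

text \<open>The function is p^2 f'''' - g. It is used with both signs, to pass from g to p^2 f''''
  and back.\<close>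

lemma L2_g_terms:
  assumes "f1 \<in> L2" "f2 \<in> L2" "(\<lambda>x. (1 - x\<^sup>2) *\<^sub>R f3 x) \<in> L2"
  shows "(\<lambda>x. (8 * x) *\<^sub>R ((1 - x\<^sup>2) *\<^sub>R f3 x) + (- (14 * x\<^sup>2 - 6)) *\<^sub>R f2 x + (- 4 * x) *\<^sub>R f1 x) \<in> L2"
    (is "?t \<in> L2")
proof -
  have "\<bar>- (14 * x\<^sup>2 - 6)\<bar> \<le> 20" if "x \<in> {-1<..<1}" for x :: real
    using one_minus_square_pos[OF that] zero_le_power2[of x] by (intro abs_leI) linarith+
  moreover have "\<bar>- 4 * x\<bar> \<le> 4" "\<bar>8 * x\<bar> \<le> 8" if "x \<in> {-1<..<1}" for x :: real
    using that by (auto simp: abs_le_iff)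
  ultimately show ?thesis
    by (intro L2_add L2_scaleR[where C = 8] L2_scaleR[where C = 20] L2_scaleR[where C = 4] assms continuous_intros) auto
qed

text \<open>The equation to which the weighted estimate for \<open>f''\<close> applies is
  \<open>(1 - x\<^sup>2) f''' = 4 x f'' + (v + 2 f')\<close>.\<close>

lemma regularity_from_limits:
  assumes U0: "lim_pm1 U 0" and w0: "lim_pm1 w 0" and g: "g \<in> L2"
  shows "v \<in> L2" "f2 \<in> L2" "(\<lambda>x. (1 - x\<^sup>2)\<^sup>2 *\<^sub>R f4 x) \<in> L2"
proof -
  show v: "v \<in> L2"
    by (rule Hardy_L2[OF _ g ae_v]) (use ae_w w0 in \<open>simp_all add: w_def[abs_def]\<close>)
  note uU = vL2_imp[OF v]
  have f1: "f1 \<in> L2"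
    by (rule Hardy_L2[OF _ uU(2) ae(2)]) (use ae_Uu(1) U0 in \<open>simp_all add: U_def[abs_def]\<close>)
  have k: "(\<lambda>x. v x + 2 *\<^sub>R f1 x) \<in> L2"
    by (intro L2_add v L2_scaleR[where C = 2] f1 continuous_intros) auto
  \<comment> \<open>p^2 f'' = p u + 2 x U, where u is bounded up to the ends and U vanishes
    there.\<close>
  have q0: "lim_pm1 (\<lambda>x. (1 - x\<^sup>2)\<^sup>2 *\<^sub>R f2 x) 0"
  proof (rule lim_pm1_cong)
    show "lim_pm1 (\<lambda>x. (1 - x\<^sup>2) *\<^sub>R u x + (2 * x) *\<^sub>R U x) 0"
      by (intro lim_pm1_add AC_closed_lim_pm1 uU lim_pm1_scaleR U0 continuous_intros)
  qed (simp add: u_def U_def complex_eq_iff algebra_simps power2_eq_square)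
  obtain C where C: "\<And>x. x \<in> {-1<..<1} \<Longrightarrow> (cmod ((1 - x\<^sup>2)\<^sup>2 *\<^sub>R f2 x))\<^sup>2 \<le> C * (1 - x\<^sup>2) ^ (2 * 1 + 1)"
    by (rule vanishing_at_ends_bound[OF ae_q k q0]) blast
  show f2: "f2 \<in> L2"
  proof (rule weighted_L2_boundary_controlled[OF ae(3), of "-2" C])
    show "(\<lambda>x. (1 - x\<^sup>2) *\<^sub>R f3 x + (2 * - 2 * x) *\<^sub>R f2 x) \<in> L2"
      by (rule L2_cong[OF k]) (simp add: v_def)
    fix x :: real assume x: "x \<in> {-1<..<1}"
    have p: "1 - x\<^sup>2 > 0" by (rule one_minus_square_pos[OF x])
    \<comment> \<open>The decay p^3 of |p^2 f''|^2 = p^4 |f''|^2 leaves exactly the bound on p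
      |f''|^2 that the weighted estimate asks for.\<close>
    have "(1 - x\<^sup>2) ^ 3 * ((1 - x\<^sup>2) * (cmod (f2 x))\<^sup>2) \<le> (1 - x\<^sup>2) ^ 3 * C"
      using C[OF x] by (simp add: power_mult_distrib power2_eq_square power3_eq_cube mult_ac)
    then show "(1 - x\<^sup>2) * (cmod (f2 x))\<^sup>2 \<le> C" using p by simp
  qed simp
  have f3: "(\<lambda>x. (1 - x\<^sup>2) *\<^sub>R f3 x) \<in> L2"
    by (rule L2_linear_comb[OF f1 f2 v, of _ 4 2]) (simp add: v_def)
  show "(\<lambda>x. (1 - x\<^sup>2)\<^sup>2 *\<^sub>R f4 x) \<in> L2"
    by (rule L2_cong[OF L2_add[OF g L2_g_terms[OF f1 f2 f3]]])
       (simp add: g_def complex_eq_iff algebra_simps)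
qed

text \<open>\<open>weighted_L2\<close> is applied to p f''' (c = 1) and then to f'' (c = 0). Besides
  square integrability it yields p^2 f''' -> 0 and p f'' -> 0, and with U these make up w = p^2 f'''
  - 4 x p f'' - 2 U and the second bracket.\<close>

lemma regularity_from_f4:
  assumes f4: "(\<lambda>x. (1 - x\<^sup>2)\<^sup>2 *\<^sub>R f4 x) \<in> L2"
  shows "v \<in> L2" "f2 \<in> L2" "g \<in> L2" "lim_pm1 U 0" "lim_pm1 w 0"
    "lim_pm1 (\<lambda>x. x *\<^sub>R w x - (1 - x\<^sup>2)\<^sup>2 *\<^sub>R f2 x + 2 *\<^sub>R ((1 - x\<^sup>2) *\<^sub>R f x)) 0"
proof -
  let ?z = "\<lambda>x. (1 - x\<^sup>2) *\<^sub>R f3 x"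
  have z: "has_ae_deriv ?z (\<lambda>x. (1 - x\<^sup>2) *\<^sub>R f4 x + (- 2 * x) *\<^sub>R f3 x)"
    by (rule has_ae_deriv_scaleR[OF poly_deriv(1) _ d3]) (intro continuous_intros)
  have "(\<lambda>x. (1 - x\<^sup>2) *\<^sub>R ((1 - x\<^sup>2) *\<^sub>R f4 x + (- 2 * x) *\<^sub>R f3 x) + (2 * 1 * x) *\<^sub>R ?z x) \<in> L2"
    by (rule L2_cong[OF f4]) (simp add: complex_eq_iff algebra_simps power2_eq_square)
  note f3 = weighted_L2[OF z zero_le_one this]
  have "(\<lambda>x. (1 - x\<^sup>2) *\<^sub>R f3 x + (2 * 0 * x) *\<^sub>R f2 x) \<in> L2" using f3(1) by simp
  note f2 = weighted_L2[OF ae(3) order_refl this]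
  show "f2 \<in> L2" by (rule f2(1))
  note f1 = f2L2_imp[OF f2(1)]
  show v: "v \<in> L2"
    by (rule L2_linear_comb[OF f1(2) f2(1) f3(1), of _ "-4" "-2"]) (simp add: v_def)
  have "(\<lambda>x. (- 1) *\<^sub>R ((8 * x) *\<^sub>R ((1 - x\<^sup>2) *\<^sub>R f3 x) + (- (14 * x\<^sup>2 - 6)) *\<^sub>R f2 x + (- 4 * x) *\<^sub>R f1 x)) \<in> L2"
    by (rule L2_scaleR[OF L2_g_terms[OF f1(2) f2(1) f3(1)], of _ 1]) auto
  from L2_add[OF f4 this] show "g \<in> L2"
    by (rule L2_cong) (simp add: g_def complex_eq_iff algebra_simps)
  show U0: "lim_pm1 U 0"
    using AC_closed_lim_pm1[OF f1(1)] by (simp add: U_def[abs_def])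
  have "lim_pm1 (\<lambda>x. (1 - x\<^sup>2) *\<^sub>R ?z x + ((- 4 * x) *\<^sub>R ((1 - x\<^sup>2) *\<^sub>R f2 x) + (- 2) *\<^sub>R U x)) 0"
    by (intro lim_pm1_add lim_pm1_scaleR f3(2) f2(2) U0 continuous_intros)
  then show w0: "lim_pm1 w 0"
    by (rule lim_pm1_cong) (simp add: w_def v_def U_def algebra_simps)
  have "lim_pm1 (\<lambda>x. x *\<^sub>R w x + ((- (1 - x\<^sup>2)) *\<^sub>R ((1 - x\<^sup>2) *\<^sub>R f2 x) + 2 *\<^sub>R ((1 - x\<^sup>2) *\<^sub>R f x))) 0"
    by (intro lim_pm1_add lim_pm1_scaleR[of "\<lambda>x. - (1 - x\<^sup>2)"] lim_pm1_scaleR[of "\<lambda>x. x"] lim_pm1_scaleR[of "\<lambda>x. 2"]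
        w0 f2(2) AC_closed_lim_pm1 f1(3) continuous_intros)
  then show "lim_pm1 (\<lambda>x. x *\<^sub>R w x - (1 - x\<^sup>2)\<^sup>2 *\<^sub>R f2 x + 2 *\<^sub>R ((1 - x\<^sup>2) *\<^sub>R f x)) 0"
    by (rule lim_pm1_cong) (simp add: complex_eq_iff algebra_simps power2_eq_square)
qed

text \<open>w -> 0 and g in \<open>L2\<close> already put v in \<open>L2\<close>, so u and U extend
  continuously to the ends and p u and p U vanish there. So does p f, by \<open>weighted_L2\<close>
  with c = 0, because p f' = U is in \<open>L2\<close>. The second bracket then decides the limit of
  U.\<close>

lemma U_lim_from_brackets:
  assumes w0: "lim_pm1 w 0" and g: "g \<in> L2"
    and b0: "lim_pm1 (\<lambda>x. x *\<^sub>R w x - (1 - x\<^sup>2)\<^sup>2 *\<^sub>R f2 x + 2 *\<^sub>R ((1 - x\<^sup>2) *\<^sub>R f x)) 0"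
  shows "lim_pm1 U 0"
proof -
  have v: "v \<in> L2"
    by (rule Hardy_L2[OF _ g ae_v]) (use ae_w w0 in \<open>simp_all add: w_def[abs_def]\<close>)
  note uU = vL2_imp[OF v]
  have "U \<in> L2" by (rule AC_closed_L2[OF has_ae_deriv_AC_loc[OF ae_Uu(1)] uU(3)])
  then have "(\<lambda>x. (1 - x\<^sup>2) *\<^sub>R f1 x + (2 * 0 * x) *\<^sub>R f x) \<in> L2" by (simp add: U_def[abs_def])
  from weighted_L2(2)[OF ae(1) order_refl this]
  have pf: "lim_pm1 (\<lambda>x. (1 - x\<^sup>2) *\<^sub>R f x) 0" .
  \<comment> \<open>With b the second bracket, p^2 f'' = p u + 2 x U gives x w - p u + 2 p f - b = 2
    x U. Multiplication by x / 2 produces x^2 U, and adding p U restores U because x^2 + p =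
    1.\<close>
  have "lim_pm1 (\<lambda>x. (x / 2) *\<^sub>R (x *\<^sub>R w x + ((- 1) *\<^sub>R ((1 - x\<^sup>2) *\<^sub>R u x) + (2 *\<^sub>R ((1 - x\<^sup>2) *\<^sub>R f x)
      + (- 1) *\<^sub>R (x *\<^sub>R w x - (1 - x\<^sup>2)\<^sup>2 *\<^sub>R f2 x + 2 *\<^sub>R ((1 - x\<^sup>2) *\<^sub>R f x))))) + (1 - x\<^sup>2) *\<^sub>R U x) 0"
    by (intro lim_pm1_add lim_pm1_scaleR[of "\<lambda>x. x / 2"] lim_pm1_scaleR[of "\<lambda>x. x"] lim_pm1_scaleR[of "\<lambda>x. 2"]
        lim_pm1_scaleR[of "\<lambda>x. - 1"] w0 b0 pf AC_closed_lim_pm1 uU continuous_intros) auto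
  then show ?thesis
  proof (rule lim_pm1_cong)
    fix x :: real
    show "U x = (x / 2) *\<^sub>R (x *\<^sub>R w x + ((- 1) *\<^sub>R ((1 - x\<^sup>2) *\<^sub>R u x) + (2 *\<^sub>R ((1 - x\<^sup>2) *\<^sub>R f x)
      + (- 1) *\<^sub>R (x *\<^sub>R w x - (1 - x\<^sup>2)\<^sup>2 *\<^sub>R f2 x + 2 *\<^sub>R ((1 - x\<^sup>2) *\<^sub>R f x))))) + (1 - x\<^sup>2) *\<^sub>R U x"
      by (simp add: u_def U_def complex_eq_iff field_simps power2_eq_square)
  qed
qed

end

subsection \<open>The four domains\<close>

lemma AC_loc_upto_3_jet:
  assumes "f \<in> AC_loc_upto 3"
  shows "legendre_jet f (vd f) ((vd ^^ 2) f) ((vd ^^ 3) f) ((vd ^^ 4) f)"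
proof -
  have d: "((vd ^^ k) f has_vector_derivative (vd ^^ Suc k) f x) (at x)" if "k < 3" "x \<in> {-1<..<1}" for k x
    using assms that by (auto simp: AC_loc_upto_def vd_def vector_derivative_works)
  have ac: "(vd ^^ 3) f \<in> AC_loc" using assms by (simp add: AC_loc_upto_def)
  show ?thesis
  proof
    fix x :: real assume x: "x \<in> {-1<..<1}"
    show "(f has_vector_derivative vd f x) (at x)" using d[OF _ x, of 0] by simp
    show "(vd f has_vector_derivative (vd ^^ 2) f x) (at x)" using d[OF _ x, of 1] by (simp add: numeral_2_eq_2)
    show "((vd ^^ 2) f has_vector_derivative (vd ^^ 3) f x) (at x)" using d[OF _ x, of 2] by (simp add: numeral_3_eq_3 numeral_2_eq_2)
  next
    show "has_ae_deriv ((vd ^^ 3) f) ((vd ^^ 4) f)"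
      using has_ae_deriv_vd[OF ac] by (simp add: eval_nat_numeral)
  qed
qed

lemma funpow_2: "(F ^^ 2) y = F (F y)"
  by (simp add: numeral_2_eq_2)

lemma mult_two_scaleR: "2 * z = 2 *\<^sub>R (z :: complex)"
  by (simp add: scaleR_conv_of_real)

lemma AC_loc_upto_1I:
  assumes "\<And>x. x \<in> {-1<..<1} \<Longrightarrow> (f has_vector_derivative f1 x) (at x)"
    and "f \<in> AC_loc" "f1 \<in> AC_loc"
  shows "f \<in> AC_loc_upto 1"
proof -
  have "vd f x = f1 x" if "x \<in> {-1<..<1}" for x by (rule vd_eqI[OF assms(1)[OF that]])
  then have "vd f \<in> AC_loc" by (rule AC_loc_cong[OF assms(3)])
  moreover have "f differentiable (at x)" if "x \<in> {-1<..<1}" for x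
    by (rule differentiableI_vector[OF assms(1)[OF that]])
  ultimately show ?thesis
    using assms(2) by (auto simp: AC_loc_upto_def le_Suc_eq)
qed

lemma legendre_jet_AC_loc_upto_3:
  assumes "legendre_jet f f1 f2 f3 f4"
  shows "f \<in> AC_loc_upto 3"
proof -
  interpret legendre_jet f f1 f2 f3 f4 by fact
  have v1: "vd f x = f1 x" if "x \<in> {-1<..<1}" for x by (rule vd_eqI[OF d0[OF that]])
  have e1: "(vd f has_vector_derivative f2 x) (at x)" if "x \<in> {-1<..<1}" for x
    by (rule has_vector_derivative_cong_OI[OF d1[OF that] that v1])
  have v2: "vd (vd f) x = f2 x" if "x \<in> {-1<..<1}" for x by (rule vd_eqI[OF e1[OF that]])
  have e2: "(vd (vd f) has_vector_derivative f3 x) (at x)" if "x \<in> {-1<..<1}" for x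
    by (rule has_vector_derivative_cong_OI[OF d2[OF that] that v2])
  have v3: "vd (vd (vd f)) x = f3 x" if "x \<in> {-1<..<1}" for x by (rule vd_eqI[OF e2[OF that]])
  have "vd f \<in> AC_loc" "vd (vd f) \<in> AC_loc" "vd (vd (vd f)) \<in> AC_loc"
    using AC_loc_cong[OF AC(2) v1] AC_loc_cong[OF AC(3) v2] AC_loc_cong[OF AC(4) v3] by auto
  moreover have "f differentiable (at x)" "vd f differentiable (at x)" "vd (vd f) differentiable (at x)"
    if "x \<in> {-1<..<1}" for x
    by (rule differentiableI_vector[OF d0[OF that]] differentiableI_vector[OF e1[OF that]]
        differentiableI_vector[OF e2[OF that]])+
  ultimately show ?thesis
    using AC(1) by (auto simp: AC_loc_upto_def numeral_3_eq_3 less_Suc_eq le_Suc_eq)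
qed

section \<open>The Legendre expressions and brackets in terms of \<open>u\<close>, \<open>v\<close>,
  \<open>w\<close> and \<open>g\<close>\<close>

context legendre_jet
begin

lemma vds:
  assumes "x \<in> {-1<..<1}"
  shows "vd f x = f1 x" "(vd ^^ 2) f x = f2 x"
proof -
  have v1: "vd f x = f1 x" if "x \<in> {-1<..<1}" for x by (rule vd_eqI[OF d0[OF that]])
  have "(vd f has_vector_derivative f2 x) (at x)" if "x \<in> {-1<..<1}" for x
    by (rule has_vector_derivative_cong_OI[OF d1[OF that] that v1])
  then show "vd f x = f1 x" "(vd ^^ 2) f x = f2 x"
    using assms v1 by (auto simp: numeral_2_eq_2 intro: vd_eqI)
qed

lemma leg_eq:
  assumes "x \<in> {-1<..<1}"
  shows "leg f x = - u x"
proof -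
  have "vd (\<lambda>t. (1 - t\<^sup>2) *\<^sub>R vd f t) x = vd U x"
    by (rule vd_cong[OF _ assms]) (simp add: vds U_def)
  then show ?thesis by (simp add: leg_def vd_eqI[OF dU[OF assms]])
qed

lemma leg_deriv: "x \<in> {-1<..<1} \<Longrightarrow> (leg f has_vector_derivative - v x) (at x)"
  by (rule has_vector_derivative_cong_OI[OF has_vector_derivative_minus[OF du]]) (auto simp: leg_eq)

lemma vd_leg: "x \<in> {-1<..<1} \<Longrightarrow> vd (leg f) x = - v x"
  by (rule vd_eqI[OF leg_deriv])

lemma vd_q:
  assumes "x \<in> {-1<..<1}"
  shows "vd (\<lambda>t. ((1 - t\<^sup>2)\<^sup>2) *\<^sub>R (vd ^^ 2) f t) x = w x + 2 *\<^sub>R U x"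
proof -
  have "vd (\<lambda>t. ((1 - t\<^sup>2)\<^sup>2) *\<^sub>R (vd ^^ 2) f t) x = vd (\<lambda>t. (1 - t\<^sup>2)\<^sup>2 *\<^sub>R f2 t) x"
    by (rule vd_cong[OF _ assms]) (simp add: vds)
  then show ?thesis by (simp add: vd_eqI[OF dq[OF assms]])
qed

lemma bracket_1_eq: "x \<in> {-1<..<1} \<Longrightarrow> bracket_1 f x = w x"
  unfolding bracket_1_def mult_two_scaleR by (simp add: vd_q vds U_def)

lemma bracket_x_eq: "x \<in> {-1<..<1} \<Longrightarrow>
    bracket_x f x = x *\<^sub>R w x - (1 - x\<^sup>2)\<^sup>2 *\<^sub>R f2 x + 2 *\<^sub>R ((1 - x\<^sup>2) *\<^sub>R f x)"
  unfolding bracket_x_def mult_two_scaleR by (simp add: bracket_1_eq vds)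

text \<open>Equality holds almost everywhere only, since the outermost \<open>vd\<close> may meet
  points without derivative. There (p^2 f'')' = w + 2 U is differentiated once more to g + 2 u, and
  the second order term of \<open>leg_sq\<close> cancels 2 u.\<close>

lemma leg_sq_eq: "negligible {x\<in>{-1<..<1}. leg_sq f x \<noteq> g x}"
proof -
  let ?q = "vd (\<lambda>t. ((1 - t\<^sup>2)\<^sup>2) *\<^sub>R (vd ^^ 2) f t)"
  have "has_ae_deriv (\<lambda>x. 2 *\<^sub>R U x) (\<lambda>x. 2 *\<^sub>R u x + 0 *\<^sub>R U x)"
    by (rule has_ae_deriv_scaleR[OF _ _ ae_Uu(1)]) (auto intro!: derivative_eq_intros)
  from has_ae_deriv_add[OF ae_w this] have h: "has_ae_deriv ?q (\<lambda>x. g x + 2 *\<^sub>R u x)"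
    by (rule has_ae_deriv_cong') (simp_all add: vd_q)
  from has_ae_deriv_unique[OF has_ae_deriv_vd[OF has_ae_deriv_AC_loc[OF h]] h]
  have "negligible {x\<in>{-1<..<1}. vd ?q x \<noteq> g x + 2 *\<^sub>R u x}" .
  moreover have "leg_sq f x = vd ?q x - 2 *\<^sub>R u x" if "x \<in> {-1<..<1}" for x
    using leg_eq[OF that] unfolding leg_sq_def leg_def funpow_2 mult_two_scaleR by simp
  ultimately show ?thesis
    by (elim negligible_subset) auto
qed

lemma leg_sq_L2_iff: "leg_sq f \<in> L2 \<longleftrightarrow> g \<in> L2"
proof -
  have "negligible {x\<in>{-1<..<1}. g x \<noteq> leg_sq f x}"
    using leg_sq_eq by (rule negligible_subset) auto
  then show ?thesis using leg_sq_eq L2_cong_ae by blast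
qed

lemma lim_pm1_eqs:
  "lim_pm1 (bracket_1 f) 0 \<longleftrightarrow> lim_pm1 w 0"
  "lim_pm1 (bracket_x f) 0 \<longleftrightarrow> lim_pm1 (\<lambda>x. x *\<^sub>R w x - (1 - x\<^sup>2)\<^sup>2 *\<^sub>R f2 x + 2 *\<^sub>R ((1 - x\<^sup>2) *\<^sub>R f x)) 0"
  "lim_pm1 (\<lambda>x. (1 - x\<^sup>2) *\<^sub>R vd f x) 0 \<longleftrightarrow> lim_pm1 U 0"
  "lim_pm1 (vd (\<lambda>t. ((1 - t\<^sup>2)\<^sup>2) *\<^sub>R (vd ^^ 2) f t)) 0 \<longleftrightarrow> lim_pm1 (\<lambda>x. w x + 2 *\<^sub>R U x) 0"
  by (auto elim!: lim_pm1_cong simp: bracket_1_eq bracket_x_eq vd_q vds U_def)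

end

text \<open>The inclusions from the hub outwards, together with the regularity asserted in the
  theorem. For \<open>dom_A_sq\<close> the representative is \<open>leg f\<close> itself: p (leg f)'
  = - w gives its boundary condition, and \<open>leg (leg f)\<close> equals g almost
  everywhere.\<close>

lemma set_B_regularity:
  assumes "f \<in> set_B"
  shows "f \<in> dom_A_sq" "f \<in> dom_S" "f \<in> set_D"
    "(vd ^^ 2) f \<in> L2" "f \<in> AC_closed" "vd f \<in> AC_closed" "vd (leg f) \<in> L2" "leg f \<in> AC_closed"
proof -
  have f: "f \<in> AC_loc_upto 3" using assms by (simp add: set_B_def)
  interpret legendre_jet f "vd f" "(vd ^^ 2) f" "(vd ^^ 3) f" "(vd ^^ 4) f"
    by (rule AC_loc_upto_3_jet[OF f])
  have "(\<lambda>x. (1 - x\<^sup>2)\<^sup>2 *\<^sub>R (vd ^^ 4) f x) \<in> L2" using assms by (simp add: set_B_def)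
  note reg = regularity_from_f4[OF this]
  note f12 = f2L2_imp[OF reg(2)] and uU = vL2_imp[OF reg(1)]
  show "(vd ^^ 2) f \<in> L2" "f \<in> AC_closed" "vd f \<in> AC_closed" by fact+
  have neg: "(\<lambda>x. - F x) \<in> L2" if "F \<in> L2" for F
    using L2_scaleR[OF that, of "\<lambda>x. -1" 1] by simp
  show vleg: "vd (leg f) \<in> L2"
    by (rule L2_cong[OF neg[OF reg(1)]]) (rule vd_leg)
  have AC_leg: "leg f \<in> AC_loc"
    by (rule AC_loc_C1[OF leg_deriv], assumption) (intro continuous_intros cont_uv)
  have AC_v: "(\<lambda>x. - v x) \<in> AC_loc"
    using AC_loc_scaleR[of "\<lambda>x. -1" "\<lambda>x. 0" v, OF _ _ has_ae_deriv_AC_loc[OF ae_v]] by simp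
  have "has_ae_deriv (leg f) (vd (leg f))" by (rule has_ae_deriv_vd[OF AC_leg])
  then show leg_closed: "leg f \<in> AC_closed" by (rule L2_deriv_imp_AC_closed) (rule vleg)
  have legL2: "leg f \<in> L2" by (rule AC_closed_L2[OF AC_leg leg_closed])
  have fmax: "f \<in> Delta2_max"
    using f f12(4) reg(3) by (simp add: Delta2_max_def leg_sq_L2_iff)
  then show "f \<in> dom_S" using reg by (simp add: dom_S_def lim_pm1_eqs)
  have "lim_pm1 (\<lambda>x. w x + 2 *\<^sub>R U x) 0"
    by (intro lim_pm1_add lim_pm1_scaleR reg continuous_intros)
  with fmax show "f \<in> set_D" using reg(4) by (simp add: set_D_def lim_pm1_eqs)
  have fA: "f \<in> dom_A"
    using AC_loc_upto_1I[OF d0 AC(1,2)] f12(4) legL2 reg(4) by (simp add: dom_A_def lim_pm1_eqs)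
  have pvd: "(1 - x\<^sup>2) *\<^sub>R vd (leg f) x = - w x" if "x \<in> {-1<..<1}" for x
    using vd_leg[OF that] by (simp add: w_def)
  have "leg f \<in> dom_A"
    unfolding dom_A_def
  proof (intro CollectI conjI legL2)
    show "leg f \<in> AC_loc_upto 1"
      by (rule AC_loc_upto_1I[OF leg_deriv AC_leg AC_v])
    have "lim_pm1 (\<lambda>x. (-1) *\<^sub>R w x) 0"
      by (intro lim_pm1_scaleR reg continuous_intros)
    then show "lim_pm1 (\<lambda>x. (1 - x\<^sup>2) *\<^sub>R vd (leg f) x) 0"
      by (rule lim_pm1_cong) (simp add: pvd)
    have "has_ae_deriv (\<lambda>x. (-1) *\<^sub>R w x) (\<lambda>x. (-1) *\<^sub>R g x + 0 *\<^sub>R w x)"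
      by (rule has_ae_deriv_scaleR[OF _ _ ae_w]) (auto intro!: derivative_eq_intros)
    then have h: "has_ae_deriv (\<lambda>x. (1 - x\<^sup>2) *\<^sub>R vd (leg f) x) (\<lambda>x. - g x)"
      by (rule has_ae_deriv_cong') (simp_all add: pvd)
    have "negligible {x\<in>{-1<..<1}. leg (leg f) x \<noteq> g x}"
      using has_ae_deriv_unique[OF has_ae_deriv_vd[OF has_ae_deriv_AC_loc[OF h]] h]
      by (rule negligible_subset) (auto simp: leg_def)
    then show "leg (leg f) \<in> L2" by (rule L2_cong_ae[OF reg(3)])
  qed
  with fA show "f \<in> dom_A_sq" unfolding dom_A_sq_def by auto
qed

text \<open>The common last step of the inclusions into \<open>set_B\<close>; what differs among
  them is how U -> 0 and w -> 0 are reached.\<close>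

lemma set_B_if_limits:
  assumes f: "f \<in> AC_loc_upto 3"
    and "lim_pm1 (\<lambda>x. (1 - x\<^sup>2) *\<^sub>R vd f x) 0" "lim_pm1 (bracket_1 f) 0" "leg_sq f \<in> L2"
  shows "f \<in> set_B"
proof -
  interpret legendre_jet f "vd f" "(vd ^^ 2) f" "(vd ^^ 3) f" "(vd ^^ 4) f"
    by (rule AC_loc_upto_3_jet[OF f])
  show ?thesis
    using assms regularity_from_limits(3) by (simp add: set_B_def lim_pm1_eqs leg_sq_L2_iff)
qed

lemma dom_S_imp_set_B:
  assumes "f \<in> dom_S"
  shows "f \<in> set_B"
proof -
  have f: "f \<in> AC_loc_upto 3" using assms by (simp add: dom_S_def Delta2_max_def)
  interpret legendre_jet f "vd f" "(vd ^^ 2) f" "(vd ^^ 3) f" "(vd ^^ 4) f"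
    by (rule AC_loc_upto_3_jet[OF f])
  show ?thesis
    using assms U_lim_from_brackets
    by (intro set_B_if_limits[OF f]) (auto simp: dom_S_def Delta2_max_def lim_pm1_eqs leg_sq_L2_iff)
qed

lemma set_D_imp_set_B:
  assumes "f \<in> set_D"
  shows "f \<in> set_B"
proof -
  have f: "f \<in> AC_loc_upto 3" using assms by (simp add: set_D_def Delta2_max_def)
  interpret legendre_jet f "vd f" "(vd ^^ 2) f" "(vd ^^ 3) f" "(vd ^^ 4) f"
    by (rule AC_loc_upto_3_jet[OF f])
  have lims: "lim_pm1 U 0" "lim_pm1 (\<lambda>x. w x + 2 *\<^sub>R U x) 0"
    using assms by (simp_all add: set_D_def lim_pm1_eqs)
  have "lim_pm1 (\<lambda>x. (w x + 2 *\<^sub>R U x) + (-2) *\<^sub>R U x) 0"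
    by (intro lim_pm1_add[OF lims(2)] lim_pm1_scaleR lims continuous_intros)
  then have "lim_pm1 w 0" by simp
  then show ?thesis
    using assms by (intro set_B_if_limits[OF f]) (auto simp: set_D_def Delta2_max_def lim_pm1_eqs)
qed

text \<open>An almost everywhere representative of \<open>\<ell>[f]\<close> that is continuously differentiable forces \<open>f\<close> to have
  three continuous derivatives, by solving \<open>((1 - x\<^sup>2) f')' = - h\<close> for the highest one.\<close>

lemma dom_A_sq_imp_set_B:
  assumes "f \<in> dom_A_sq"
  shows "f \<in> set_B"
proof -
  obtain h where fA: "f \<in> dom_A" and hA: "h \<in> dom_A" and hf: "AE x in lebesgue_on {-1<..<1}. h x = leg f x"
    using assms by (auto simp: dom_A_sq_def)
  define f1 h1 where "f1 = vd f" and "h1 = vd h"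
  have f1: "(f has_vector_derivative f1 x) (at x)" and h1: "(h has_vector_derivative h1 x) (at x)"
    if "x \<in> {-1<..<1}" for x
    using fA hA that by (auto simp: dom_A_def AC_loc_upto_def vd_def f1_def h1_def vector_derivative_works)
  have AC: "f1 \<in> AC_loc" "h \<in> AC_loc" "h1 \<in> AC_loc"
    using fA hA by (auto simp: dom_A_def AC_loc_upto_def f1_def h1_def)
  note cont = AC[THEN continuous_on_AC_loc]
  let ?U = "\<lambda>t. (1 - t\<^sup>2) *\<^sub>R f1 t"
  have UAC: "?U \<in> AC_loc"
    by (rule AC_loc_scaleR[OF _ _ AC(1), of _ "\<lambda>x. - 2 * x"]) (auto intro!: derivative_eq_intros continuous_intros)
  have "negligible {x\<in>{-1<..<1}. - h x \<noteq> vd ?U x}"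
  proof -
    have "AE x in lebesgue. x \<in> {-1<..<1} \<longrightarrow> h x = leg f x"
      using hf by (subst (asm) AE_restrict_space_iff) auto
    then have "negligible {x. \<not> (x \<in> {-1<..<1} \<longrightarrow> h x = leg f x)}"
      unfolding eventually_ae_filter_negligible by (blast intro: negligible_subset)
    then show ?thesis
      by (rule negligible_subset) (auto simp: leg_def f1_def)
  qed
  then have "has_ae_deriv ?U (\<lambda>x. - h x)"
    by (rule has_ae_deriv_cong[OF has_ae_deriv_vd[OF UAC] refl])
  \<comment> \<open>\<open>h\<close> is continuous, so the derivative of U, known almost everywhere,
    becomes classical on all of (-1,1).\<close>
  from has_ae_deriv_continuous[OF this]
  have hU: "(?U has_vector_derivative - h x) (at x)" if "x \<in> {-1<..<1}" for x
    using that by (auto intro!: continuous_intros cont)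
  \<comment> \<open>f' = c U with c = 1 / p. The function c'' enters as the continuous derivative
    that lets c' act as a coefficient in \<open>AC_loc_scaleR\<close>.\<close>
  define c c' c'' :: "real \<Rightarrow> real"
    where "c = (\<lambda>x. 1 / (1 - x\<^sup>2))" and "c' = (\<lambda>x. 2 * x / (1 - x\<^sup>2)\<^sup>2)"
      and "c'' = (\<lambda>x. 2 / (1 - x\<^sup>2)\<^sup>2 + 8 * x\<^sup>2 / (1 - x\<^sup>2) ^ 3)"
  have p: "1 - x\<^sup>2 \<noteq> 0" if "x \<in> {-1<..<1}" for x :: real
    using one_minus_square_pos[OF that] by simp
  have dc: "(c has_real_derivative c' x) (at x)" "(c' has_real_derivative c'' x) (at x)"
    if x: "x \<in> {-1<..<1}" for x
  proof -
    have dp: "((\<lambda>x. 1 - x\<^sup>2) has_real_derivative - 2 * x) (at x)"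
      by (auto intro!: derivative_eq_intros)
    show "(c has_real_derivative c' x) (at x)"
      unfolding c_def c'_def
      by (rule DERIV_cong[OF DERIV_divide[OF DERIV_const dp p[OF x]]]) (simp add: power2_eq_square)
    have d2p: "((\<lambda>x. (1 - x\<^sup>2)\<^sup>2) has_real_derivative - 4 * x * (1 - x\<^sup>2)) (at x)"
      by (auto intro!: derivative_eq_intros)
    have eq: "(2 * y\<^sup>2 - 2 * x * (- 4 * x * y)) / (y\<^sup>2 * y\<^sup>2) = 2 / y\<^sup>2 + 8 * x\<^sup>2 / y ^ 3"
      if "y \<noteq> 0" for y :: real
      using that by (simp add: field_simps power2_eq_square power3_eq_cube)
    have "(1 - x\<^sup>2)\<^sup>2 \<noteq> 0" using p[OF x] by simp
    from DERIV_divide[OF DERIV_cmult_Id d2p this, of 2]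
    show "(c' has_real_derivative c'' x) (at x)"
      unfolding c'_def c''_def by (rule DERIV_cong) (rule eq[OF p[OF x]])
  qed
  have cc: "continuous_on {-1<..<1} c'" "continuous_on {-1<..<1} c''"
    unfolding c'_def c''_def using p by (auto intro!: continuous_intros)
  \<comment> \<open>Solving U' = - h for f'' gives c (2 x f' - h). \<open>f3\<close> is the
    derivative of this product, in which h' exists at every point.\<close>
  define f2 where "f2 = (\<lambda>x. c x *\<^sub>R ((2 * x) *\<^sub>R f1 x - h x))"
  define f3 where "f3 = (\<lambda>x. c x *\<^sub>R ((2 * x) *\<^sub>R f2 x + 2 *\<^sub>R f1 x - h1 x) + c' x *\<^sub>R ((2 * x) *\<^sub>R f1 x - h x))"
  have d1: "(f1 has_vector_derivative f2 x) (at x)" if x: "x \<in> {-1<..<1}" for x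
  proof -
    have "((\<lambda>x. c x *\<^sub>R ?U x) has_vector_derivative c x *\<^sub>R (- h x) + c' x *\<^sub>R ?U x) (at x)"
      by (rule has_vector_derivative_scaleR[OF dc(1)[OF x] hU[OF x]])
    moreover have "c x *\<^sub>R (- h x) + c' x *\<^sub>R ?U x = f2 x"
    proof -
      have "c' x * (1 - x\<^sup>2) = c x * (2 * x)"
        using p[OF x] by (simp add: c_def c'_def power2_eq_square)
      then have "c' x *\<^sub>R ?U x = c x *\<^sub>R (2 * x) *\<^sub>R f1 x" by (simp only: scaleR_scaleR)
      then show ?thesis by (simp only: f2_def scaleR_diff_right scaleR_minus_right) simp
    qed
    ultimately show ?thesis
      using has_vector_derivative_cong_OI[of "\<lambda>x. c x *\<^sub>R ?U x" "f2 x" x f1] x p by (simp add: c_def)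
  qed
  have d2: "(f2 has_vector_derivative f3 x) (at x)" if x: "x \<in> {-1<..<1}" for x
    unfolding f2_def f3_def
    by (rule derivative_eq_intros dc(1)[OF x] d1[OF x] h1[OF x] refl | simp add: f2_def)+
  have lin: "(\<lambda>x. (2 * x) *\<^sub>R F x) \<in> AC_loc" if "F \<in> AC_loc" for F
    by (rule AC_loc_scaleR[OF _ _ that, of _ "\<lambda>x. 2"]) (auto intro!: derivative_eq_intros)
  have const: "(\<lambda>x. a *\<^sub>R F x) \<in> AC_loc" if "F \<in> AC_loc" for F a
    by (rule AC_loc_scaleR[OF _ _ that, of _ "\<lambda>x. 0"]) (auto intro!: derivative_eq_intros)
  have cf2: "continuous_on {-1<..<1} f3"
  proof -
    have "continuous_on {-1<..<1} f2"
      using d1 has_vector_derivative_continuous[OF d2] by (simp add: continuous_at_imp_continuous_on)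
    moreover have "continuous_on {-1<..<1} c"
      using dc(1) by (meson DERIV_isCont continuous_at_imp_continuous_on)
    ultimately show ?thesis
      unfolding f3_def by (intro continuous_intros cont cc)
  qed
  have AC2: "f2 \<in> AC_loc" by (rule AC_loc_C1[OF d2 cf2])
  have "(\<lambda>x. c x *\<^sub>R ((2 * x) *\<^sub>R f2 x + 2 *\<^sub>R f1 x + (-1) *\<^sub>R h1 x) + c' x *\<^sub>R ((2 * x) *\<^sub>R f1 x + (-1) *\<^sub>R h x)) \<in> AC_loc"
    by (intro AC_loc_add AC_loc_scaleR[OF dc(1) cc(1)] AC_loc_scaleR[OF dc(2) cc(2)] lin const AC AC2)
  then have AC3: "f3 \<in> AC_loc" by (simp add: f3_def)
  have jet: "legendre_jet f f1 f2 f3 (vd f3)"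
    by standard (use f1 d1 d2 has_ae_deriv_vd[OF AC3] in auto)
  interpret legendre_jet f f1 f2 f3 "vd f3" by (rule jet)
  have f: "f \<in> AC_loc_upto 3" by (rule legendre_jet_AC_loc_upto_3[OF jet])
  have uh: "u x = - h x" if "x \<in> {-1<..<1}" for x
    using vector_derivative_unique_at[OF dU[OF that]] hU[OF that] by (simp add: U_def[abs_def])
  have vh: "v x = - h1 x" if x: "x \<in> {-1<..<1}" for x
    using vector_derivative_unique_at[OF du[OF x]
        has_vector_derivative_cong_OI[OF has_vector_derivative_minus[OF h1[OF x]] x uh]] by simp
  \<comment> \<open>u = - h implies w = - p h', so the boundary condition on \<open>h\<close> is w
    -> 0, and \<open>leg h\<close> agrees with g almost everywhere.\<close>
  have pw: "(1 - x\<^sup>2) *\<^sub>R vd h x = - w x" if "x \<in> {-1<..<1}" for x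
    using vh[OF that] by (simp add: w_def h1_def)
  have "lim_pm1 (\<lambda>x. (-1) *\<^sub>R ((1 - x\<^sup>2) *\<^sub>R vd h x)) 0"
    by (rule lim_pm1_scaleR) (use hA in \<open>simp_all add: dom_A_def\<close>)
  then have w0: "lim_pm1 w 0"
    by (rule lim_pm1_cong) (simp add: pw)
  have "has_ae_deriv (\<lambda>x. (-1) *\<^sub>R w x) (\<lambda>x. (-1) *\<^sub>R g x + 0 *\<^sub>R w x)"
    by (rule has_ae_deriv_scaleR[OF _ _ ae_w]) (auto intro!: derivative_eq_intros)
  then have hd: "has_ae_deriv (\<lambda>x. (1 - x\<^sup>2) *\<^sub>R vd h x) (\<lambda>x. - g x)"
    by (rule has_ae_deriv_cong') (simp_all add: pw)
  have "negligible {x\<in>{-1<..<1}. g x \<noteq> leg h x}"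
    using has_ae_deriv_unique[OF has_ae_deriv_vd[OF has_ae_deriv_AC_loc[OF hd]] hd]
    by (rule negligible_subset) (auto simp: leg_def)
  then have "g \<in> L2" using hA L2_cong_ae by (auto simp: dom_A_def)
  then show ?thesis
    using fA w0 by (intro set_B_if_limits[OF f]) (auto simp: dom_A_def lim_pm1_eqs leg_sq_L2_iff)
qed

theorem corollary1:
  shows "dom_A_sq = dom_S \<and> dom_S = set_B \<and> set_B = set_D \<and>
         (\<forall>f\<in>dom_A_sq.
            ((vd ^^ 2) f \<in> L2 \<and> f \<in> AC_closed \<and> vd f \<in> AC_closed) \<and>
            (vd (leg f) \<in> L2 \<and> leg f \<in> AC_closed))"
proof -
  have "dom_A_sq = set_B" "dom_S = set_B" "set_D = set_B"
    using set_B_regularity(1-3) dom_A_sq_imp_set_B dom_S_imp_set_B set_D_imp_set_B by blast+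
  then show ?thesis using set_B_regularity(4-8) by simp
qed

end
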